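(* Let $\alpha\in(0,2)\setminus\{1\}$, $a>0$ and $\beta\in\left(1-\alpha,\frac{1}{1+\alpha}\right)$, and put $$c_1=(a(1-\beta))^{\frac1{1-\beta}},\qquad \gamma=\frac{\beta}{1-\beta},\qquad \rho=1-\frac{\alpha\beta}{1-\beta},\qquad r=\frac{\alpha+\beta-1}{\alpha}.$$ Let $B_\alpha$ be a strictly $\alpha$-stable process with Lévy measure $(c_+\mathbf 1_{u>0}+c_-\mathbf 1_{u<0})|u|^{-1-\alpha}\,du$, where $c_+,c_-\ge 0$ and $c_++c_->0$. Let $f:\mathbb R\to\mathbb R$ be a $\mathcal C^1$ function such that, as $x\to+\infty$, $(\ln f)'(x)=O(1/x)$ and $f(x)=ax^\beta+o(x^{\beta-r})$. Let $X$ be a solution of the stochastic differential equation $$dX(t)=f(X(t))\,dt+dB_\alpha(t),\qquad t\ge 0,$$ and assume that $\lim_{t\to\infty}X(t)=+\infty$ almost surely. For $\lambda>0$ define $$X^{(\lambda)}(t)=\frac{X(\lambda t)-c_1(\lambda t)^{\frac1{1-\beta}}}{(\lambda/\rho)^{1/\alpha}},\qquad t\in[0,\infty).$$ Then, as $\lambda\to\infty$, the processes $X^{(\lambda)}$ converge in distribution to the process $t\mapsto t^\gamma B_\alpha(t^\rho)$, in the space of càdlàg functions endowed with the topology of local uniform convergence on $(0,\infty)$. Moreover, if $\beta\ge 0$, this convergence in distribution of $X^{(\lambda)}$ holds locally uniformly on $[0,\infty)$ (i.e. for the topology of local uniform convergence on $[0,\infty)$); and if $\beta<0$, then $(t^{-\gamma}X^{(\lambda)}(t))_{t\in[0,\infty)}$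 converges in distribution to $(B_\alpha(t^\rho))_{t\in[0,\infty)}$ locally uniformly on $[0,\infty)$.
   Context: A strictly $\alpha$-stable process is a Lévy process $B_\alpha$ with $B_\alpha(0)=0$ such that $(B_\alpha(\lambda t))_{t\ge0}$ and $(\lambda^{1/\alpha}B_\alpha(t))_{t\ge0}$ have the same law for every $\lambda>0$ (for $\alpha<1$ it is the sum of its jumps, with no drift; for $\alpha>1$ it is a centred, fully compensated jump process). A solution $X$ of the SDE is a càdlàg process, adapted to a filtration with respect to which $B_\alpha$ is a Lévy process, defined for all $t\ge0$ and satisfying $X(t)=X(0)+\int_0^t f(X(s))\,ds+B_\alpha(t)$. The condition on $(\ln f)'=f'/f$ concerns large $x$, where $f>0$. *)

theory Defs
  imports "HOL-Probability.Probability" "HOL-Library.Landau_Symbols"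
begin

section \<open>The space of cadlag functions with the topology of local uniform convergence\<close>

text \<open>
  Cadlag functions on \<open>I\<close>, to be used with \<open>I = {0..}\<close> or \<open>I = {0<..}\<close>. At the left endpoint of
  \<open>{0..}\<close> the filter in the second condition is trivial, so no left limit is required there.
\<close>

definition cadlag_on :: "real set \<Rightarrow> (real \<Rightarrow> real) \<Rightarrow> bool" where
  "cadlag_on I x \<longleftrightarrow>
     (\<forall>t\<in>I. (x \<longlongrightarrow> x t) (at t within I \<inter> {t<..}) \<and> (\<exists>l. (x \<longlongrightarrow> l) (at t within I \<inter> {..<t})))"

definition cadlag_paths :: "real set \<Rightarrow> (real \<Rightarrow> real) set" where
  "cadlag_paths I = {x \<in> extensional I. cadlag_on I x}"

text \<open>
  A set is open if it contains, with each of its elements \<open>x\<close>, a basic neighbourhood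
  \<open>{y. \<forall>t\<in>K. \<bar>y t - x t\<bar> < \<epsilon>}\<close> of \<open>x\<close> with \<open>K\<close> compact in \<open>I\<close>. These basic neighbourhoods
  are in general not themselves open (a supremum over \<open>K\<close> need not be attained), so the topology
  must not be defined as the one generated by them.
\<close>

definition loc_unif_open :: "real set \<Rightarrow> (real \<Rightarrow> real) set \<Rightarrow> bool" where
  "loc_unif_open I U \<longleftrightarrow> U \<subseteq> cadlag_paths I \<and>
     (\<forall>x\<in>U. \<exists>K \<epsilon>. compact K \<and> K \<subseteq> I \<and> \<epsilon> > 0 \<and>
        {y \<in> cadlag_paths I. \<forall>t\<in>K. \<bar>y t - x t\<bar> < \<epsilon>} \<subseteq> U)"

definition loc_unif_topology :: "real set \<Rightarrow> (real \<Rightarrow> real) topology" where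
  "loc_unif_topology I = topology (loc_unif_open I)"

lemma istopology_loc_unif_open: "istopology (loc_unif_open I)"
  unfolding istopology_def
proof (intro conjI allI impI)
  fix S T assume S: "loc_unif_open I S" and T: "loc_unif_open I T"
  show "loc_unif_open I (S \<inter> T)"
    unfolding loc_unif_open_def
  proof (intro conjI ballI)
    show "S \<inter> T \<subseteq> cadlag_paths I" using S by (auto simp: loc_unif_open_def)
  next
    fix x assume x: "x \<in> S \<inter> T"
    obtain K d where K: "compact K" "K \<subseteq> I" "d > 0"
      "{y \<in> cadlag_paths I. \<forall>t\<in>K. \<bar>y t - x t\<bar> < d} \<subseteq> S"
      using S x unfolding loc_unif_open_def by blast
    obtain L e where L: "compact L" "L \<subseteq> I" "e > 0"
      "{y \<in> cadlag_paths I. \<forall>t\<in>L. \<bar>y t - x t\<bar> < e} \<subseteq> T"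
      using T x unfolding loc_unif_open_def by blast
    have "{y \<in> cadlag_paths I. \<forall>t\<in>K \<union> L. \<bar>y t - x t\<bar> < min d e} \<subseteq> S \<inter> T"
    proof
      fix y assume "y \<in> {y \<in> cadlag_paths I. \<forall>t\<in>K \<union> L. \<bar>y t - x t\<bar> < min d e}"
      then have "y \<in> cadlag_paths I" "\<forall>t\<in>K. \<bar>y t - x t\<bar> < d" "\<forall>t\<in>L. \<bar>y t - x t\<bar> < e"
        by auto
      then show "y \<in> S \<inter> T" using K(4) L(4) by blast
    qed
    moreover have "compact (K \<union> L)" "K \<union> L \<subseteq> I" "min d e > 0"
      using K L by (auto intro: compact_Un)
    ultimately show "\<exists>K \<epsilon>. compact K \<and> K \<subseteq> I \<and> \<epsilon> > 0 \<and>
        {y \<in> cadlag_paths I. \<forall>t\<in>K. \<bar>y t - x t\<bar> < \<epsilon>} \<subseteq> S \<inter> T"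
      by blast
  qed
next
  fix \<U> assume U: "\<forall>U\<in>\<U>. loc_unif_open I U"
  show "loc_unif_open I (\<Union>\<U>)"
    unfolding loc_unif_open_def
  proof (intro conjI ballI)
    show "\<Union>\<U> \<subseteq> cadlag_paths I" using U unfolding loc_unif_open_def by blast
  next
    fix x assume "x \<in> \<Union>\<U>"
    then obtain U where "U \<in> \<U>" "x \<in> U" by blast
    with U obtain K \<epsilon> where "compact K" "K \<subseteq> I" "\<epsilon> > 0"
      "{y \<in> cadlag_paths I. \<forall>t\<in>K. \<bar>y t - x t\<bar> < \<epsilon>} \<subseteq> U"
      unfolding loc_unif_open_def by meson
    with \<open>U \<in> \<U>\<close> show "\<exists>K \<epsilon>. compact K \<and> K \<subseteq> I \<and> \<epsilon> > 0 \<and>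
        {y \<in> cadlag_paths I. \<forall>t\<in>K. \<bar>y t - x t\<bar> < \<epsilon>} \<subseteq> \<Union>\<U>"
      by (meson Union_upper subset_trans)
  qed
qed

lemma openin_loc_unif_topology: "openin (loc_unif_topology I) U \<longleftrightarrow> loc_unif_open I U"
  by (simp add: loc_unif_topology_def istopology_loc_unif_open)

lemma topspace_loc_unif_topology: "topspace (loc_unif_topology I) = cadlag_paths I"
proof
  show "topspace (loc_unif_topology I) \<subseteq> cadlag_paths I"
    unfolding topspace_def openin_loc_unif_topology loc_unif_open_def by blast
  have "loc_unif_open I (cadlag_paths I)"
    unfolding loc_unif_open_def
    by (auto intro!: exI[of _ "{}"] exI[of _ "1::real"])
  then show "cadlag_paths I \<subseteq> topspace (loc_unif_topology I)"
    unfolding topspace_def openin_loc_unif_topology by blast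
qed

definition cadlag_space :: "real set \<Rightarrow> (real \<Rightarrow> real) measure" where
  "cadlag_space I = restrict_space (Pi\<^sub>M I (\<lambda>_. borel)) (cadlag_paths I)"

text \<open>
  Convergence in distribution of the processes \<open>Y i\<close>, indexed by \<open>I\<close>, to \<open>Z\<close>, for local uniform
  convergence on \<open>I\<close>. That topology is not separable, and a process with cadlag paths is in general
  not measurable for its Borel sets. As usual, laws are therefore considered on the sigma-algebra
  generated by the coordinates, and the test functionals are the bounded continuous ones that are
  measurable for it.
\<close>

definition converges_in_distribution_loc_unif ::
    "real set \<Rightarrow> 'a measure \<Rightarrow> ('i \<Rightarrow> real \<Rightarrow> 'a \<Rightarrow> real) \<Rightarrow> (real \<Rightarrow> 'a \<Rightarrow> real) \<Rightarrow> 'i filter \<Rightarrow> bool" where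
  "converges_in_distribution_loc_unif I M Y Z \<F> \<longleftrightarrow>
     (\<forall>\<^sub>F i in \<F>. (\<lambda>\<omega>. \<lambda>t\<in>I. Y i t \<omega>) \<in> M \<rightarrow>\<^sub>M cadlag_space I) \<and>
     (\<lambda>\<omega>. \<lambda>t\<in>I. Z t \<omega>) \<in> M \<rightarrow>\<^sub>M cadlag_space I \<and>
     (\<forall>\<Phi> :: (real \<Rightarrow> real) \<Rightarrow> real.
        continuous_map (loc_unif_topology I) euclideanreal \<Phi> \<longrightarrow>
        \<Phi> \<in> borel_measurable (cadlag_space I) \<longrightarrow>
        bounded (\<Phi> ` cadlag_paths I) \<longrightarrow>
        ((\<lambda>i. \<integral>\<omega>. \<Phi> (\<lambda>t\<in>I. Y i t \<omega>) \<partial>M) \<longlongrightarrow> (\<integral>\<omega>. \<Phi> (\<lambda>t\<in>I. Z t \<omega>) \<partial>M)) \<F>)"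


section \<open>Stable Levy processes and the stochastic differential equation\<close>

text \<open>
  Time is \<open>[0, \<infinity>)\<close>; the values of processes and filtrations at negative times play no role.
\<close>

definition cadlag_adapted :: "'a measure \<Rightarrow> (real \<Rightarrow> 'a measure) \<Rightarrow> (real \<Rightarrow> 'a \<Rightarrow> real) \<Rightarrow> bool" where
  "cadlag_adapted M F X \<longleftrightarrow>
     (\<forall>\<omega>\<in>space M. cadlag_on {0..} (\<lambda>t. X t \<omega>)) \<and> (\<forall>t\<ge>0. X t \<in> borel_measurable (F t))"

definition levy_process :: "'a measure \<Rightarrow> (real \<Rightarrow> 'a measure) \<Rightarrow> (real \<Rightarrow> 'a \<Rightarrow> real) \<Rightarrow> bool" where
  "levy_process M F B \<longleftrightarrow>
     prob_space M \<and> filtration (space M) F \<and> (\<forall>t. subalgebra M (F t)) \<and>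
     cadlag_adapted M F B \<and>
     (\<forall>\<omega>\<in>space M. B 0 \<omega> = 0) \<and>
     (\<forall>s\<ge>0. \<forall>t\<ge>s. prob_space.indep_set M (sets (F s))
        (sets (vimage_algebra (space M) (\<lambda>\<omega>. B t \<omega> - B s \<omega>) borel))) \<and>
     (\<forall>s\<ge>0. \<forall>t\<ge>s. distr M borel (\<lambda>\<omega>. B t \<omega> - B s \<omega>) = distr M borel (B (t - s)))"

text \<open>
  \<open>\<nu>\<close> is the Levy measure of \<open>B\<close>, i.e. the measure in its Levy-Khintchine representation, for some
  drift \<open>b\<close> and Gaussian variance \<open>v\<close>.
\<close>

definition has_levy_measure :: "'a measure \<Rightarrow> (real \<Rightarrow> 'a \<Rightarrow> real) \<Rightarrow> real measure \<Rightarrow> bool" where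
  "has_levy_measure M B \<nu> \<longleftrightarrow>
     sets \<nu> = sets borel \<and> emeasure \<nu> {0} = 0 \<and> integrable \<nu> (\<lambda>u. min 1 (u\<^sup>2)) \<and>
     (\<exists>b v. v \<ge> 0 \<and> (\<forall>t\<ge>0. \<forall>\<theta>. char (distr M borel (B t)) \<theta> =
        exp (complex_of_real t * (\<i> * complex_of_real (b * \<theta>) - complex_of_real (v * \<theta>\<^sup>2 / 2) +
          (CLINT u|\<nu>. iexp (\<theta> * u) - 1 - \<i> * complex_of_real (\<theta> * u * indicator {-1..1} u))))))"

definition strictly_stable_process ::
    "'a measure \<Rightarrow> (real \<Rightarrow> 'a measure) \<Rightarrow> real \<Rightarrow> (real \<Rightarrow> 'a \<Rightarrow> real) \<Rightarrow> bool" where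
  "strictly_stable_process M F \<alpha> B \<longleftrightarrow> levy_process M F B \<and>
     (\<forall>l>0. distr M (Pi\<^sub>M {0..} (\<lambda>_. borel)) (\<lambda>\<omega>. \<lambda>t\<in>{0..}. B (l * t) \<omega>) =
            distr M (Pi\<^sub>M {0..} (\<lambda>_. borel)) (\<lambda>\<omega>. \<lambda>t\<in>{0..}. l powr (1 / \<alpha>) * B t \<omega>))"

definition stable_levy_measure :: "real \<Rightarrow> real \<Rightarrow> real \<Rightarrow> real measure" where
  "stable_levy_measure \<alpha> cp cm =
     density lborel (\<lambda>u. ennreal ((cp * indicator {0<..} u + cm * indicator {..<0} u) *
       \<bar>u\<bar> powr (- 1 - \<alpha>)))"

definition solves_sde ::
    "'a measure \<Rightarrow> (real \<Rightarrow> 'a measure) \<Rightarrow> (real \<Rightarrow> real) \<Rightarrow> (real \<Rightarrow> 'a \<Rightarrow> real) \<Rightarrow> (real \<Rightarrow> 'a \<Rightarrow> real) \<Rightarrow> bool"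
  where
  "solves_sde M F f B X \<longleftrightarrow> cadlag_adapted M F X \<and>
     (AE \<omega> in M. \<forall>t\<ge>0. X t \<omega> = X 0 \<omega> + (LBINT s:{0..t}. f (X s \<omega>)) + B t \<omega>)"

end

theory Submission
  imports Defs "HOL-Real_Asymp.Real_Asymp"
begin

text \<open>
  With \<open>p = 1 / (1 - \<beta>)\<close>, the function \<open>c\<^sub>1 t\<^sup>p\<close> solves the equation with drift \<open>a x\<^sup>\<beta>\<close> and without noise, and the
  equation linearised around it has drift \<open>\<gamma> / t\<close>. So \<open>X - c\<^sub>1 t\<^sup>p\<close> is compared with
  \<open>W t = t\<^sup>\<gamma> J t\<close>, where \<open>J t\<close> is the integral of \<open>s powr (- \<gamma>)\<close> against \<open>dB s\<close> over \<open>[0, t]\<close>, defined by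
  integration by parts. Almost surely \<open>X - c\<^sub>1 t\<^sup>p = W + D\<close> with \<open>D\<close> continuous and of smaller order than
  \<open>t powr (1 / \<alpha>)\<close>; this is a pathwise argument with right derivatives and barriers, based on almost sure growth
  bounds for \<open>B\<close> and on the fact that after late times at which \<open>X\<close> is large the increments of \<open>B\<close> are
  negligible compared with the flow.

  By independence of increments and stability, \<open>J\<close> has the law of \<open>B (t\<^sup>\<rho> / \<rho>)\<close>, so the rescalings of \<open>W\<close>
  all have exactly the law of the limit process. They differ from the rescalings of \<open>X\<close> by continuous functions
  tending to \<open>0\<close>. Because the difference is continuous, it ranges over a separable space, and this makes up for
  the non-separability of the topology of local uniform convergence.
\<close>

section \<open>Flows with a power drift\<close>

text \<open>The jumps of \<open>X\<close> are those of \<open>B\<close>, and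
  \<open>t\<^sup>\<gamma> J t\<close> is \<open>B t\<close> plus a continuous path. The remainder
  therefore has no jumps and satisfies a differential equation; its right-hand side jumps with
  \<open>X\<close>, so only right derivatives are available. The homogeneous linearised equation has
  the solution \<open>t powr \<gamma>\<close>, while the noise acts at scale
  \<open>t powr (1 / \<alpha>)\<close>. The upper bound on \<beta> amounts to \<gamma> < 1 /
  \<alpha>: initial errors are forgotten, and the integral defining \<open>J\<close> converges at 0.
  The lower bound amounts to 1 / \<alpha> < 1 / (1 - \<beta>): the noise is small against the flow.
  The exponent \<open>r\<close> is the one for which the error of \<open>f\<close> along the flow is
  \<open>o(t powr (1 / \<alpha> - 1))\<close> and so contributes
  \<open>o(t powr (1 / \<alpha>))\<close>. For \<alpha> < 1 the process has no first moment, so its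
  growth is obtained from tail bounds that follow from self-similarity and independence of
  increments.\<close>

text \<open>At the last time before \<open>t\<close> with \<open>h \<le> g\<close> the two functions
  touch, and \<open>h\<close> exceeds \<open>g\<close> right afterwards; the slopes at a contact
  forbid this. Slopes are compared only at contacts, where the two values coincide, which is what
  makes explicit barriers usable.\<close>

lemma right_derivative_barrier:
  fixes h g :: "real \<Rightarrow> real"
  assumes conth: "continuous_on {T..} h" and contg: "continuous_on {T..} g"
    and init: "h T \<le> g T"
    and contact: "\<And>u. u \<ge> T \<Longrightarrow> h u = g u \<Longrightarrow> \<exists>d e. (h has_real_derivative d) (at_right u) \<and>
      (g has_real_derivative e) (at_right u) \<and> d < e"
    and "t \<ge> T"
  shows "h t \<le> g t"
proof (rule ccontr)
  assume "\<not> h t \<le> g t"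
  define S where "S = {s \<in> {T..t}. h s - g s \<le> 0}"
  have cont: "continuous_on {T..t} (\<lambda>s. h s - g s)"
    by (intro continuous_intros continuous_on_subset[OF contg] continuous_on_subset[OF conth]) auto
  have "closed S"
    using continuous_closed_preimage[OF cont closed_real_atLeastAtMost closed_atMost[of 0]]
    by (simp add: S_def vimage_def Int_def)
  moreover have "T \<in> S" "bounded S"
    using assms by (auto simp: S_def intro: bounded_subset[OF bounded_closed_interval[of T t]])
  ultimately have "Sup S \<in> S"
    by (intro closed_contains_Sup) (auto intro: bounded_imp_bdd_above)
  define u where "u = Sup S"
  have u: "T \<le> u" "u \<le> t" "h u \<le> g u"
    using \<open>Sup S \<in> S\<close> by (auto simp: S_def u_def)
  have "u < t" using u \<open>\<not> h t \<le> g t\<close> by (cases "u = t") auto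
  have above: "h s > g s" if "u < s" "s \<le> t" for s
  proof (rule ccontr)
    assume "\<not> h s > g s"
    then have "s \<in> S" using that u by (auto simp: S_def)
    then have "s \<le> u" unfolding u_def
      by (rule cSup_upper) (use \<open>bounded S\<close> in \<open>auto intro: bounded_imp_bdd_above\<close>)
    with that show False by simp
  qed
  have "((\<lambda>s. h s - g s) \<longlongrightarrow> h u - g u) (at u within {u..t})"
    using continuous_on_subset[OF cont, of "{u..t}"] u by (auto simp: continuous_on)
  then have "((\<lambda>s. h s - g s) \<longlongrightarrow> h u - g u) (at_right u)"
    by (metis at_within_Icc_at_right \<open>u < t\<close>)
  moreover have "eventually (\<lambda>s. h s - g s \<ge> 0) (at_right u)"
    using eventually_at_right_less[of u] eventually_at_rightI[OF _ \<open>u < t\<close>, of "\<lambda>s. h s - g s \<ge> 0"]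
      above by (auto simp: less_imp_le)
  ultimately have "h u - g u \<ge> 0"
    by (rule tendsto_lowerbound) simp
  then have "h u = g u" using u by simp
  from contact[OF \<open>T \<le> u\<close> this] obtain d e where
    de: "(h has_real_derivative d) (at_right u)" "(g has_real_derivative e) (at_right u)" "d < e"
    by blast
  have "((\<lambda>s. h s - g s) has_real_derivative d - e) (at_right u)"
    using de by (intro derivative_intros)
  from has_real_derivative_neg_dec_right[OF this] \<open>d < e\<close>
  obtain c where c: "c > 0" "\<And>x. x > 0 \<Longrightarrow> x < c \<Longrightarrow> h (u + x) - g (u + x) < h u - g u"
    by auto
  define x where "x = min (c / 2) (t - u)"
  have "x > 0" "x < c" "u + x \<le> t" using c \<open>u < t\<close> by (auto simp: x_def)
  with c(2)[of x] above[of "u + x"] \<open>h u = g u\<close> show False by auto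
qed

section \<open>Power bounds for perturbations of the Euler equation\<close>

text \<open>The majorant is a supersolution: \<open>K * t powr (\<gamma> + \<eta>)\<close> solves
  the homogeneous Euler equation with \<gamma> raised by \<eta>, which absorbs the relative error,
  and \<open>M * t powr q\<close> beats the forcing because
  \<open>M * (q - \<gamma> - \<eta>) > C\<close>. This strict inequality supplies the strict
  comparison of slopes at a contact.\<close>

lemma perturbed_euler_upper:
  fixes D D' :: "real \<Rightarrow> real"
  assumes T: "T > 0" and cont: "continuous_on {T..} D"
    and deriv: "\<And>t. t \<ge> T \<Longrightarrow> (D has_real_derivative D' t) (at_right t)"
    and bound: "\<And>t. t \<ge> T \<Longrightarrow> \<bar>D' t - \<gamma> / t * D t\<bar> \<le> (\<eta> * \<bar>D t\<bar> + C * t powr q) / t"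
    and M: "M \<ge> 0" "M * (q - \<gamma> - \<eta>) > C"
    and K: "K \<ge> 0" "D T \<le> K * T powr (\<gamma> + \<eta>)" and t: "t \<ge> T"
  shows "D t \<le> K * t powr (\<gamma> + \<eta>) + M * t powr q"
proof (rule right_derivative_barrier[where T = T and h = D and g = "\<lambda>t. K * t powr (\<gamma> + \<eta>) + M * t powr q"])
  show "continuous_on {T..} (\<lambda>t. K * t powr (\<gamma> + \<eta>) + M * t powr q)"
    using T by (auto intro!: continuous_intros)
  show "D T \<le> K * T powr (\<gamma> + \<eta>) + M * T powr q" using K M by (simp add: add_increasing2)
next
  fix u assume u: "u \<ge> T" and eq: "D u = K * u powr (\<gamma> + \<eta>) + M * u powr q"
  have "u > 0" using u T by simp
  define e where "e = K * ((\<gamma> + \<eta>) * u powr (\<gamma> + \<eta> - 1)) + M * (q * u powr (q - 1))"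
  have "((\<lambda>t. K * t powr (\<gamma> + \<eta>) + M * t powr q) has_real_derivative e) (at u)"
    unfolding e_def using \<open>u > 0\<close> by (auto intro!: derivative_eq_intros)
  then have 1: "((\<lambda>t. K * t powr (\<gamma> + \<eta>) + M * t powr q) has_real_derivative e) (at_right u)"
    by (rule has_field_derivative_at_within)
  \<comment> \<open>Positivity at the contact lets the error \<open>\<eta> * \<bar>D u\<bar>\<close>
    be merged into the linear term.\<close>
  have "D u \<ge> 0" using eq K M by simp
  then have "D' u \<le> (\<gamma> + \<eta>) / u * D u + C * u powr q / u"
    using bound[OF u] \<open>u > 0\<close> by (auto simp: field_simps abs_le_iff)
  also have "\<dots> = K * ((\<gamma> + \<eta>) * u powr (\<gamma> + \<eta> - 1)) + (M * (\<gamma> + \<eta>) + C) * u powr (q - 1)"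
    using \<open>u > 0\<close> by (simp add: eq powr_diff field_simps)
  also have "\<dots> < e"
  proof -
    have "(M * (\<gamma> + \<eta>) + C) * u powr (q - 1) < M * q * u powr (q - 1)"
      using M(2) \<open>u > 0\<close> by (intro mult_strict_right_mono) (auto simp: algebra_simps)
    then show ?thesis by (simp add: e_def algebra_simps)
  qed
  finally show "\<exists>d e. (D has_real_derivative d) (at_right u) \<and>
      ((\<lambda>t. K * t powr (\<gamma> + \<eta>) + M * t powr q) has_real_derivative e) (at_right u) \<and> d < e"
    using 1 deriv[OF u] by blast
qed (use cont t in auto)

text \<open>The one-sided bound is applied to \<open>D\<close> and to \<open>- D\<close>. Only
  \<open>K\<close> depends on the initial value; the condition on \<open>M\<close> involves the
  forcing alone. When \<open>\<gamma> + \<eta> < q\<close>, small forcing therefore gives a small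
  multiple of \<open>t powr q\<close> at large times, whatever the start.\<close>

lemma perturbed_euler_bound:
  fixes D D' :: "real \<Rightarrow> real"
  assumes T: "T > 0" and cont: "continuous_on {T..} D"
    and deriv: "\<And>t. t \<ge> T \<Longrightarrow> (D has_real_derivative D' t) (at_right t)"
    and bound: "\<And>t. t \<ge> T \<Longrightarrow> \<bar>D' t - \<gamma> / t * D t\<bar> \<le> (\<eta> * \<bar>D t\<bar> + C * t powr q) / t"
    and M: "M \<ge> 0" "M * (q - \<gamma> - \<eta>) > C"
  obtains K where "K \<ge> 0" "\<And>t. t \<ge> T \<Longrightarrow> \<bar>D t\<bar> \<le> K * t powr (\<gamma> + \<eta>) + M * t powr q"
proof
  define K where "K = \<bar>D T\<bar> / T powr (\<gamma> + \<eta>)"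
  show K: "K \<ge> 0" by (simp add: K_def)
  have init: "D T \<le> K * T powr (\<gamma> + \<eta>)" "- D T \<le> K * T powr (\<gamma> + \<eta>)"
    using T by (auto simp: K_def)
  fix t assume t: "t \<ge> T"
  have "D t \<le> K * t powr (\<gamma> + \<eta>) + M * t powr q"
    by (rule perturbed_euler_upper[OF T cont deriv bound M K init(1) t])
  moreover have "- D t \<le> K * t powr (\<gamma> + \<eta>) + M * t powr q"
  proof (rule perturbed_euler_upper[where D = "\<lambda>t. - D t" and D' = "\<lambda>t. - D' t"])
    show "((\<lambda>t. - D t) has_real_derivative - D' t) (at_right t)" if "t \<ge> T" for t
      using deriv[OF that] by (intro derivative_intros)
    show "\<bar>- D' t - \<gamma> / t * - D t\<bar> \<le> (\<eta> * \<bar>- D t\<bar> + C * t powr q) / t" if "t \<ge> T" for t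
      using bound[OF that] by (simp add: abs_minus_commute)
  qed (use T M K init t cont in \<open>auto intro!: continuous_intros\<close>)
  ultimately show "\<bar>D t\<bar> \<le> K * t powr (\<gamma> + \<eta>) + M * t powr q" by simp
qed

section \<open>First order: the solution follows the noiseless flow\<close>

text \<open>Writing \<open>f x / g powr \<beta>\<close> as
  \<open>(f x / x powr \<beta>) * (x / g) powr \<beta>\<close> reduces the claim to continuity of
  \<open>u * v powr \<beta>\<close> at \<open>(a, 1)\<close>. It is used with \<open>g\<close> a
  barrier and \<open>x\<close> the barrier plus noise of relative size at most
  \<open>d\<close>.\<close>

lemma powr_locally_constant:
  fixes f :: "real \<Rightarrow> real"
  assumes a: "a > 0" and f: "((\<lambda>x. f x / x powr \<beta>) \<longlongrightarrow> a) at_top" and e: "e > 0"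
  obtains d N where "0 < d" "d < e" "d < 1" "N > 0"
    "\<And>g x. g \<ge> N \<Longrightarrow> \<bar>x - g\<bar> \<le> d * g \<Longrightarrow> \<bar>f x - a * g powr \<beta>\<bar> < e * g powr \<beta>"
proof -
  have "((\<lambda>z :: real \<times> real. fst z * snd z powr \<beta>) \<longlongrightarrow> a * 1 powr \<beta>) (nhds a \<times>\<^sub>F nhds 1)"
    by (intro tendsto_intros filterlim_fst filterlim_snd) auto
  then have "eventually (\<lambda>z. dist (fst z * snd z powr \<beta>) a < e) (nhds a \<times>\<^sub>F nhds (1::real))"
    using e by (simp add: tendsto_iff)
  then obtain P Q where P: "eventually P (nhds a)" and Q: "eventually Q (nhds (1::real))"
    and PQ: "\<And>u v. P u \<Longrightarrow> Q v \<Longrightarrow> \<bar>u * v powr \<beta> - a\<bar> < e"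
    by (auto simp: eventually_prod_filter dist_real_def)
  obtain d0 where d0: "d0 > 0" "\<And>v. \<bar>v - 1\<bar> < d0 \<Longrightarrow> Q v"
    using Q by (auto simp: eventually_nhds_metric dist_real_def)
  have "eventually (\<lambda>x. P (f x / x powr \<beta>)) at_top"
    using f P by (simp add: filterlim_iff)
  then obtain N0 where N0: "\<And>x. x \<ge> N0 \<Longrightarrow> P (f x / x powr \<beta>)"
    by (auto simp: eventually_at_top_linorder)
  \<comment> \<open>The bound 1 / 2 keeps \<open>x \<ge> g / 2\<close>, so that \<open>x\<close> is
    large whenever \<open>g\<close> is; hence the factor 2 in \<open>N\<close>.\<close>
  define d where "d = min (d0 / 2) (min (e / 2) (1 / 2))"
  define N where "N = max 1 (2 * N0)"
  have d: "0 < d" "d < d0" "d < e" "d \<le> 1 / 2" using d0 e by (auto simp: d_def)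
  show thesis
  proof (rule that)
    fix g x assume g: "g \<ge> N" and x: "\<bar>x - g\<bar> \<le> d * g"
    have "g > 0" using g by (auto simp: N_def)
    have "d * g \<le> 1 / 2 * g" using d \<open>g > 0\<close> by (intro mult_right_mono) auto
    then have "x \<ge> g / 2" using x by auto
    then have "x > 0" "x \<ge> N0" using g \<open>g > 0\<close> by (auto simp: N_def)
    have "x / g - 1 = (x - g) / g" using \<open>g > 0\<close> by (simp add: diff_divide_distrib)
    then have "\<bar>x / g - 1\<bar> = \<bar>x - g\<bar> / g" using \<open>g > 0\<close> by simp
    also have "\<dots> \<le> d" using x \<open>g > 0\<close> by (simp add: pos_divide_le_eq)
    finally have "Q (x / g)" using d by (intro d0) auto
    from PQ[OF N0[OF \<open>x \<ge> N0\<close>] this]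
    have "\<bar>f x / g powr \<beta> - a\<bar> < e" using \<open>x > 0\<close> \<open>g > 0\<close> by (simp add: powr_divide)
    moreover have "f x - a * g powr \<beta> = (f x / g powr \<beta> - a) * g powr \<beta>"
      using \<open>g > 0\<close> by (simp add: left_diff_distrib)
    then have "\<bar>f x - a * g powr \<beta>\<bar> = \<bar>f x / g powr \<beta> - a\<bar> * g powr \<beta>"
      by (simp add: abs_mult)
    ultimately show "\<bar>f x - a * g powr \<beta>\<bar> < e * g powr \<beta>"
      using \<open>g > 0\<close> by simp
  qed (use d in \<open>auto simp: N_def\<close>)
qed

text \<open>The curve is the exact flow for the coefficient \<open>p * k powr (1 - \<beta>)\<close>
  in place of \<open>a\<close>; the coefficients agree for
  \<open>k = (a * (1 - \<beta>)) powr p\<close>. A smaller or larger \<open>k\<close> gives a strict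
  lower or upper barrier.\<close>

lemma power_flow_derivative:
  fixes a \<beta> p k :: real
  assumes \<beta>: "\<beta> < 1" and p: "p = 1 / (1 - \<beta>)" and k: "k > 0" and y: "s + c > 0"
  shows "((\<lambda>s. k * (s + c) powr p) has_real_derivative
    p * k powr (1 - \<beta>) * (k * (s + c) powr p) powr \<beta>) (at s)"
proof -
  have "p * \<beta> = p - 1" using \<beta> by (simp add: p field_simps)
  have "k powr (1 - \<beta>) * (k * (s + c) powr p) powr \<beta> = (k powr (1 - \<beta>) * k powr \<beta>) * (s + c) powr (p * \<beta>)"
    using k y by (simp add: powr_mult powr_powr)
  also have "\<dots> = k * (s + c) powr (p - 1)"
    using k \<open>p * \<beta> = p - 1\<close> by (simp flip: powr_add)
  finally have "p * k powr (1 - \<beta>) * (k * (s + c) powr p) powr \<beta> = k * (p * (s + c) powr (p - 1))"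
    by simp
  then show ?thesis using y by (auto intro!: derivative_eq_intros)
qed

lemma powr_less_power_flow_constant:
  fixes a \<beta> p k :: real
  assumes "a > 0" and \<beta>: "\<beta> < 1" and p: "p = 1 / (1 - \<beta>)" and k: "k > 0"
  shows "k < (a * (1 - \<beta>)) powr p \<Longrightarrow> p * k powr (1 - \<beta>) < a"
    and "k > (a * (1 - \<beta>)) powr p \<Longrightarrow> p * k powr (1 - \<beta>) > a"
proof -
  have *: "((a * (1 - \<beta>)) powr p) powr (1 - \<beta>) = a * (1 - \<beta>)"
    using assms by (simp add: powr_powr)
  show "p * k powr (1 - \<beta>) < a" if "k < (a * (1 - \<beta>)) powr p"
    using powr_less_mono2[OF _ _ that, of "1 - \<beta>"] k \<beta> unfolding * by (simp add: p field_simps)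
  show "p * k powr (1 - \<beta>) > a" if "k > (a * (1 - \<beta>)) powr p"
    using powr_less_mono2[OF _ _ that, of "1 - \<beta>"] k \<beta> unfolding * by (simp add: p field_simps)
qed

text \<open>The path is \<open>V + w\<close> with \<open>V\<close> differentiable from the right and
  \<open>w\<close> the noise since the restart. A slightly slow exact flow that starts below
  \<open>V 0\<close> stays below \<open>V\<close>: at a contact the true position is off the barrier
  by a relative error of at most \<open>d\<close>, and the gap between the two drift coefficients
  compensates for this.\<close>

lemma noisy_power_flow_lower:
  fixes f :: "real \<Rightarrow> real"
  assumes a: "a > 0" and \<beta>: "\<beta> < 1" and p: "p = 1 / (1 - \<beta>)"
    and f: "((\<lambda>x. f x / x powr \<beta>) \<longlongrightarrow> a) at_top"
    and k: "0 < k" "k < (a * (1 - \<beta>)) powr p"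
  obtains \<delta> N where "\<delta> > 0" "N > 0"
    "\<And>n V w s. n \<ge> N \<Longrightarrow> continuous_on {0..} V \<Longrightarrow>
      (\<And>s. s \<ge> 0 \<Longrightarrow> (V has_real_derivative f (V s + w s)) (at_right s)) \<Longrightarrow> V 0 \<ge> n powr p \<Longrightarrow>
      (\<And>s. s \<ge> 0 \<Longrightarrow> \<bar>w s\<bar> \<le> \<delta> * (n + s) powr p) \<Longrightarrow> s \<ge> 0 \<Longrightarrow> V s + w s \<ge> k * s powr p"
proof -
  define c where "c = (a * (1 - \<beta>)) powr p"
  \<comment> \<open>The gap from \<open>k1\<close> up to \<open>c\<close> gives the slower slope;
    the gap from \<open>k\<close> up to \<open>k1\<close> pays for the noise when passing from
    \<open>V\<close> to \<open>V + w\<close>. The two entries of \<open>e\<close> below measure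
    these gaps.\<close>
  define k1 where "k1 = (k + c) / 2"
  have k1: "0 < k1" "k < k1" "k1 < c" using k by (auto simp: k1_def c_def)
  have p0: "p > 0" using \<beta> by (simp add: p)
  define e where "e = min (a - p * k1 powr (1 - \<beta>)) (1 - k / k1)"
  have e: "e > 0" using powr_less_power_flow_constant(1)[OF a \<beta> p k1(1)] k1
    by (simp add: e_def c_def)
  obtain d N0 where d: "0 < d" "d < e" "d < 1" "N0 > 0"
    and contact: "\<And>g x. g \<ge> N0 \<Longrightarrow> \<bar>x - g\<bar> \<le> d * g \<Longrightarrow> \<bar>f x - a * g powr \<beta>\<bar> < e * g powr \<beta>"
    using powr_locally_constant[OF a f e] by metis
  \<comment> \<open>The shift \<open>\<kappa> * n\<close> must be small enough for the barrier to
    start below \<open>n powr p\<close>, and \<open>\<kappa> \<le> 1\<close> gives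
    \<open>\<kappa> * (n + s) \<le> s + \<kappa> * n\<close>, which turns the noise bound into
    \<open>d\<close> times the barrier.\<close>
  define \<kappa> where "\<kappa> = min 1 (k1 powr (- 1 / p))"
  have \<kappa>: "0 < \<kappa>" "\<kappa> \<le> 1" using k1 by (auto simp: \<kappa>_def)
  have "k1 * \<kappa> powr p \<le> k1 * (k1 powr (- 1 / p)) powr p"
    using k1 p0 \<kappa> by (intro mult_left_mono powr_mono2) (auto simp: \<kappa>_def)
  also have "\<dots> = 1" using k1 p0 by (simp only: powr_powr) (simp add: powr_minus)
  finally have k\<kappa>: "k1 * \<kappa> powr p \<le> 1" .
  define \<delta> where "\<delta> = d * k1 * \<kappa> powr p"
  define N where "N = (N0 / (k1 * \<kappa> powr p)) powr (1 / p)"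
  show thesis
  proof (rule that)
    show "\<delta> > 0" using d k1 \<kappa> by (simp add: \<delta>_def)
    show N0: "N > 0" using d k1 \<kappa> by (simp add: N_def)
    fix n V w and s :: real
    assume n: "n \<ge> N" and cont: "continuous_on {0..} V"
      and deriv: "\<And>s. s \<ge> 0 \<Longrightarrow> (V has_real_derivative f (V s + w s)) (at_right s)"
      and V0: "V 0 \<ge> n powr p" and w: "\<And>s. s \<ge> 0 \<Longrightarrow> \<bar>w s\<bar> \<le> \<delta> * (n + s) powr p" and s: "s \<ge> 0"
    have n0: "n > 0" using n N0 by simp
    define g where "g = (\<lambda>s. k1 * (s + \<kappa> * n) powr p)"
    have g_ge: "g s \<ge> N0" if "s \<ge> 0" for s
    proof -
      have "N0 = k1 * \<kappa> powr p * N powr p"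
        using d k1 \<kappa> p0 by (simp add: N_def powr_powr)
      also have "\<dots> = k1 * (\<kappa> * N) powr p" using \<kappa> N0 by (simp add: powr_mult)
      also have "\<dots> \<le> g s" unfolding g_def
        using that n \<kappa> N0 p0 k1 by (intro mult_left_mono powr_mono2) (auto intro: add_increasing mult_left_mono)
      finally show ?thesis .
    qed
    have w_g: "\<bar>w s\<bar> \<le> d * g s" if "s \<ge> 0" for s
    proof -
      have "\<kappa> powr p * (n + s) powr p = (\<kappa> * (n + s)) powr p"
        using \<kappa> n0 that by (simp add: powr_mult)
      also have "\<dots> \<le> (s + \<kappa> * n) powr p"
        using \<kappa> n0 that p0 by (intro powr_mono2) (auto simp: algebra_simps mult_left_le_one_le)
      finally have "\<kappa> powr p * (n + s) powr p \<le> (s + \<kappa> * n) powr p" .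
      then have "d * k1 * (\<kappa> powr p * (n + s) powr p) \<le> d * k1 * (s + \<kappa> * n) powr p"
        using d k1 by (intro mult_left_mono) auto
      then show ?thesis using w[OF that] by (simp add: \<delta>_def g_def mult_ac)
    qed
    have "g s \<le> V s"
    proof (rule right_derivative_barrier[where T = 0 and h = g and g = V and t = s])
      show "continuous_on {0..} g" unfolding g_def
        using \<kappa> n0 by (intro continuous_intros) (auto intro: add_nonneg_pos simp: add_nonneg_eq_0_iff)
      have "g 0 = k1 * \<kappa> powr p * n powr p" using \<kappa> n0 by (simp add: g_def powr_mult)
      also have "\<dots> \<le> 1 * n powr p" using k\<kappa> by (intro mult_right_mono) auto
      finally show "g 0 \<le> V 0" using V0 by simp
    next
      fix u :: real assume u: "u \<ge> 0" and eq: "g u = V u"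
      have "\<bar>f (V u + w u) - a * g u powr \<beta>\<bar> < e * g u powr \<beta>"
        using w_g[OF u] by (intro contact g_ge u) (simp add: eq)
      then have "f (V u + w u) > (a - e) * g u powr \<beta>" by (simp add: algebra_simps abs_if split: if_splits)
      moreover have "(a - e) * g u powr \<beta> \<ge> p * k1 powr (1 - \<beta>) * g u powr \<beta>"
        by (intro mult_right_mono) (auto simp: e_def)
      moreover have "(g has_real_derivative p * k1 powr (1 - \<beta>) * g u powr \<beta>) (at_right u)"
        unfolding g_def using u \<kappa> n0
        by (intro has_field_derivative_at_within[OF power_flow_derivative] \<beta> p k1 add_nonneg_pos) auto
      ultimately show "\<exists>d e. (g has_real_derivative d) (at_right u) \<and>
          (V has_real_derivative e) (at_right u) \<and> d < e"
        using deriv[OF u] by force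
    qed (use cont s in auto)
    then have "(1 - d) * g s \<le> V s + w s" using w_g[OF s] by (simp add: algebra_simps)
    moreover have "k / k1 * (k1 * s powr p) \<le> (1 - d) * g s"
    proof (intro mult_mono)
      show "k1 * s powr p \<le> g s" unfolding g_def using s \<kappa> n0 k1 p0
        by (intro mult_left_mono powr_mono2) auto
      show "k / k1 \<le> 1 - d" using d(2) by (simp add: e_def)
    qed (use k1 d in auto)
    ultimately show "k * s powr p \<le> V s + w s" using k1 by simp
  qed
qed

text \<open>Mirror image with a slightly fast flow. Nothing bounds \<open>V 0\<close> from above, so
  the shift \<open>s0\<close> depends on the path and can only be asserted to exist; it disappears
  in the limit of \<open>X t / t powr p\<close>.\<close>

lemma noisy_power_flow_upper:
  fixes f :: "real \<Rightarrow> real"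
  assumes a: "a > 0" and \<beta>: "\<beta> < 1" and p: "p = 1 / (1 - \<beta>)"
    and f: "((\<lambda>x. f x / x powr \<beta>) \<longlongrightarrow> a) at_top"
    and k: "k > (a * (1 - \<beta>)) powr p"
  obtains \<delta> N where "\<delta> > 0" "N > 0"
    "\<And>n V w. n \<ge> N \<Longrightarrow> continuous_on {0..} V \<Longrightarrow>
      (\<And>s. s \<ge> 0 \<Longrightarrow> (V has_real_derivative f (V s + w s)) (at_right s)) \<Longrightarrow>
      (\<And>s. s \<ge> 0 \<Longrightarrow> \<bar>w s\<bar> \<le> \<delta> * (n + s) powr p) \<Longrightarrow>
      \<exists>s0\<ge>0. \<forall>s\<ge>0. V s + w s \<le> k * (s + s0) powr p"
proof -
  define c where "c = (a * (1 - \<beta>)) powr p"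
  define k1 where "k1 = (k + c) / 2"
  have c: "c > 0" using a \<beta> by (simp add: c_def)
  have "c < k" using k by (simp add: c_def)
  then have k1: "0 < k1" "k1 < k" "c < k1" using c by (auto simp: k1_def)
  have p0: "p > 0" using \<beta> by (simp add: p)
  define e where "e = min (p * k1 powr (1 - \<beta>) - a) (k / k1 - 1)"
  have e: "e > 0" using powr_less_power_flow_constant(2)[OF a \<beta> p k1(1)] k1
    by (simp add: e_def c_def)
  obtain d N0 where d: "0 < d" "d < e" "d < 1" "N0 > 0"
    and contact: "\<And>g x. g \<ge> N0 \<Longrightarrow> \<bar>x - g\<bar> \<le> d * g \<Longrightarrow> \<bar>f x - a * g powr \<beta>\<bar> < e * g powr \<beta>"
    using powr_locally_constant[OF a f e] by metis
  define \<delta> where "\<delta> = d * k1"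
  define N where "N = (N0 / k1) powr (1 / p)"
  show thesis
  proof (rule that)
    show "\<delta> > 0" using d k1 by (simp add: \<delta>_def)
    show N0: "N > 0" using d k1 by (simp add: N_def)
    fix n V w
    assume n: "n \<ge> N" and cont: "continuous_on {0..} V"
      and deriv: "\<And>s. s \<ge> 0 \<Longrightarrow> (V has_real_derivative f (V s + w s)) (at_right s)"
      and w: "\<And>s. s \<ge> 0 \<Longrightarrow> \<bar>w s\<bar> \<le> \<delta> * (n + s) powr p"
    have n0: "n > 0" using n N0 by simp
    \<comment> \<open>At least \<open>n\<close> for the noise bound and the size of the barrier, and
      large enough to start above \<open>V 0\<close>.\<close>
    define s0 where "s0 = max n ((max 0 (V 0) / k1) powr (1 / p))"
    have s0: "s0 \<ge> n" "s0 > 0" using n0 by (auto simp: s0_def)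
    define g where "g = (\<lambda>s. k1 * (s + s0) powr p)"
    have g_ge: "g s \<ge> N0" if "s \<ge> 0" for s
    proof -
      have "N0 = k1 * N powr p" using d k1 p0 by (simp add: N_def powr_powr)
      also have "\<dots> \<le> g s" unfolding g_def
        using that n N0 p0 k1 s0 by (intro mult_left_mono powr_mono2) auto
      finally show ?thesis .
    qed
    have w_g: "\<bar>w s\<bar> \<le> d * g s" if "s \<ge> 0" for s
    proof -
      have "d * k1 * (n + s) powr p \<le> d * k1 * (s + s0) powr p"
        using d k1 n0 that p0 s0 by (intro mult_left_mono powr_mono2) auto
      then show ?thesis using w[OF that] by (simp add: \<delta>_def g_def mult_ac)
    qed
    have V_g: "V s \<le> g s" if s: "s \<ge> 0" for s
    proof (rule right_derivative_barrier[where T = 0 and h = V and g = g and t = s])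
      show "continuous_on {0..} g" unfolding g_def
        using s0 by (intro continuous_intros) (auto simp: add_nonneg_eq_0_iff)
      have "max 0 (V 0) = k1 * ((max 0 (V 0) / k1) powr (1 / p)) powr p"
        using k1 p0 by (simp add: powr_powr)
      also have "\<dots> \<le> k1 * s0 powr p"
        using k1 p0 by (intro mult_left_mono powr_mono2) (auto simp: s0_def)
      finally show "V 0 \<le> g 0" by (simp add: g_def)
    next
      fix u :: real assume u: "u \<ge> 0" and eq: "V u = g u"
      have "\<bar>f (V u + w u) - a * g u powr \<beta>\<bar> < e * g u powr \<beta>"
        using w_g[OF u] by (intro contact g_ge u) (simp add: eq)
      then have "f (V u + w u) < (a + e) * g u powr \<beta>" by (simp add: algebra_simps abs_if split: if_splits)
      moreover have "(a + e) * g u powr \<beta> \<le> p * k1 powr (1 - \<beta>) * g u powr \<beta>"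
        by (intro mult_right_mono) (auto simp: e_def)
      moreover have "(g has_real_derivative p * k1 powr (1 - \<beta>) * g u powr \<beta>) (at_right u)"
        unfolding g_def using u s0
        by (intro has_field_derivative_at_within[OF power_flow_derivative] \<beta> p k1) auto
      ultimately show "\<exists>d e. (V has_real_derivative d) (at_right u) \<and>
          (g has_real_derivative e) (at_right u) \<and> d < e"
        using deriv[OF u] by force
    qed (use cont s in auto)
    show "\<exists>s0\<ge>0. \<forall>s\<ge>0. V s + w s \<le> k * (s + s0) powr p"
    proof (intro exI[of _ s0] conjI allI impI)
      fix s :: real assume s: "s \<ge> 0"
      have "V s + w s \<le> (1 + d) * g s" using w_g[OF s] V_g[OF s] by (simp add: algebra_simps)
      also have "\<dots> \<le> k / k1 * g s"
        using d(2) k1 by (intro mult_right_mono) (auto simp: e_def g_def)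
      finally show "V s + w s \<le> k * (s + s0) powr p" using k1 by (simp add: g_def)
    qed (use s0 in auto)
  qed
qed

text \<open>The hypothesis \<open>restart\<close> provides times at which the path is above
  \<open>n powr p\<close> and after which the noise stays negligible against
  \<open>(n + s) powr p\<close>. From one such time the two barriers give lower and upper rates
  arbitrarily close to the constant; the shifts by \<open>T\<close> and \<open>s0\<close> vanish in
  the quotient.\<close>

lemma power_flow_asymptotics:
  fixes f X b :: "real \<Rightarrow> real"
  assumes a: "a > 0" and \<beta>: "\<beta> < 1" and p: "p = 1 / (1 - \<beta>)"
    and f: "((\<lambda>x. f x / x powr \<beta>) \<longlongrightarrow> a) at_top"
    and cont: "continuous_on {0..} (\<lambda>t. X t - b t)"
    and deriv: "\<And>t. t \<ge> 0 \<Longrightarrow> ((\<lambda>t. X t - b t) has_real_derivative f (X t)) (at_right t)"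
    and restart: "\<And>\<delta> N. \<delta> > 0 \<Longrightarrow> \<exists>T\<ge>0. \<exists>n\<ge>N. X T \<ge> n powr p \<and>
      (\<forall>s\<ge>0. \<bar>b (T + s) - b T\<bar> \<le> \<delta> * (n + s) powr p)"
  shows "((\<lambda>t. X t / t powr p) \<longlongrightarrow> (a * (1 - \<beta>)) powr p) at_top"
proof (rule order_tendstoI)
  have shifted: "continuous_on {0..} (\<lambda>s. X (T + s) - (b (T + s) - b T))"
    "\<And>s. s \<ge> 0 \<Longrightarrow> ((\<lambda>s. X (T + s) - (b (T + s) - b T)) has_real_derivative f (X (T + s))) (at_right s)"
    if "T \<ge> 0" for T
  proof -
    have "continuous_on {0..} (\<lambda>s. (X (T + s) - b (T + s)) + b T)"
      by (intro continuous_intros continuous_on_compose2[OF cont]) (use that in auto)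
    then show "continuous_on {0..} (\<lambda>s. X (T + s) - (b (T + s) - b T))" by (simp add: algebra_simps)
    fix s :: real assume "s \<ge> 0"
    have "(\<lambda>s. T + s) ` {s<..} = {T + s<..}"
      by (auto simp: image_iff intro!: bexI[of _ "x - T" for x])
    then have "((\<lambda>t. X t - b t) has_real_derivative f (X (T + s))) (at (T + s) within (\<lambda>s. T + s) ` {s<..})"
      using deriv[of "T + s"] that \<open>s \<ge> 0\<close> by simp
    then have "((\<lambda>t. X t - b t) \<circ> (\<lambda>s. T + s) has_real_derivative f (X (T + s)) * 1) (at_right s)"
      by (intro DERIV_image_chain) (auto intro!: derivative_eq_intros)
    then have "((\<lambda>s. (X (T + s) - b (T + s)) + b T) has_real_derivative f (X (T + s)) + 0) (at_right s)"
      by (intro derivative_intros) (simp add: o_def)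
    then show "((\<lambda>s. X (T + s) - (b (T + s) - b T)) has_real_derivative f (X (T + s))) (at_right s)"
      by (simp add: algebra_simps)
  qed
  have p0: "p > 0" using \<beta> by (simp add: p)
  define c where "c = (a * (1 - \<beta>)) powr p"
  have c: "c > 0" using a \<beta> by (simp add: c_def)
  show "eventually (\<lambda>t. l < X t / t powr p) at_top" if "l < (a * (1 - \<beta>)) powr p" for l
  proof -
    \<comment> \<open>The maximum with 0 keeps \<open>k\<close> positive when \<open>l\<close> is
      negative.\<close>
    define k where "k = (max l 0 + c) / 2"
    have "l < c" using that by (simp add: c_def)
    then have k: "k > 0" "k > l" "k < c" using c by (auto simp: k_def)
    obtain \<delta> N where \<delta>: "\<delta> > 0" "N > 0" and flow:
      "\<And>n V w s. n \<ge> N \<Longrightarrow> continuous_on {0..} V \<Longrightarrow>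
      (\<And>s. s \<ge> 0 \<Longrightarrow> (V has_real_derivative f (V s + w s)) (at_right s)) \<Longrightarrow> V 0 \<ge> n powr p \<Longrightarrow>
      (\<And>s. s \<ge> 0 \<Longrightarrow> \<bar>w s\<bar> \<le> \<delta> * (n + s) powr p) \<Longrightarrow> s \<ge> 0 \<Longrightarrow> V s + w s \<ge> k * s powr p"
      using noisy_power_flow_lower[OF a \<beta> p f k(1) k(3)[unfolded c_def]] by metis
    obtain T n where T: "T \<ge> 0" "n \<ge> N" "X T \<ge> n powr p"
      "\<And>s. s \<ge> 0 \<Longrightarrow> \<bar>b (T + s) - b T\<bar> \<le> \<delta> * (n + s) powr p"
      using restart[OF \<delta>(1), of N] by blast
    have ge: "X (T + s) \<ge> k * s powr p" if "s \<ge> 0" for s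
      using flow[of n "\<lambda>s. X (T + s) - (b (T + s) - b T)" "\<lambda>s. b (T + s) - b T" s]
        T shifted[OF T(1)] that by auto
    have "((\<lambda>t. k * ((t - T) / t) powr p) \<longlongrightarrow> k * 1 powr p) at_top"
      by (intro tendsto_intros) (real_asymp, simp)
    then have "eventually (\<lambda>t. k * ((t - T) / t) powr p > l) at_top"
      using k by (intro order_tendstoD) auto
    then show ?thesis
      using eventually_gt_at_top[of "max T 0"]
    proof eventually_elim
      case (elim t)
      have "l * t powr p < k * ((t - T) / t) powr p * t powr p"
        using elim by (intro mult_strict_right_mono) auto
      also have "\<dots> = k * (t - T) powr p" using elim by (simp add: powr_divide)
      also have "\<dots> \<le> X t" using ge[of "t - T"] elim by simp
      finally show ?case using elim by (simp add: field_simps)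
    qed
  qed
  show "eventually (\<lambda>t. l > X t / t powr p) at_top" if "l > (a * (1 - \<beta>)) powr p" for l
  proof -
    define k where "k = (l + c) / 2"
    have "l > c" using that by (simp add: c_def)
    then have k: "k > 0" "k < l" "k > c" using c by (auto simp: k_def)
    obtain \<delta> N where \<delta>: "\<delta> > 0" "N > 0" and flow:
      "\<And>n V w. n \<ge> N \<Longrightarrow> continuous_on {0..} V \<Longrightarrow>
      (\<And>s. s \<ge> 0 \<Longrightarrow> (V has_real_derivative f (V s + w s)) (at_right s)) \<Longrightarrow>
      (\<And>s. s \<ge> 0 \<Longrightarrow> \<bar>w s\<bar> \<le> \<delta> * (n + s) powr p) \<Longrightarrow>
      \<exists>s0\<ge>0. \<forall>s\<ge>0. V s + w s \<le> k * (s + s0) powr p"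
      using noisy_power_flow_upper[OF a \<beta> p f k(3)[unfolded c_def]] by metis
    obtain T n where T: "T \<ge> 0" "n \<ge> N" "X T \<ge> n powr p"
      "\<And>s. s \<ge> 0 \<Longrightarrow> \<bar>b (T + s) - b T\<bar> \<le> \<delta> * (n + s) powr p"
      using restart[OF \<delta>(1), of N] by blast
    obtain s0 where s0: "s0 \<ge> 0" and le: "\<And>s. s \<ge> 0 \<Longrightarrow> X (T + s) \<le> k * (s + s0) powr p"
      using flow[of n "\<lambda>s. X (T + s) - (b (T + s) - b T)" "\<lambda>s. b (T + s) - b T"]
        T shifted[OF T(1)] by auto
    have "((\<lambda>t. k * ((t + s0) / t) powr p) \<longlongrightarrow> k * 1 powr p) at_top"
      by (intro tendsto_intros) (real_asymp, simp)
    then have "eventually (\<lambda>t. k * ((t + s0) / t) powr p < l) at_top"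
      using k by (intro order_tendstoD) auto
    then show ?thesis
      using eventually_gt_at_top[of "max T 0"]
    proof eventually_elim
      case (elim t)
      have "X t \<le> k * (t - T + s0) powr p" using le[of "t - T"] elim by simp
      also have "\<dots> \<le> k * (t + s0) powr p"
        using elim T s0 p0 k by (intro mult_left_mono powr_mono2) auto
      also have "\<dots> = k * ((t + s0) / t) powr p * t powr p" using elim s0 by (simp add: powr_divide)
      also have "\<dots> < l * t powr p"
        using elim by (intro mult_strict_right_mono) auto
      finally show ?case using elim by (simp add: field_simps)
    qed
  qed
qed

section \<open>Second order: linearisation around the flow and size of the remainder\<close>

lemma has_real_derivative_powr_shift:
  fixes e y :: real
  assumes "1 + y > 0"
  shows "((\<lambda>y. (1 + y) powr e) has_real_derivative e * (1 + y) powr (e - 1)) (at y)"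
proof -
  have "((\<lambda>y. 1 + y) has_real_derivative 1) (at y)" by (auto intro!: derivative_eq_intros)
  from DERIV_fun_powr[OF this, of e] assms show ?thesis by simp
qed

lemma powr_bounded_near_one:
  fixes e :: real
  obtains C where "C > 0" "\<And>y. \<bar>y\<bar> \<le> 1 / 2 \<Longrightarrow> (1 + y) powr e \<le> C"
proof -
  have "compact ((\<lambda>y. (1 + y) powr e) ` {-(1/2)..1/2::real})"
    by (intro compact_continuous_image continuous_intros) auto
  then have "bounded ((\<lambda>y. (1 + y) powr e) ` {-(1/2)..1/2::real})"
    by (rule compact_imp_bounded)
  then obtain C where C: "\<forall>x \<in> (\<lambda>y. (1 + y) powr e) ` {-(1/2)..1/2::real}. norm x \<le> C"
    unfolding bounded_iff ..
  have "(1 + y) powr e \<le> max C 1" if "\<bar>y\<bar> \<le> 1 / 2" for y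
  proof -
    have "y \<in> {-(1/2)..1/2}" using that by (auto simp: abs_le_iff)
    then have "norm ((1 + y) powr e) \<le> C" by (intro C[rule_format] imageI)
    then show ?thesis by simp
  qed
  then show ?thesis by (intro that[of "max C 1"]) auto
qed

text \<open>The mean value bound is used twice: first for the derivative
  \<open>(1 + z) powr (\<beta> - 1)\<close>, then for the function itself between
  \<open>-\<bar>z\<bar>\<close> and \<open>\<bar>z\<bar>\<close>. The restriction to
  \<open>\<bar>z\<bar> \<le> 1 / 2\<close> stays away from the singularity at -1.\<close>

lemma powr_second_order_bound:
  fixes \<beta> :: real
  obtains C where "C > 0" "\<And>z. \<bar>z\<bar> \<le> 1 / 2 \<Longrightarrow> \<bar>(1 + z) powr \<beta> - 1 - \<beta> * z\<bar> \<le> C * z\<^sup>2"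
proof -
  obtain C where C: "C > 0" "\<And>y. \<bar>y\<bar> \<le> 1 / 2 \<Longrightarrow> (1 + y) powr (\<beta> - 2) \<le> C"
    using powr_bounded_near_one by blast
  have 1: "\<bar>(1 + z) powr (\<beta> - 1) - 1\<bar> \<le> \<bar>\<beta> - 1\<bar> * C * \<bar>z\<bar>" if "\<bar>z\<bar> \<le> 1 / 2" for z
  proof -
    have "norm ((1 + z) powr (\<beta> - 1) - (1 + 0) powr (\<beta> - 1)) \<le> \<bar>\<beta> - 1\<bar> * C * norm (z - 0)"
    proof (rule field_differentiable_bound[where S = "{-(1/2)..1/2}" and f' = "\<lambda>y. (\<beta> - 1) * (1 + y) powr (\<beta> - 2)"])
      fix y :: real assume y: "y \<in> {-(1/2)..1/2}"
      have "((\<lambda>y. (1 + y) powr (\<beta> - 1)) has_field_derivative (\<beta> - 1) * (1 + y) powr (\<beta> - 1 - 1)) (at y)"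
        using y by (intro has_real_derivative_powr_shift) auto
      then show "((\<lambda>y. (1 + y) powr (\<beta> - 1)) has_field_derivative (\<beta> - 1) * (1 + y) powr (\<beta> - 2))
          (at y within {-(1/2)..1/2})"
        using has_field_derivative_at_within by force
      show "norm ((\<beta> - 1) * (1 + y) powr (\<beta> - 2)) \<le> \<bar>\<beta> - 1\<bar> * C"
        using C(2)[of y] y by (auto simp: abs_mult intro!: mult_left_mono)
    qed (use that in auto)
    then show ?thesis by simp
  qed
  \<comment> \<open>The summand 1 makes the constant positive when \<beta> is 0 or 1.\<close>
  define C' where "C' = \<bar>\<beta>\<bar> * \<bar>\<beta> - 1\<bar> * C + 1"
  have "\<bar>(1 + z) powr \<beta> - 1 - \<beta> * z\<bar> \<le> C' * z\<^sup>2" if z: "\<bar>z\<bar> \<le> 1 / 2" for z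
  proof -
    have "norm (((1 + z) powr \<beta> - \<beta> * z) - ((1 + 0) powr \<beta> - \<beta> * 0)) \<le> \<bar>\<beta>\<bar> * (\<bar>\<beta> - 1\<bar> * C * \<bar>z\<bar>) * norm (z - 0)"
    proof (rule field_differentiable_bound[where S = "{-\<bar>z\<bar>..\<bar>z\<bar>}" and f' = "\<lambda>y. \<beta> * ((1 + y) powr (\<beta> - 1) - 1)"])
      fix y :: real assume y: "y \<in> {-\<bar>z\<bar>..\<bar>z\<bar>}"
      then have y': "\<bar>y\<bar> \<le> \<bar>z\<bar>" by auto
      have "((\<lambda>y. (1 + y) powr \<beta> - \<beta> * y) has_field_derivative \<beta> * ((1 + y) powr (\<beta> - 1) - 1)) (at y)"
      proof -
        have "((\<lambda>y. (1 + y) powr \<beta> - \<beta> * y) has_field_derivative \<beta> * (1 + y) powr (\<beta> - 1) - \<beta> * 1) (at y)"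
          using y' z by (intro derivative_intros has_real_derivative_powr_shift) auto
        then show ?thesis by (simp add: right_diff_distrib)
      qed
      then show "((\<lambda>y. (1 + y) powr \<beta> - \<beta> * y) has_field_derivative \<beta> * ((1 + y) powr (\<beta> - 1) - 1))
          (at y within {-\<bar>z\<bar>..\<bar>z\<bar>})"
        by (rule has_field_derivative_at_within)
      have "\<bar>\<beta> - 1\<bar> * C * \<bar>y\<bar> \<le> \<bar>\<beta> - 1\<bar> * C * \<bar>z\<bar>"
        using y' C by (intro mult_left_mono) auto
      then show "norm (\<beta> * ((1 + y) powr (\<beta> - 1) - 1)) \<le> \<bar>\<beta>\<bar> * (\<bar>\<beta> - 1\<bar> * C * \<bar>z\<bar>)"
        using 1[of y] y' z by (auto simp: abs_mult intro!: mult_left_mono)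
    qed auto
    also have "\<dots> = \<bar>\<beta>\<bar> * \<bar>\<beta> - 1\<bar> * C * z\<^sup>2"
      by (simp add: power2_eq_square mult.assoc)
    finally have "\<bar>(1 + z) powr \<beta> - 1 - \<beta> * z\<bar> \<le> \<bar>\<beta>\<bar> * \<bar>\<beta> - 1\<bar> * C * z\<^sup>2"
      by (simp add: algebra_simps)
    also have "\<dots> \<le> C' * z\<^sup>2" by (intro mult_right_mono) (auto simp: C'_def)
    finally show ?thesis .
  qed
  then show ?thesis using C by (intro that[of C']) (auto simp: C'_def intro!: add_nonneg_pos)
qed

text \<open>With \<open>x = c * t powr p\<close> and \<open>z = Y / x\<close>, the speed of the flow
  is \<open>a * x powr \<beta> = x / (1 - \<beta>) / t\<close>, so the linear term of
  \<open>(1 + z) powr \<beta>\<close> becomes \<open>\<beta> / (1 - \<beta>) / t * Y\<close>. The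
  quadratic error is kept as \<open>\<bar>z\<bar> * \<bar>Y\<bar>\<close>: it serves once as a small
  multiple of \<open>\<bar>Y\<bar>\<close> and once as a square.\<close>

lemma flow_linearisation_bound:
  fixes a \<beta> p :: real
  assumes a: "a > 0" and \<beta>: "\<beta> < 1" and p: "p = 1 / (1 - \<beta>)" and c: "c = (a * (1 - \<beta>)) powr p"
  obtains C where "C > 0"
    "\<And>t Y. t > 0 \<Longrightarrow> \<bar>Y / (c * t powr p)\<bar> \<le> 1 / 2 \<Longrightarrow>
      \<bar>a * (c * t powr p + Y) powr \<beta> - c * p * t powr (p - 1) - \<beta> / (1 - \<beta>) / t * Y\<bar>
        \<le> C * \<bar>Y / (c * t powr p)\<bar> * \<bar>Y\<bar> / t"
proof -
  obtain C where C: "C > 0" "\<And>z. \<bar>z\<bar> \<le> 1 / 2 \<Longrightarrow> \<bar>(1 + z) powr \<beta> - 1 - \<beta> * z\<bar> \<le> C * z\<^sup>2"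
    using powr_second_order_bound by blast
  have c0: "c > 0" using a \<beta> by (simp add: c)
  have c\<beta>: "c powr (1 - \<beta>) = a * (1 - \<beta>)" using a \<beta> by (simp add: c p powr_powr)
  have p\<beta>: "p * \<beta> = p - 1" using \<beta> by (simp add: p field_simps)
  show thesis
  proof (rule that)
    show "C / (1 - \<beta>) > 0" using C \<beta> by simp
    fix t Y :: real assume t: "t > 0" and z_le: "\<bar>Y / (c * t powr p)\<bar> \<le> 1 / 2"
    define x where "x = c * t powr p"
    define z where "z = Y / x"
    have x: "x > 0" using c0 t by (simp add: x_def)
    have z: "\<bar>z\<bar> \<le> 1 / 2" using z_le by (simp add: z_def x_def)
    have Y: "Y = x * z" using x by (simp add: z_def)
    have "(x + Y) powr \<beta> = (x * (1 + z)) powr \<beta>" by (simp add: Y algebra_simps)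
    also have "\<dots> = x powr \<beta> * (1 + z) powr \<beta>" using x z by (intro powr_mult; linarith)
    finally have X: "(x + Y) powr \<beta> = x powr \<beta> * (1 + z) powr \<beta>" .
    have "x powr \<beta> = c powr \<beta> * t powr (p - 1)"
      using c0 t by (simp add: x_def powr_mult powr_powr p\<beta>)
    also have "c powr \<beta> = c / c powr (1 - \<beta>)" using c0 by (simp add: powr_diff)
    also have "c / c powr (1 - \<beta>) = c * p / a" using \<beta> a by (simp add: c\<beta> p)
    finally have ax: "a * x powr \<beta> = c * p * t powr (p - 1)" using a by simp
    have axt: "a * x powr \<beta> = x / (1 - \<beta>) / t"
      unfolding ax using t by (simp add: x_def p powr_diff)
    have "\<beta> / (1 - \<beta>) / t * Y = x / (1 - \<beta>) / t * (\<beta> * z)"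
      by (simp add: Y mult_ac)
    moreover have "a * (x + Y) powr \<beta> = x / (1 - \<beta>) / t * (1 + z) powr \<beta>"
      unfolding X axt[symmetric] by simp
    ultimately have "a * (x + Y) powr \<beta> - c * p * t powr (p - 1) - \<beta> / (1 - \<beta>) / t * Y =
        x / (1 - \<beta>) / t * ((1 + z) powr \<beta> - 1 - \<beta> * z)"
      unfolding ax[symmetric] axt by (simp only: right_diff_distrib mult_1_right)
    also have "\<bar>\<dots>\<bar> = x / (1 - \<beta>) / t * \<bar>(1 + z) powr \<beta> - 1 - \<beta> * z\<bar>"
      using x \<beta> t by (simp only: abs_mult) simp
    also have "\<dots> \<le> x / (1 - \<beta>) / t * (C * z\<^sup>2)"
      using x \<beta> t by (intro mult_left_mono C(2) z) auto
    also have "\<dots> = C / (1 - \<beta>) * \<bar>z\<bar> * \<bar>Y\<bar> / t"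
      using x by (simp add: Y abs_mult power2_eq_square)
    finally show "\<bar>a * (c * t powr p + Y) powr \<beta> - c * p * t powr (p - 1) - \<beta> / (1 - \<beta>) / t * Y\<bar>
        \<le> C / (1 - \<beta>) * \<bar>Y / (c * t powr p)\<bar> * \<bar>Y\<bar> / t"
      by (simp add: z_def x_def)
  qed
qed

text \<open>The remainder \<open>D\<close> satisfies the Euler equation up to the quadratic error
  and the error of \<open>f\<close>. A bootstrap: convergence of \<open>X t / t powr p\<close> makes
  the quadratic error a small multiple of \<open>\<bar>Y\<bar>\<close>, whence
  \<open>Y = O(t powr m)\<close> for some \<open>m\<close> slightly above \<open>q\<close>; inserted
  back, the quadratic error is \<open>O(t powr (2 * m - p))\<close>, of smaller order than
  \<open>t powr q\<close>, and all forcing becomes an arbitrarily small multiple of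
  \<open>t powr q\<close>.\<close>

lemma flow_fluctuation_asymptotics:
  fixes f X b w :: "real \<Rightarrow> real"
  assumes a: "a > 0" and \<beta>: "\<beta> < 1" and p: "p = 1 / (1 - \<beta>)" and c: "c = (a * (1 - \<beta>)) powr p"
    and \<gamma>: "\<gamma> = \<beta> / (1 - \<beta>)" and q: "\<gamma> < q" "q < p" "p * (\<beta> - r) = q - 1"
    and f: "(\<lambda>x. f x - a * x powr \<beta>) \<in> o[at_top](\<lambda>x. x powr (\<beta> - r))"
    and X: "((\<lambda>t. X t / t powr p) \<longlongrightarrow> c) at_top"
    and contX: "continuous_on {0<..} (\<lambda>t. X t - b t)"
    and derivX: "\<And>t. t > 0 \<Longrightarrow> ((\<lambda>t. X t - b t) has_real_derivative f (X t)) (at_right t)"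
    and contw: "continuous_on {0<..} w"
    and derivw: "\<And>t. t > 0 \<Longrightarrow> (w has_real_derivative \<gamma> * (w t + b t) / t) (at_right t)"
    and b: "\<And>\<epsilon>. \<epsilon> > 0 \<Longrightarrow> \<exists>C. \<forall>t\<ge>1. \<bar>b t\<bar> \<le> C * t powr (q + \<epsilon>)"
  shows "(\<lambda>t. X t - c * t powr p - b t - w t) \<in> o[at_top](\<lambda>t. t powr q)"
proof -
  define D where "D = (\<lambda>t. X t - b t - w t - c * t powr p)"
  define D' where "D' = (\<lambda>t. f (X t) - \<gamma> * (w t + b t) / t - c * p * t powr (p - 1))"
  define Y where "Y = (\<lambda>t. X t - c * t powr p)"
  define z where "z = (\<lambda>t. Y t / (c * t powr p))"
  \<comment> \<open>Any exponent strictly between \<open>q\<close> and \<open>(p + q) / 2\<close>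
    would do: \<open>b\<close> is only known to be bounded by powers above \<open>q\<close>, and the
    square needs \<open>2 * m - p < q\<close>.\<close>
  define m where "m = q + (p - q) / 4"
  have m: "q < m" "2 * m - p < q" "\<gamma> < m" using q by (auto simp: m_def field_simps)
  have c0: "c > 0" using a \<beta> by (simp add: c)
  have p0: "p > 0" using \<beta> by (simp add: p)
  have contD: "continuous_on {T..} D" if "T > 0" for T
  proof -
    have "continuous_on {T..} (\<lambda>t. X t - b t)" "continuous_on {T..} w"
      by (rule continuous_on_subset[OF contX] continuous_on_subset[OF contw]; use that in force)+
    moreover have "continuous_on {T..} (\<lambda>t. c * t powr p)"
      using that by (intro continuous_intros) auto
    ultimately show ?thesis unfolding D_def
      using continuous_on_diff[OF continuous_on_diff] by blast
  qed
  have derivD: "(D has_real_derivative D' t) (at_right t)" if "t > 0" for t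
  proof -
    have "((\<lambda>t. c * t powr p) has_real_derivative c * (p * t powr (p - 1))) (at_right t)"
      by (rule DERIV_cmult[OF has_field_derivative_at_within[OF has_real_derivative_powr[OF that]]])
    from DERIV_diff[OF DERIV_diff[OF derivX derivw] this] that show ?thesis
      by (simp add: D_def D'_def mult.assoc)
  qed
  have z: "(z \<longlongrightarrow> 0) at_top"
  proof -
    have "((\<lambda>t. X t / t powr p / c - 1) \<longlongrightarrow> c / c - 1) at_top"
      by (intro tendsto_intros X) (use c0 in auto)
    then have "((\<lambda>t. X t / t powr p / c - 1) \<longlongrightarrow> 0) at_top" using c0 by simp
    then show ?thesis
      by (rule Lim_transform_eventually)
        (use eventually_gt_at_top[of 0] in \<open>eventually_elim, use c0 in \<open>simp add: z_def Y_def field_simps\<close>\<close>)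
  qed
  have X_top: "filterlim X at_top at_top"
  proof -
    have "filterlim (\<lambda>t. X t / t powr p * t powr p) at_top at_top"
      by (rule filterlim_tendsto_pos_mult_at_top[OF X c0]) (use p0 in real_asymp)
    then show ?thesis
      by (rule filterlim_cong[THEN iffD1, OF refl refl, rotated])
        (use eventually_gt_at_top[of 0] in \<open>eventually_elim, auto\<close>)
  qed
  \<comment> \<open>Along the flow \<open>x powr (\<beta> - r)\<close> is of order
    \<open>t powr (p * (\<beta> - r))\<close>, that is \<open>t powr (q - 1)\<close>.\<close>
  have e_small: "eventually (\<lambda>t. \<bar>f (X t) - a * X t powr \<beta>\<bar> \<le> \<epsilon> * t powr q / t) at_top" if "\<epsilon> > 0" for \<epsilon>
  proof -
    have "((\<lambda>t. (X t / t powr p) powr (\<beta> - r)) \<longlongrightarrow> c powr (\<beta> - r)) at_top"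
      by (intro tendsto_intros X) (use c0 in auto)
    then have "eventually (\<lambda>t. (X t / t powr p) powr (\<beta> - r) < c powr (\<beta> - r) + 1) at_top"
      by (intro order_tendstoD) auto
    moreover have "\<epsilon> / (c powr (\<beta> - r) + 1) > 0" using that by (simp add: add_nonneg_pos)
    then have "eventually (\<lambda>x. norm (f x - a * x powr \<beta>) \<le> \<epsilon> / (c powr (\<beta> - r) + 1) * norm (x powr (\<beta> - r))) at_top"
      using f by (intro landau_o.smallD)
    then have "eventually (\<lambda>t. norm (f (X t) - a * X t powr \<beta>) \<le> \<epsilon> / (c powr (\<beta> - r) + 1) * norm (X t powr (\<beta> - r))) at_top"
      by (rule eventually_compose_filterlim[OF _ X_top])
    moreover have "eventually (\<lambda>t. X t > 0) at_top"
      using X_top by (simp add: filterlim_at_top_dense)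
    ultimately show ?thesis
      using eventually_gt_at_top[of 0]
    proof eventually_elim
      case (elim t)
      define k where "k = c powr (\<beta> - r) + 1"
      have k: "k > 0" by (simp add: k_def add_nonneg_pos)
      have "X t powr (\<beta> - r) = (X t / t powr p * t powr p) powr (\<beta> - r)" using elim by simp
      also have "\<dots> = (X t / t powr p) powr (\<beta> - r) * t powr (q - 1)"
        using elim by (subst powr_mult) (auto simp: powr_powr q)
      also have "\<dots> \<le> k * t powr (q - 1)"
        using elim by (intro mult_right_mono) (auto simp: k_def)
      finally have "\<epsilon> / k * X t powr (\<beta> - r) \<le> \<epsilon> / k * (k * t powr (q - 1))"
        using that k by (intro mult_left_mono) auto
      also have "\<dots> = \<epsilon> * t powr q / t" using k elim by (simp add: powr_diff)
      finally show ?case using elim by (simp add: k_def)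
    qed
  qed
  obtain C1 where C1: "C1 > 0" and lin: "\<And>t Y. t > 0 \<Longrightarrow> \<bar>Y / (c * t powr p)\<bar> \<le> 1 / 2 \<Longrightarrow>
      \<bar>a * (c * t powr p + Y) powr \<beta> - c * p * t powr (p - 1) - \<gamma> / t * Y\<bar>
        \<le> C1 * \<bar>Y / (c * t powr p)\<bar> * \<bar>Y\<bar> / t"
    using flow_linearisation_bound[OF a \<beta> p c] unfolding \<gamma> by metis
  have D'_bound: "eventually (\<lambda>t. \<bar>D' t - \<gamma> / t * D t\<bar> \<le> (C1 * \<bar>z t\<bar> * \<bar>Y t\<bar> + \<epsilon> * t powr q) / t) at_top"
    if "\<epsilon> > 0" for \<epsilon>
  proof -
    have "eventually (\<lambda>t. \<bar>z t\<bar> < 1 / 2) at_top"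
      using tendstoD[OF z, of "1/2"] by simp
    then show ?thesis
      using e_small[OF that] eventually_gt_at_top[of 0]
    proof eventually_elim
      case (elim t)
      have "\<bar>a * X t powr \<beta> - c * p * t powr (p - 1) - \<gamma> / t * Y t\<bar> \<le> C1 * \<bar>z t\<bar> * \<bar>Y t\<bar> / t"
        using lin[of t "Y t"] elim by (simp add: z_def Y_def)
      \<comment> \<open>Since \<open>Y = D + (w + b)\<close>, the drift of \<open>w\<close> cancels
        the part \<open>\<gamma> / t * (w + b)\<close> of the linear term.\<close>
      moreover have "D' t - \<gamma> / t * D t =
        (a * X t powr \<beta> - c * p * t powr (p - 1) - \<gamma> / t * Y t) + (f (X t) - a * X t powr \<beta>)"
        by (simp add: D'_def D_def Y_def add_divide_distrib diff_divide_distrib algebra_simps)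
      ultimately show ?case using elim by (simp add: add_divide_distrib)
    qed
  qed
  obtain Cb where Cb: "\<And>t. t \<ge> 1 \<Longrightarrow> \<bar>b t\<bar> \<le> Cb * t powr m"
    using b[of "(p - q) / 4"] q by (auto simp: m_def)
  have Cb0: "Cb \<ge> 0" using Cb[of 1] by simp
  \<comment> \<open>\<open>w\<close> solves an Euler equation with forcing
    \<open>\<gamma> / t * b t\<close>, so it inherits the growth of \<open>b\<close>.\<close>
  obtain Cw where Cw: "\<And>t. t \<ge> 1 \<Longrightarrow> \<bar>w t + b t\<bar> \<le> Cw * t powr m" "Cw \<ge> 0"
  proof -
    define M where "M = (\<bar>\<gamma>\<bar> * Cb + 1) / (m - \<gamma>)"
    have M: "M \<ge> 0" "M * (m - \<gamma> - 0) > \<bar>\<gamma>\<bar> * Cb" using m Cb0 by (auto simp: M_def)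
    have "\<bar>\<gamma> * (w t + b t) / t - \<gamma> / t * w t\<bar> \<le> (0 * \<bar>w t\<bar> + \<bar>\<gamma>\<bar> * Cb * t powr m) / t" if "t \<ge> 1" for t
    proof -
      have "\<gamma> * (w t + b t) / t - \<gamma> / t * w t = \<gamma> * b t / t"
        by (simp add: algebra_simps add_divide_distrib)
      moreover have "\<bar>\<gamma>\<bar> * \<bar>b t\<bar> / t \<le> \<bar>\<gamma>\<bar> * (Cb * t powr m) / t"
        using that Cb[OF that] by (intro divide_right_mono mult_left_mono) auto
      ultimately show ?thesis using that by (simp add: abs_mult mult.assoc)
    qed
    note bound = this
    obtain K where K: "K \<ge> 0" "\<And>t. t \<ge> 1 \<Longrightarrow> \<bar>w t\<bar> \<le> K * t powr (\<gamma> + 0) + M * t powr m"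
    proof (rule perturbed_euler_bound[where D = w and D' = "\<lambda>t. \<gamma> * (w t + b t) / t" and T = 1 and \<gamma> = \<gamma>
        and \<eta> = 0 and C = "\<bar>\<gamma>\<bar> * Cb" and q = m and M = M])
      show "continuous_on {1..} w" by (rule continuous_on_subset[OF contw]) auto
    qed (use M derivw bound in auto)
    have "\<bar>w t + b t\<bar> \<le> (K + M + Cb) * t powr m" if "t \<ge> 1" for t
    proof -
      have "K * t powr \<gamma> \<le> K * t powr m" using K m that by (intro mult_left_mono powr_mono) auto
      then show ?thesis using K(2)[OF that] Cb[OF that] by (simp add: algebra_simps)
    qed
    then show thesis using that[of "K + M + Cb"] K M Cb0 by simp
  qed
  \<comment> \<open>First stage of the bootstrap: smallness of \<open>z\<close> turns the quadratic
    error into \<open>\<eta> * \<bar>Y\<bar>\<close>, with \<open>\<eta>\<close> chosen so that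
    \<open>\<gamma> + \<eta> < m\<close>.\<close>
  obtain CY where CY: "eventually (\<lambda>t. \<bar>Y t\<bar> \<le> CY * t powr m) at_top" "CY \<ge> 0"
  proof -
    define \<eta> where "\<eta> = (m - \<gamma>) / 2"
    define C where "C = \<eta> * Cw + 1"
    define M where "M = (C + 1) / (m - \<gamma> - \<eta>)"
    have \<eta>: "\<eta> > 0" "m - \<gamma> - \<eta> > 0" using m by (auto simp: \<eta>_def field_simps)
    have C: "C > 0" using \<eta> Cw by (simp add: C_def add_nonneg_pos)
    have M: "M \<ge> 0" "M * (m - \<gamma> - \<eta>) > C" using \<eta> C by (auto simp: M_def)
    have "eventually (\<lambda>t. \<bar>z t\<bar> < \<eta> / C1) at_top"
      using tendstoD[OF z, of "\<eta> / C1"] \<eta> C1 by simp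
    moreover have "eventually (\<lambda>t. \<bar>D' t - \<gamma> / t * D t\<bar> \<le> (C1 * \<bar>z t\<bar> * \<bar>Y t\<bar> + t powr q) / t) at_top"
      using D'_bound[of 1] by simp
    ultimately have "eventually (\<lambda>t. t \<ge> 1 \<and> \<bar>D' t - \<gamma> / t * D t\<bar> \<le> (\<eta> * \<bar>D t\<bar> + C * t powr m) / t) at_top"
      using eventually_ge_at_top[of 1]
    proof eventually_elim
      case (elim t)
      have "C1 * \<bar>z t\<bar> \<le> \<eta>" using elim C1 by (simp add: field_simps)
      then have "C1 * \<bar>z t\<bar> * \<bar>Y t\<bar> \<le> \<eta> * \<bar>Y t\<bar>" by (intro mult_right_mono) auto
      also have "\<dots> \<le> \<eta> * (\<bar>D t\<bar> + Cw * t powr m)"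
        using Cw(1)[of t] elim \<eta> by (intro mult_left_mono) (auto simp: Y_def D_def)
      finally have 1: "C1 * \<bar>z t\<bar> * \<bar>Y t\<bar> \<le> \<eta> * (\<bar>D t\<bar> + Cw * t powr m)" .
      have "t powr q \<le> t powr m" using elim m by (intro powr_mono) auto
      with 1 have "C1 * \<bar>z t\<bar> * \<bar>Y t\<bar> + t powr q \<le> \<eta> * \<bar>D t\<bar> + C * t powr m"
        by (simp add: C_def algebra_simps)
      then have "(C1 * \<bar>z t\<bar> * \<bar>Y t\<bar> + t powr q) / t \<le> (\<eta> * \<bar>D t\<bar> + C * t powr m) / t"
        using elim by (intro divide_right_mono) auto
      then show ?case using elim by linarith
    qed
    then obtain T where T: "\<And>t. t \<ge> T \<Longrightarrow> t \<ge> 1 \<and> \<bar>D' t - \<gamma> / t * D t\<bar> \<le> (\<eta> * \<bar>D t\<bar> + C * t powr m) / t"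
      by (auto simp: eventually_at_top_linorder)
    have "T > 0" using T[of T] by simp
    obtain K where K: "K \<ge> 0" "\<And>t. t \<ge> T \<Longrightarrow> \<bar>D t\<bar> \<le> K * t powr (\<gamma> + \<eta>) + M * t powr m"
    proof (rule perturbed_euler_bound[where D = D and D' = D' and T = T and \<gamma> = \<gamma>
        and \<eta> = \<eta> and C = C and q = m and M = M])
      show "(D has_real_derivative D' t) (at_right t)" if "t \<ge> T" for t
        using derivD \<open>T > 0\<close> that by simp
    qed (use M \<open>T > 0\<close> contD T in blast)+
    have "eventually (\<lambda>t. \<bar>Y t\<bar> \<le> (K + M + Cw) * t powr m) at_top"
      using eventually_ge_at_top[of T]
    proof eventually_elim
      case (elim t)
      have "K * t powr (\<gamma> + \<eta>) \<le> K * t powr m"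
        using K \<eta> T[OF elim] by (intro mult_left_mono powr_mono) auto
      moreover have "\<bar>Y t\<bar> \<le> \<bar>D t\<bar> + \<bar>w t + b t\<bar>" by (simp add: Y_def D_def)
      ultimately show ?case using K(2)[OF elim] Cw(1)[of t] T[OF elim] by (simp add: algebra_simps)
    qed
    then show thesis using that[of "K + M + Cw"] K M Cw by simp
  qed
  have "D \<in> o[at_top](\<lambda>t. t powr q)"
  proof (rule landau_o.smallI)
    fix \<delta> :: real assume \<delta>: "\<delta> > 0"
    \<comment> \<open>Chosen so that with \<open>M = \<delta> / 2\<close> the product
      \<open>M * (q - \<gamma>)\<close> exceeds the total forcing constant
      \<open>2 * \<epsilon>\<close>; the other half of \<open>\<delta>\<close> is left for the term
      in \<open>t powr \<gamma>\<close>.\<close>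
    define \<epsilon> where "\<epsilon> = \<delta> * (q - \<gamma>) / 8"
    have \<epsilon>: "\<epsilon> > 0" using \<delta> q by (simp add: \<epsilon>_def)
    define M where "M = \<delta> / 2"
    have M: "M \<ge> 0" "M * (q - \<gamma> - 0) > 2 * \<epsilon>" using \<delta> q by (auto simp: M_def \<epsilon>_def)
    have "((\<lambda>t. C1 * CY\<^sup>2 / c * t powr (2 * m - p - q)) \<longlongrightarrow> 0) at_top"
      by (rule tendsto_mult_right_zero) (use m in \<open>intro tendsto_neg_powr filterlim_ident, auto\<close>)
    then have "eventually (\<lambda>t. C1 * CY\<^sup>2 / c * t powr (2 * m - p - q) < \<epsilon>) at_top"
      using \<epsilon> by (intro order_tendstoD) auto
    with D'_bound[OF \<epsilon>] CY(1)
    have "eventually (\<lambda>t. t \<ge> 1 \<and> \<bar>D' t - \<gamma> / t * D t\<bar> \<le> (0 * \<bar>D t\<bar> + 2 * \<epsilon> * t powr q) / t) at_top"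
      using eventually_ge_at_top[of 1]
    proof eventually_elim
      case (elim t)
      have "C1 * \<bar>z t\<bar> * \<bar>Y t\<bar> = C1 / (c * t powr p) * \<bar>Y t\<bar>\<^sup>2"
        using c0 by (simp add: z_def power2_eq_square abs_mult)
      also have "\<dots> \<le> C1 / (c * t powr p) * (CY * t powr m)\<^sup>2"
        using C1 c0 elim by (intro mult_left_mono power_mono) auto
      also have "(CY * t powr m)\<^sup>2 = CY\<^sup>2 * (t powr p * (t powr (2 * m - p - q) * t powr q))"
        using elim by (simp add: power_mult_distrib power2_eq_square flip: powr_add)
      also have "C1 / (c * t powr p) * \<dots> = C1 * CY\<^sup>2 / c * t powr (2 * m - p - q) * t powr q"
        using elim by simp
      also have "\<dots> \<le> \<epsilon> * t powr q" using elim by (intro mult_right_mono) auto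
      finally have "(C1 * \<bar>z t\<bar> * \<bar>Y t\<bar> + \<epsilon> * t powr q) / t \<le> (2 * \<epsilon> * t powr q) / t"
        using elim by (intro divide_right_mono) auto
      then show ?case using elim by simp
    qed
    then obtain T where T: "\<And>t. t \<ge> T \<Longrightarrow> t \<ge> 1 \<and> \<bar>D' t - \<gamma> / t * D t\<bar> \<le> (0 * \<bar>D t\<bar> + 2 * \<epsilon> * t powr q) / t"
      by (auto simp: eventually_at_top_linorder)
    have "T > 0" using T[of T] by simp
    obtain K where K: "K \<ge> 0" "\<And>t. t \<ge> T \<Longrightarrow> \<bar>D t\<bar> \<le> K * t powr (\<gamma> + 0) + M * t powr q"
    proof (rule perturbed_euler_bound[where D = D and D' = D' and T = T and \<gamma> = \<gamma>
        and \<eta> = 0 and C = "2 * \<epsilon>" and q = q and M = M])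
      show "(D has_real_derivative D' t) (at_right t)" if "t \<ge> T" for t
        using derivD \<open>T > 0\<close> that by simp
    qed (use M \<open>T > 0\<close> contD T in blast)+
    have "((\<lambda>t. K * t powr (\<gamma> - q)) \<longlongrightarrow> 0) at_top"
      by (rule tendsto_mult_right_zero) (use q in \<open>intro tendsto_neg_powr filterlim_ident, auto\<close>)
    then have "eventually (\<lambda>t. K * t powr (\<gamma> - q) < \<delta> / 2) at_top"
      using \<delta> by (intro order_tendstoD) auto
    then show "eventually (\<lambda>t. norm (D t) \<le> \<delta> * norm (t powr q)) at_top"
      using eventually_ge_at_top[of T]
    proof eventually_elim
      case (elim t)
      have "K * t powr \<gamma> = K * t powr (\<gamma> - q) * t powr q" using T[OF elim(2)] by (simp flip: powr_add)
      also have "\<dots> \<le> \<delta> / 2 * t powr q" using elim by (intro mult_right_mono) auto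
      finally show ?case using K(2)[OF elim(2)] by (simp add: M_def)
    qed
  qed
  then show ?thesis by (simp add: D_def algebra_simps)
qed

section \<open>Independent increments\<close>

text \<open>A single product identity carries both the independence of \<open>Z\<close> from
  \<open>G\<close> and the law of \<open>Z\<close>: taking the whole space for \<open>A\<close>
  gives the law. In this form the property passes to sums and limits.\<close>

definition indep_law :: "'a measure \<Rightarrow> 'a measure \<Rightarrow> ('a \<Rightarrow> real) \<Rightarrow> real measure \<Rightarrow> bool" where
  "indep_law M G Z \<nu> \<longleftrightarrow> Z \<in> borel_measurable M \<and> prob_space \<nu> \<and> sets \<nu> = sets borel \<and>
     (\<forall>A\<in>sets G. \<forall>C\<in>sets borel. emeasure M (A \<inter> (Z -` C \<inter> space M)) = emeasure M A * emeasure \<nu> C)"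

lemma indep_law_distr:
  assumes "prob_space M" "subalgebra M G" "indep_law M G Z \<nu>"
  shows "distr M borel Z = \<nu>"
proof (rule measure_eqI)
  interpret prob_space M by fact
  have Z: "Z \<in> borel_measurable M" and \<nu>: "sets \<nu> = sets borel" and
    ind: "\<And>A C. A \<in> sets G \<Longrightarrow> C \<in> sets borel \<Longrightarrow>
      emeasure M (A \<inter> (Z -` C \<inter> space M)) = emeasure M A * emeasure \<nu> C"
    using assms(3) by (auto simp: indep_law_def)
  show "sets (distr M borel Z) = sets \<nu>" using \<nu> by simp
  fix C assume C: "C \<in> sets (distr M borel Z)"
  have "space M \<in> sets G" using assms(2) sets.top[of G] by (simp add: subalgebra_def)
  from ind[OF this, of C] C Z show "emeasure (distr M borel Z) C = emeasure \<nu> C"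
    by (simp add: emeasure_distr emeasure_space_1 Int_absorb1)
qed

text \<open>The law of \<open>(\<omega>, Z \<omega>)\<close> on
  \<open>G \<Otimes>\<^sub>M borel\<close> is the product of the restriction of \<open>M\<close> to
  \<open>G\<close> with \<nu>; the formula is then Tonelli. The first component is the sample point
  itself, read in the smaller sigma-algebra, so \<open>H\<close> may depend on everything known in
  \<open>G\<close>.\<close>

lemma nn_integral_indep_law:
  assumes M: "prob_space M" and G: "subalgebra M G" and Z: "indep_law M G Z \<nu>"
    and H: "H \<in> borel_measurable (G \<Otimes>\<^sub>M borel)"
  shows "(\<integral>\<^sup>+\<omega>. H (\<omega>, Z \<omega>) \<partial>M) = (\<integral>\<^sup>+\<omega>. (\<integral>\<^sup>+y. H (\<omega>, y) \<partial>\<nu>) \<partial>M)"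
proof -
  interpret M: prob_space M by fact
  have Zm[measurable]: "Z \<in> borel_measurable M" and \<nu>[measurable_cong]: "sets \<nu> = sets borel" and p: "prob_space \<nu>" and
    ind: "\<And>A C. A \<in> sets G \<Longrightarrow> C \<in> sets borel \<Longrightarrow>
      emeasure M (A \<inter> (Z -` C \<inter> space M)) = emeasure M A * emeasure \<nu> C"
    using Z by (auto simp: indep_law_def)
  interpret \<nu>: prob_space \<nu> by fact
  have spG: "space G = space M" using G by (simp add: subalgebra_def)
  have id[measurable]: "(\<lambda>\<omega>. \<omega>) \<in> M \<rightarrow>\<^sub>M G" using measurable_from_subalg[OF G measurable_ident] by (simp add: id_def)
  define P where "P = restr_to_subalg M G"
  have setsP: "sets P = sets G" "space P = space M" using G by (auto simp: P_def sets_restr_to_subalg space_restr_to_subalg)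
  interpret P: prob_space P 
    unfolding P_def by (rule prob_space_restr_to_subalg[OF G M])
  have eq: "P \<Otimes>\<^sub>M \<nu> = distr M (G \<Otimes>\<^sub>M borel) (\<lambda>\<omega>. (\<omega>, Z \<omega>))"
  proof (rule pair_measure_eqI)
    show "sets (P \<Otimes>\<^sub>M \<nu>) = sets (distr M (G \<Otimes>\<^sub>M borel) (\<lambda>\<omega>. (\<omega>, Z \<omega>)))"
      using setsP \<nu> by (simp cong: sets_pair_measure_cong)
    fix A C assume A: "A \<in> sets P" and C: "C \<in> sets \<nu>"
    have "(\<lambda>\<omega>. (\<omega>, Z \<omega>)) -` (A \<times> C) \<inter> space M = A \<inter> (Z -` C \<inter> space M)" by auto
    then have "emeasure (distr M (G \<Otimes>\<^sub>M borel) (\<lambda>\<omega>. (\<omega>, Z \<omega>))) (A \<times> C) = emeasure M A * emeasure \<nu> C"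
      using A C setsP \<nu> ind[of A C] by (subst emeasure_distr) auto
    then show "emeasure P A * emeasure \<nu> C = emeasure (distr M (G \<Otimes>\<^sub>M borel) (\<lambda>\<omega>. (\<omega>, Z \<omega>))) (A \<times> C)"
      using A setsP G by (simp add: P_def emeasure_restr_to_subalg)
  qed (rule P.sigma_finite_measure \<nu>.sigma_finite_measure)+
  have H': "H \<in> borel_measurable (P \<Otimes>\<^sub>M \<nu>)"
    using H setsP \<nu> by (subst measurable_cong_sets[OF sets_pair_measure_cong refl]) auto
  have "(\<integral>\<^sup>+\<omega>. H (\<omega>, Z \<omega>) \<partial>M) = (\<integral>\<^sup>+z. H z \<partial>distr M (G \<Otimes>\<^sub>M borel) (\<lambda>\<omega>. (\<omega>, Z \<omega>)))"
    using H by (subst nn_integral_distr) auto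
  also have "\<dots> = (\<integral>\<^sup>+z. H z \<partial>(P \<Otimes>\<^sub>M \<nu>))" by (simp add: eq)
  also have "\<dots> = (\<integral>\<^sup>+\<omega>. (\<integral>\<^sup>+y. H (\<omega>, y) \<partial>\<nu>) \<partial>P)"
    by (rule \<nu>.nn_integral_fst[OF H', symmetric])
  also have "\<dots> = (\<integral>\<^sup>+\<omega>. (\<integral>\<^sup>+y. H (\<omega>, y) \<partial>\<nu>) \<partial>M)"
  proof -
    have "(\<lambda>\<omega>. \<integral>\<^sup>+y. H (\<omega>, y) \<partial>\<nu>) \<in> borel_measurable P"
      using \<nu>.borel_measurable_nn_integral_fst[OF H'] .
    then have "(\<lambda>\<omega>. \<integral>\<^sup>+y. H (\<omega>, y) \<partial>\<nu>) \<in> borel_measurable G"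
      unfolding measurable_cong_sets[OF setsP(1) refl] .
    then show ?thesis unfolding P_def by (rule nn_integral_subalgebra2[OF G])
  qed
  finally show ?thesis .
qed

lemma indep_law_scale:
  assumes "indep_law M G Z \<nu>"
  shows "indep_law M G (\<lambda>\<omega>. a * Z \<omega>) (distr \<nu> borel (\<lambda>x. a * x))"
proof -
  have Z[measurable]: "Z \<in> borel_measurable M" and \<nu>: "sets \<nu> = sets borel" "prob_space \<nu>" and
    ind: "\<And>A C. A \<in> sets G \<Longrightarrow> C \<in> sets borel \<Longrightarrow>
      emeasure M (A \<inter> (Z -` C \<inter> space M)) = emeasure M A * emeasure \<nu> C"
    using assms by (auto simp: indep_law_def)
  have m: "(\<lambda>x. a * x) \<in> borel_measurable \<nu>" using \<nu> by (simp cong: measurable_cong_sets)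
  have sp: "space \<nu> = UNIV" using sets_eq_imp_space_eq[OF \<nu>(1)] by simp
  show ?thesis unfolding indep_law_def
  proof (intro conjI ballI)
    show "prob_space (distr \<nu> borel (\<lambda>x. a * x))" by (rule prob_space.prob_space_distr[OF \<nu>(2) m])
    fix A C assume A: "A \<in> sets G" and C: "C \<in> sets (borel :: real measure)"
    have "(\<lambda>x. a * x) -` C \<in> sets borel" using measurable_sets_borel[of "\<lambda>x. a * x" borel C] C by auto
    from ind[OF A this]
    show "emeasure M (A \<inter> ((\<lambda>\<omega>. a * Z \<omega>) -` C \<inter> space M)) = emeasure M A * emeasure (distr \<nu> borel (\<lambda>x. a * x)) C"
      using m C sp by (simp add: emeasure_distr vimage_def)
  qed auto
qed

text \<open>\<open>Z2\<close> is integrated out first, given \<open>H\<close>, with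
  \<open>Z1\<close> as a known parameter; then \<open>Z1\<close> is integrated out given
  \<open>G\<close>.\<close>

lemma indep_law_add:
  assumes M: "prob_space M" and G: "subalgebra M G" and H: "subalgebra M H" and GH: "sets G \<subseteq> sets H"
    and Z1: "indep_law M G Z1 \<nu>1" "Z1 \<in> borel_measurable H" and Z2: "indep_law M H Z2 \<nu>2"
  shows "indep_law M G (\<lambda>\<omega>. Z1 \<omega> + Z2 \<omega>) (\<nu>1 \<star> \<nu>2)"
proof -
  interpret M: prob_space M by fact
  have m[measurable]: "Z1 \<in> borel_measurable M" "Z2 \<in> borel_measurable M"
    and \<nu>[measurable_cong]: "sets \<nu>1 = sets borel" "sets \<nu>2 = sets borel" and p: "prob_space \<nu>1" "prob_space \<nu>2"
    using Z1 Z2 by (auto simp: indep_law_def)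
  interpret \<nu>1: prob_space \<nu>1 by fact
  interpret \<nu>2: prob_space \<nu>2 by fact
  interpret pair_prob_space \<nu>1 \<nu>2 ..
  have sp: "space G = space M" "space H = space M" using G H by (auto simp: subalgebra_def)
  show ?thesis unfolding indep_law_def
  proof (intro conjI ballI)
    show "prob_space (\<nu>1 \<star> \<nu>2)" unfolding convolution_def
      by (intro prob_space_distr) measurable
    fix A C assume A: "A \<in> sets G" and C[measurable]: "C \<in> sets (borel :: real measure)"
    have [measurable]: "A \<in> sets H" "A \<in> sets M" using A GH G by (auto simp: subalgebra_def)
    have [measurable]: "Z1 \<in> borel_measurable H" by fact
    have 1: "(\<integral>\<^sup>+\<omega>. indicator A \<omega> * indicator C (Z1 \<omega> + Z2 \<omega>) \<partial>M) =
        (\<integral>\<^sup>+\<omega>. (\<integral>\<^sup>+y. indicator A \<omega> * indicator C (Z1 \<omega> + y) \<partial>\<nu>2) \<partial>M)"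
      using nn_integral_indep_law[OF M H Z2, of "\<lambda>(\<omega>, y). indicator A \<omega> * indicator C (Z1 \<omega> + y)"] by simp
    also have "\<dots> = (\<integral>\<^sup>+\<omega>. indicator A \<omega> * (\<integral>\<^sup>+y. indicator C (Z1 \<omega> + y) \<partial>\<nu>2) \<partial>M)"
      by (intro nn_integral_cong nn_integral_cmult) measurable
    also have "\<dots> = (\<integral>\<^sup>+\<omega>. (\<integral>\<^sup>+x. indicator A \<omega> * (\<integral>\<^sup>+y. indicator C (x + y) \<partial>\<nu>2) \<partial>\<nu>1) \<partial>M)"
      using nn_integral_indep_law[OF M G Z1(1), of "\<lambda>(\<omega>, x). indicator A \<omega> * (\<integral>\<^sup>+y. indicator C (x + y) \<partial>\<nu>2)"] A by simp
    also have "\<dots> = (\<integral>\<^sup>+\<omega>. indicator A \<omega> * (\<integral>\<^sup>+x. (\<integral>\<^sup>+y. indicator C (x + y) \<partial>\<nu>2) \<partial>\<nu>1) \<partial>M)"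
      by (intro nn_integral_cong nn_integral_cmult) measurable
    also have "\<dots> = emeasure M A * (\<integral>\<^sup>+x. (\<integral>\<^sup>+y. indicator C (x + y) \<partial>\<nu>2) \<partial>\<nu>1)"
      by (subst nn_integral_multc) auto
    also have "(\<integral>\<^sup>+x. (\<integral>\<^sup>+y. indicator C (x + y) \<partial>\<nu>2) \<partial>\<nu>1) = (\<integral>\<^sup>+z. indicator C z \<partial>(\<nu>1 \<star> \<nu>2))"
      using \<nu> by (intro nn_integral_convolution[symmetric] \<nu>1.finite_measure_axioms \<nu>2.finite_measure_axioms) auto
    also have "\<dots> = emeasure (\<nu>1 \<star> \<nu>2) C" by simp
    finally have "(\<integral>\<^sup>+\<omega>. indicator A \<omega> * indicator C (Z1 \<omega> + Z2 \<omega>) \<partial>M) = emeasure M A * emeasure (\<nu>1 \<star> \<nu>2) C" .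
    moreover have "(\<integral>\<^sup>+\<omega>. indicator A \<omega> * indicator C (Z1 \<omega> + Z2 \<omega>) \<partial>M) =
        (\<integral>\<^sup>+\<omega>. indicator (A \<inter> ((\<lambda>\<omega>. Z1 \<omega> + Z2 \<omega>) -` C \<inter> space M)) \<omega> \<partial>M)"
      by (intro nn_integral_cong) (auto simp: indicator_def)
    ultimately show "emeasure M (A \<inter> ((\<lambda>\<omega>. Z1 \<omega> + Z2 \<omega>) -` C \<inter> space M)) = emeasure M A * emeasure (\<nu>1 \<star> \<nu>2) C"
      by simp
  qed auto
qed

text \<open>The limit is identified through characteristic functions under the conditional laws given \<open>A\<close>.\<close>

lemma indep_law_limit:
  assumes M: "prob_space M" and G: "subalgebra M G"
    and Z: "\<And>n. indep_law M G (Z n) (\<nu> n)" and L: "L \<in> borel_measurable M"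
    and lim: "AE \<omega> in M. (\<lambda>n. Z n \<omega>) \<longlonglongrightarrow> L \<omega>"
    and \<mu>: "real_distribution \<mu>" and char: "\<And>\<theta>. (\<lambda>n. char (\<nu> n) \<theta>) \<longlonglongrightarrow> char \<mu> \<theta>"
  shows "indep_law M G L \<mu>"
proof -
  interpret M: prob_space M by fact
  interpret \<mu>: real_distribution \<mu> by fact
  have Zm[measurable]: "Z n \<in> borel_measurable M" for n using Z by (auto simp: indep_law_def)
  note L[measurable]
  show ?thesis unfolding indep_law_def
  proof (intro conjI ballI)
    show "prob_space \<mu>" by unfold_locales
    fix A C assume A: "A \<in> sets G" and C: "C \<in> sets (borel :: real measure)"
    have AM[measurable]: "A \<in> sets M" using A G by (auto simp: subalgebra_def)
    show "emeasure M (A \<inter> (L -` C \<inter> space M)) = emeasure M A * emeasure \<mu> C"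
    proof (cases "emeasure M A = 0")
      case True
      have "emeasure M (A \<inter> (L -` C \<inter> space M)) \<le> emeasure M A"
        by (intro emeasure_mono) auto
      then show ?thesis using True by simp
    next
      case False
      have cancel: "emeasure M A * x / emeasure M A = x" for x
        using False M.emeasure_finite[of A] by (subst mult.commute) (simp add: ennreal_mult_divide_eq)
      define U where "U = uniform_measure M A"
      interpret U: prob_space U unfolding U_def
        by (rule prob_space_uniform_measure) (use False in auto)
      have setsU[measurable_cong]: "sets U = sets M" by (simp add: U_def)
      have spU: "space U = space M" by (simp add: U_def)
      \<comment> \<open>Independence from \<open>G\<close> means that conditioning on
        \<open>A\<close> leaves the law of every \<open>Z n\<close> unchanged.\<close>
      have Z_law: "distr U borel (Z n) = \<nu> n" for n
      proof (rule measure_eqI)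
        show "sets (distr U borel (Z n)) = sets (\<nu> n)" using Z[of n] by (simp add: indep_law_def)
        fix D assume D: "D \<in> sets (distr U borel (Z n))"
        then have "emeasure (distr U borel (Z n)) D = emeasure M (A \<inter> (Z n -` D \<inter> space M)) / emeasure M A"
          by (subst emeasure_distr) (auto simp: U_def)
        also have "\<dots> = emeasure (\<nu> n) D"
          using Z[of n] A D False M.emeasure_finite[of A]
          by (simp add: indep_law_def cancel)
        finally show "emeasure (distr U borel (Z n)) D = emeasure (\<nu> n) D" .
      qed
      have "AE \<omega> in U. (\<lambda>n. Z n \<omega>) \<longlonglongrightarrow> L \<omega>"
        unfolding U_def using lim by (intro AE_uniform_measureI) auto
      have "char (distr U borel L) = char \<mu>"
      proof
        fix \<theta> :: real
        have "(\<lambda>n. CLINT \<omega>|U. iexp (\<theta> * Z n \<omega>)) \<longlonglongrightarrow> (CLINT \<omega>|U. iexp (\<theta> * L \<omega>))"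
        proof (rule integral_dominated_convergence[where w = "\<lambda>_. 1"])
          show "AE \<omega> in U. (\<lambda>n. iexp (\<theta> * Z n \<omega>)) \<longlonglongrightarrow> iexp (\<theta> * L \<omega>)"
            using \<open>AE \<omega> in U. _\<close>
          proof eventually_elim
            case (elim \<omega>)
            then show ?case by (intro tendsto_intros)
          qed
        qed auto
        moreover have "char (\<nu> n) \<theta> = (CLINT \<omega>|U. iexp (\<theta> * Z n \<omega>))" for n
          unfolding Z_law[symmetric] char_def by (subst integral_distr) auto
        moreover have "char (distr U borel L) \<theta> = (CLINT \<omega>|U. iexp (\<theta> * L \<omega>))"
          unfolding char_def by (subst integral_distr) auto
        ultimately show "char (distr U borel L) \<theta> = char \<mu> \<theta>"
          using char[of \<theta>] LIMSEQ_unique by auto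
      qed
      then have "distr U borel L = \<mu>"
        by (intro Levy_uniqueness \<mu>) (auto simp: real_distribution_def real_distribution_axioms_def U.prob_space_distr)
      then have "emeasure \<mu> C = emeasure M (A \<inter> (L -` C \<inter> space M)) / emeasure M A"
        using C by (auto simp: U_def emeasure_distr)
      then show ?thesis using cancel[of "emeasure M (A \<inter> (L -` C \<inter> space M))"]
        by (simp add: ennreal_times_divide)
    qed
  qed (use \<mu>.events_eq_borel in auto)
qed

section \<open>Processes with the same increment laws have the same law\<close>

text \<open>Induction on the finite time set, removing its largest element \<open>b\<close>: the
  increment from \<open>b\<close> to \<open>m\<close> is integrated out and becomes part of the
  function of the value at \<open>b\<close>. This is why the statement carries a free test function
  \<open>h\<close> of one later value.\<close>

lemma indep_increments_nn_integral_eq: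
  fixes J K :: "real \<Rightarrow> 'a \<Rightarrow> real" and F F' :: "real \<Rightarrow> 'a measure" and A :: "real \<Rightarrow> real set"
  assumes M: "prob_space M"
    and F: "filtration (space M) F" "\<And>t. subalgebra M (F t)" "\<And>t. t \<ge> 0 \<Longrightarrow> J t \<in> borel_measurable (F t)"
    and F': "filtration (space M) F'" "\<And>t. subalgebra M (F' t)" "\<And>t. t \<ge> 0 \<Longrightarrow> K t \<in> borel_measurable (F' t)"
    and J: "\<And>s t. 0 \<le> s \<Longrightarrow> s \<le> t \<Longrightarrow> indep_law M (F s) (\<lambda>\<omega>. J t \<omega> - J s \<omega>) (\<nu> s t)"
    and K: "\<And>s t. 0 \<le> s \<Longrightarrow> s \<le> t \<Longrightarrow> indep_law M (F' s) (\<lambda>\<omega>. K t \<omega> - K s \<omega>) (\<nu> s t)"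
    and init: "distr M borel (J 0) = distr M borel (K 0)"
    and S: "finite S" "S \<subseteq> {0..m}" "m \<ge> 0" and A: "\<And>i. A i \<in> sets borel"
    and h: "h \<in> borel_measurable borel"
  shows "(\<integral>\<^sup>+\<omega>. (\<Prod>i\<in>S. indicator (A i) (J i \<omega>)) * h (J m \<omega>) \<partial>M) =
    (\<integral>\<^sup>+\<omega>. (\<Prod>i\<in>S. indicator (A i) (K i \<omega>)) * h (K m \<omega>) \<partial>M)"
  using S h
proof (induction S arbitrary: m h rule: finite_linorder_max_induct)
  interpret M: prob_space M by fact
  have step: "(\<integral>\<^sup>+\<omega>. (\<Prod>i\<in>S. indicator (A i) (J i \<omega>)) * h (J m \<omega>) \<partial>M) =
      (\<integral>\<^sup>+\<omega>. (\<Prod>i\<in>S. indicator (A i) (J i \<omega>)) * (\<integral>\<^sup>+y. h (J s \<omega> + y) \<partial>\<nu> s m) \<partial>M)"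
    if F: "filtration (space M) F" "\<And>t. subalgebra M (F t)" "\<And>t. t \<ge> 0 \<Longrightarrow> J t \<in> borel_measurable (F t)"
      and J: "\<And>s t. 0 \<le> s \<Longrightarrow> s \<le> t \<Longrightarrow> indep_law M (F s) (\<lambda>\<omega>. J t \<omega> - J s \<omega>) (\<nu> s t)"
      and S: "S \<subseteq> {0..s}" "finite S" "0 \<le> s" "s \<le> m" and h[measurable]: "h \<in> borel_measurable borel"
    for F J S s m and h :: "real \<Rightarrow> ennreal"
  proof -
    have [measurable]: "J i \<in> borel_measurable (F s)" if "i \<in> insert s S" for i
    proof -
      have "0 \<le> i" "i \<le> s" using that S by auto
      then have "sets (F i) \<subseteq> sets (F s)" "space (F i) = space (F s)"
        using F(1) by (auto simp: filtration_def)
      then show ?thesis using F(3)[OF \<open>0 \<le> i\<close>] by (auto simp: measurable_def)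
    qed
    note [measurable] = A
    have p: "prob_space (\<nu> s m)" and [measurable_cong]: "sets (\<nu> s m) = sets borel"
      using J[OF S(3,4)] by (auto simp: indep_law_def)
    have "(\<integral>\<^sup>+\<omega>. (\<Prod>i\<in>S. indicator (A i) (J i \<omega>)) * h (J m \<omega>) \<partial>M) =
        (\<integral>\<^sup>+\<omega>. (\<integral>\<^sup>+y. (\<Prod>i\<in>S. indicator (A i) (J i \<omega>)) * h (J s \<omega> + y) \<partial>\<nu> s m) \<partial>M)"
      using nn_integral_indep_law[OF M F(2) J[OF S(3,4)],
          of "\<lambda>(\<omega>, y). (\<Prod>i\<in>S. indicator (A i) (J i \<omega>)) * h (J s \<omega> + y)"] by simp
    also have "\<dots> = (\<integral>\<^sup>+\<omega>. (\<Prod>i\<in>S. indicator (A i) (J i \<omega>)) * (\<integral>\<^sup>+y. h (J s \<omega> + y) \<partial>\<nu> s m) \<partial>M)"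
      by (intro nn_integral_cong nn_integral_cmult) measurable
    finally show ?thesis .
  qed
  have mix: "(\<lambda>x. \<integral>\<^sup>+y. h (x + y) \<partial>\<nu> s m) \<in> borel_measurable borel"
    if "0 \<le> s" "s \<le> m" and [measurable]: "h \<in> borel_measurable borel" for s m and h :: "real \<Rightarrow> ennreal"
  proof -
    have [measurable_cong]: "sets (\<nu> s m) = sets borel" and "prob_space (\<nu> s m)"
      using J[OF that(1,2)] by (auto simp: indep_law_def)
    then interpret prob_space "\<nu> s m" by simp
    show ?thesis by measurable
  qed
  {
    case empty
    have [measurable]: "J 0 \<in> borel_measurable M" "K 0 \<in> borel_measurable M"
      using measurable_from_subalg[OF F(2) F(3)] measurable_from_subalg[OF F'(2) F'(3)] by auto
    note [measurable] = mix[OF order.refl empty(2,3)]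
    have "(\<integral>\<^sup>+\<omega>. (\<integral>\<^sup>+y. h (J 0 \<omega> + y) \<partial>\<nu> 0 m) \<partial>M) = (\<integral>\<^sup>+x. (\<integral>\<^sup>+y. h (x + y) \<partial>\<nu> 0 m) \<partial>distr M borel (J 0))"
      by (subst nn_integral_distr) auto
    also have "\<dots> = (\<integral>\<^sup>+\<omega>. (\<integral>\<^sup>+y. h (K 0 \<omega> + y) \<partial>\<nu> 0 m) \<partial>M)"
      unfolding init by (subst nn_integral_distr) auto
    finally show ?case
      using step[OF F J, of "{}" 0 m h] step[OF F' K, of "{}" 0 m h] empty by simp
  next
    case (insert b S)
    have b: "0 \<le> b" "b \<le> m" using insert.prems by auto
    have S: "S \<subseteq> {0..b}" "b \<notin> S"
      using insert.hyps(2) insert.prems(1) by (auto simp: subset_iff intro: less_imp_le)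
    define g where "g x = indicator (A b) x * (\<integral>\<^sup>+y. h (x + y) \<partial>\<nu> b m)" for x
    have g: "g \<in> borel_measurable borel"
      using mix[OF b insert(6)] A unfolding g_def by measurable
    have bS: "insert b S \<subseteq> {0..b}" "finite (insert b S)" using S b insert by auto
    have "(\<integral>\<^sup>+\<omega>. (\<Prod>i\<in>insert b S. indicator (A i) (J i \<omega>)) * h (J m \<omega>) \<partial>M) =
        (\<integral>\<^sup>+\<omega>. (\<Prod>i\<in>S. indicator (A i) (J i \<omega>)) * g (J b \<omega>) \<partial>M)"
      using step[OF F J bS b insert(6)] insert(1) S(2) by (simp add: g_def mult_ac)
    also have "\<dots> = (\<integral>\<^sup>+\<omega>. (\<Prod>i\<in>S. indicator (A i) (K i \<omega>)) * g (K b \<omega>) \<partial>M)"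
      by (rule "insert.IH"[OF S(1) b(1) g])
    also have "\<dots> = (\<integral>\<^sup>+\<omega>. (\<Prod>i\<in>insert b S. indicator (A i) (K i \<omega>)) * h (K m \<omega>) \<partial>M)"
      using step[OF F' K bS b insert(6)] insert(1) S(2) by (simp add: g_def mult_ac)
    finally show ?case .
  }
qed

text \<open>Finite-dimensional cylinders determine a law on the product space, and the preceding
  identity with \<open>h = 1\<close> evaluates them.\<close>

lemma distr_eq_of_indep_increments:
  fixes J K :: "real \<Rightarrow> 'a \<Rightarrow> real" and F F' :: "real \<Rightarrow> 'a measure"
  assumes M: "prob_space M"
    and F: "filtration (space M) F" "\<And>t. subalgebra M (F t)" "\<And>t. t \<ge> 0 \<Longrightarrow> J t \<in> borel_measurable (F t)"
    and F': "filtration (space M) F'" "\<And>t. subalgebra M (F' t)" "\<And>t. t \<ge> 0 \<Longrightarrow> K t \<in> borel_measurable (F' t)"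
    and J: "\<And>s t. 0 \<le> s \<Longrightarrow> s \<le> t \<Longrightarrow> indep_law M (F s) (\<lambda>\<omega>. J t \<omega> - J s \<omega>) (\<nu> s t)"
    and K: "\<And>s t. 0 \<le> s \<Longrightarrow> s \<le> t \<Longrightarrow> indep_law M (F' s) (\<lambda>\<omega>. K t \<omega> - K s \<omega>) (\<nu> s t)"
    and init: "distr M borel (J 0) = distr M borel (K 0)"
  shows "distr M (Pi\<^sub>M {0..} (\<lambda>_. borel)) (\<lambda>\<omega>. \<lambda>t\<in>{0..}. J t \<omega>) =
    distr M (Pi\<^sub>M {0..} (\<lambda>_. borel)) (\<lambda>\<omega>. \<lambda>t\<in>{0..}. K t \<omega>)"
proof (rule measure_eqI_PiM_infinite)
  interpret M: prob_space M by fact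
  have m: "J t \<in> borel_measurable M" "K t \<in> borel_measurable M" if "t \<ge> 0" for t
    using measurable_from_subalg[OF F(2) F(3)[OF that]] measurable_from_subalg[OF F'(2) F'(3)[OF that]] by auto
  have J': "(\<lambda>\<omega>. \<lambda>t\<in>{0..}. J t \<omega>) \<in> M \<rightarrow>\<^sub>M Pi\<^sub>M {0..} (\<lambda>_. borel)"
    and K': "(\<lambda>\<omega>. \<lambda>t\<in>{0..}. K t \<omega>) \<in> M \<rightarrow>\<^sub>M Pi\<^sub>M {0..} (\<lambda>_. borel)"
    using m by (auto intro!: measurable_restrict)
  then show "finite_measure (distr M (Pi\<^sub>M {0..} (\<lambda>_. borel)) (\<lambda>\<omega>. \<lambda>t\<in>{0..}. J t \<omega>))"
    by (intro M.finite_measure_distr)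
  fix A S assume S: "finite S" "S \<subseteq> {0::real..}" and A: "\<And>i. i \<in> S \<Longrightarrow> A i \<in> sets (borel :: real measure)"
  \<comment> \<open>The empty set outside \<open>S\<close> only serves to have a Borel set at every
    index.\<close>
  define A' where "A' i = (if i \<in> S then A i else {})" for i
  have A': "A' i \<in> sets borel" for i using A by (simp add: A'_def)
  have eq: "emeasure (distr M (Pi\<^sub>M {0..} (\<lambda>_. borel)) (\<lambda>\<omega>. \<lambda>t\<in>{0..}. L t \<omega>))
      (prod_emb {0..} (\<lambda>_. borel) S (Pi\<^sub>E S A)) =
      (\<integral>\<^sup>+\<omega>. (\<Prod>i\<in>S. indicator (A' i) (L i \<omega>)) * 1 \<partial>M)"
    if L: "(\<lambda>\<omega>. \<lambda>t\<in>{0..}. L t \<omega>) \<in> M \<rightarrow>\<^sub>M Pi\<^sub>M {0..} (\<lambda>_. borel)" for L :: "real \<Rightarrow> 'a \<Rightarrow> real"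
  proof -
    have P: "prod_emb {0..} (\<lambda>_. borel) S (Pi\<^sub>E S A) \<in> sets (Pi\<^sub>M {0..} (\<lambda>_. borel))"
      using S A by (intro sets_PiM_I) auto
    have "(\<lambda>\<omega>. \<lambda>t\<in>{0..}. L t \<omega>) -` prod_emb {0..} (\<lambda>_. borel) S (Pi\<^sub>E S A) \<inter> space M =
        {\<omega> \<in> space M. \<forall>i\<in>S. L i \<omega> \<in> A i}"
      using S(2) by (auto simp: prod_emb_def PiE_iff restrict_def subset_iff extensional_def split: if_splits)
    then have "emeasure (distr M (Pi\<^sub>M {0..} (\<lambda>_. borel)) (\<lambda>\<omega>. \<lambda>t\<in>{0..}. L t \<omega>))
      (prod_emb {0..} (\<lambda>_. borel) S (Pi\<^sub>E S A)) = emeasure M {\<omega> \<in> space M. \<forall>i\<in>S. L i \<omega> \<in> A i}"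
      using L P by (simp add: emeasure_distr)
    also have "\<dots> = (\<integral>\<^sup>+\<omega>. indicator {\<omega> \<in> space M. \<forall>i\<in>S. L i \<omega> \<in> A i} \<omega> \<partial>M)"
      using measurable_sets[OF L P] \<open>_ = {\<omega> \<in> space M. \<forall>i\<in>S. L i \<omega> \<in> A i}\<close> by (simp add: nn_integral_indicator)
    also have "\<dots> = (\<integral>\<^sup>+\<omega>. (\<Prod>i\<in>S. indicator (A' i) (L i \<omega>)) * 1 \<partial>M)"
    proof (rule nn_integral_cong)
      fix \<omega> assume \<omega>: "\<omega> \<in> space M"
      show "indicator {\<omega> \<in> space M. \<forall>i\<in>S. L i \<omega> \<in> A i} \<omega> = (\<Prod>i\<in>S. indicator (A' i) (L i \<omega>)) * (1 :: ennreal)"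
      proof (cases "\<forall>i\<in>S. L i \<omega> \<in> A i")
        case True
        then have "(\<Prod>i\<in>S. indicator (A' i) (L i \<omega>)) = (1 :: ennreal)"
          by (intro prod.neutral) (auto simp: A'_def)
        then show ?thesis using True \<omega> by simp
      next
        case False
        then obtain i where "i \<in> S" "L i \<omega> \<notin> A i" by auto
        then have "(\<Prod>i\<in>S. indicator (A' i) (L i \<omega>)) = (0 :: ennreal)"
          using S by (intro prod_zero) (auto simp: A'_def intro!: bexI[of _ i])
        then show ?thesis using False by simp
      qed
    qed
    finally show ?thesis .
  qed
  define m where "m = (if S = {} then 0 else Max S)"
  have m0: "m \<ge> 0" "S \<subseteq> {0..m}"
    using S by (auto simp: m_def subset_iff)
  have "(\<integral>\<^sup>+\<omega>. (\<Prod>i\<in>S. indicator (A' i) (J i \<omega>)) * 1 \<partial>M) = (\<integral>\<^sup>+\<omega>. (\<Prod>i\<in>S. indicator (A' i) (K i \<omega>)) * 1 \<partial>M)"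
    by (rule indep_increments_nn_integral_eq[OF M F F' J K init S(1) m0(2,1) A', where h = "\<lambda>_. 1"]) auto
  then show "emeasure (distr M (Pi\<^sub>M {0..} (\<lambda>_. borel)) (\<lambda>\<omega>. \<lambda>t\<in>{0..}. J t \<omega>))
      (prod_emb {0..} (\<lambda>_. borel) S (Pi\<^sub>E S A)) =
    emeasure (distr M (Pi\<^sub>M {0..} (\<lambda>_. borel)) (\<lambda>\<omega>. \<lambda>t\<in>{0..}. K t \<omega>))
      (prod_emb {0..} (\<lambda>_. borel) S (Pi\<^sub>E S A))"
    by (simp only: eq[OF J'] eq[OF K'])
qed auto

section \<open>Path bounds for stable processes\<close>

lemma cadlag_on_right:
  assumes "cadlag_on I x" "t \<in> I" "{t<..} \<subseteq> I"
  shows "(x \<longlongrightarrow> x t) (at_right t)"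
  using assms unfolding cadlag_on_def by (metis Int_absorb1)

text \<open>Right continuity makes an exceedance persist to the right, hence visible at a rational
  time. Events about all times are thereby reduced to countably many; the level \<open>y\<close> may
  move with time.\<close>

lemma rational_after_ge:
  fixes x :: "real \<Rightarrow> real"
  assumes "(x \<longlongrightarrow> x s) (at_right s)" and "\<bar>x s\<bar> > y s" and y: "(y \<longlongrightarrow> y s) (at_right s)" and "s < t"
  obtains q where "q \<in> \<rat>" "s < q" "q < t" "\<bar>x q\<bar> > y q"
proof -
  have "((\<lambda>s. \<bar>x s\<bar> - y s) \<longlongrightarrow> \<bar>x s\<bar> - y s) (at_right s)" by (intro tendsto_intros assms)
  then have "eventually (\<lambda>s. \<bar>x s\<bar> - y s > 0) (at_right s)"
    using assms(2) by (intro order_tendstoD) auto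
  then obtain d where "d > s" "\<And>u. s < u \<Longrightarrow> u < d \<Longrightarrow> \<bar>x u\<bar> - y u > 0"
    unfolding eventually_at_right_field by auto
  moreover obtain q where "q \<in> \<rat>" "s < q" "q < min d t"
    using Rats_dense_in_real[of s "min d t"] \<open>d > s\<close> \<open>s < t\<close> by auto
  ultimately show ?thesis by (intro that[of q]) auto
qed

locale stable_process =
  fixes M :: "'a measure" and F :: "real \<Rightarrow> 'a measure" and \<alpha> :: real and B :: "real \<Rightarrow> 'a \<Rightarrow> real"
  assumes stable: "strictly_stable_process M F \<alpha> B" and \<alpha>_pos: "\<alpha> > 0"
begin

sublocale prob_space M
  using stable by (simp add: strictly_stable_process_def levy_process_def)

lemma
  shows filtration: "filtration (space M) F" and subalgebra: "\<And>t. subalgebra M (F t)"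
    and B_adapted: "\<And>t. t \<ge> 0 \<Longrightarrow> B t \<in> borel_measurable (F t)"
    and B_cadlag: "\<And>\<omega>. \<omega> \<in> space M \<Longrightarrow> cadlag_on {0..} (\<lambda>t. B t \<omega>)"
    and B_0: "\<And>\<omega>. \<omega> \<in> space M \<Longrightarrow> B 0 \<omega> = 0"
    and B_scaling: "\<And>l. l > 0 \<Longrightarrow> distr M (Pi\<^sub>M {0..} (\<lambda>_. borel)) (\<lambda>\<omega>. \<lambda>t\<in>{0..}. B (l * t) \<omega>) =
            distr M (Pi\<^sub>M {0..} (\<lambda>_. borel)) (\<lambda>\<omega>. \<lambda>t\<in>{0..}. l powr (1 / \<alpha>) * B t \<omega>)"
  using stable by (auto simp: strictly_stable_process_def levy_process_def cadlag_adapted_def)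

lemma sets_F_mono: "s \<le> t \<Longrightarrow> sets (F s) \<subseteq> sets (F t)"
  using filtration by (simp add: filtration_def)

lemma space_F: "space (F s) = space M"
  using subalgebra by (simp add: subalgebra_def)

lemma B_measurable[measurable]: "t \<ge> 0 \<Longrightarrow> B t \<in> borel_measurable M"
  using measurable_from_subalg[OF subalgebra B_adapted] .

lemma B_adapted_le: "0 \<le> s \<Longrightarrow> s \<le> t \<Longrightarrow> B s \<in> borel_measurable (F t)"
  using B_adapted[of s] sets_F_mono[of s t] by (auto simp: measurable_def space_F)

lemma B_right: "\<omega> \<in> space M \<Longrightarrow> t \<ge> 0 \<Longrightarrow> ((\<lambda>t. B t \<omega>) \<longlongrightarrow> B t \<omega>) (at_right t)"
  by (rule cadlag_on_right[OF B_cadlag]) auto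

definition law :: "real \<Rightarrow> real measure" where
  "law t = distr M borel (B t)"

lemma sets_law[simp, measurable_cong]: "sets (law t) = sets borel"
  by (simp add: law_def)

lemma prob_space_law: "t \<ge> 0 \<Longrightarrow> prob_space (law t)"
  unfolding law_def by (intro prob_space_distr) measurable

lemma B_indep_law:
  assumes "0 \<le> s" "s \<le> t"
  shows "indep_law M (F s) (\<lambda>\<omega>. B t \<omega> - B s \<omega>) (law (t - s))"
  unfolding indep_law_def
proof (intro conjI ballI)
  have [measurable]: "B s \<in> borel_measurable M" "B t \<in> borel_measurable M" using assms by auto
  show m: "(\<lambda>\<omega>. B t \<omega> - B s \<omega>) \<in> borel_measurable M" by measurable
  have ind: "indep_set (sets (F s)) (sets (vimage_algebra (space M) (\<lambda>\<omega>. B t \<omega> - B s \<omega>) borel))"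
    and law: "distr M borel (\<lambda>\<omega>. B t \<omega> - B s \<omega>) = law (t - s)"
    using stable assms by (auto simp: strictly_stable_process_def levy_process_def law_def)
  fix A C assume A: "A \<in> sets (F s)" and C: "C \<in> sets (borel :: real measure)"
  have "(\<lambda>\<omega>. B t \<omega> - B s \<omega>) -` C \<inter> space M \<in> sets (vimage_algebra (space M) (\<lambda>\<omega>. B t \<omega> - B s \<omega>) borel)"
    using C by (auto simp: sets_vimage_algebra2)
  from indep_setD[OF ind A this]
  have "emeasure M (A \<inter> ((\<lambda>\<omega>. B t \<omega> - B s \<omega>) -` C \<inter> space M)) =
      emeasure M A * emeasure M ((\<lambda>\<omega>. B t \<omega> - B s \<omega>) -` C \<inter> space M)"
    by (simp add: emeasure_eq_measure ennreal_mult'')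
  then show "emeasure M (A \<inter> ((\<lambda>\<omega>. B t \<omega> - B s \<omega>) -` C \<inter> space M)) = emeasure M A * emeasure (law (t - s)) C"
    unfolding law[symmetric] using m C by (simp add: emeasure_distr)
qed (use assms prob_space_law in auto)

lemma law_scaling:
  assumes "l > 0" "t \<ge> 0"
  shows "law (l * t) = distr (law t) borel (\<lambda>x. l powr (1 / \<alpha>) * x)"
proof -
  note [measurable] = assms
  have m: "(\<lambda>\<omega>. \<lambda>t\<in>{0..}. B (l * t) \<omega>) \<in> M \<rightarrow>\<^sub>M Pi\<^sub>M {0..} (\<lambda>_. borel)"
    "(\<lambda>\<omega>. \<lambda>t\<in>{0..}. l powr (1 / \<alpha>) * B t \<omega>) \<in> M \<rightarrow>\<^sub>M Pi\<^sub>M {0..} (\<lambda>_. borel)"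
    using assms by (auto intro!: measurable_restrict borel_measurable_times)
  have c: "(\<lambda>x. x t) \<in> Pi\<^sub>M {0..} (\<lambda>_. borel) \<rightarrow>\<^sub>M borel"
    using assms by (intro measurable_component_singleton) auto
  have "law (l * t) = distr (distr M (Pi\<^sub>M {0..} (\<lambda>_. borel)) (\<lambda>\<omega>. \<lambda>t\<in>{0..}. B (l * t) \<omega>)) borel (\<lambda>x. x t)"
    using assms by (subst distr_distr[OF c m(1)]) (simp add: law_def o_def)
  also have "\<dots> = distr (law t) borel (\<lambda>x. l powr (1 / \<alpha>) * x)"
    unfolding B_scaling[OF assms(1)] using assms
    by (subst distr_distr[OF c m(2)]) (simp add: law_def o_def distr_distr)
  finally show ?thesis .
qed

lemma law_scaling':
  assumes "a > 0" "t \<ge> 0"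
  shows "distr (law t) borel (\<lambda>x. a * x) = law (a powr \<alpha> * t)"
  using law_scaling[of "a powr \<alpha>" t] assms \<alpha>_pos by (simp add: powr_powr)

lemma law_add:
  assumes "s \<ge> 0" "t \<ge> 0"
  shows "(law s \<star> law t) = law (s + t)"
proof -
  have m[measurable]: "B s \<in> borel_measurable M" "B (s + t) \<in> borel_measurable M" "B 0 \<in> borel_measurable M"
    using assms by auto
  have "indep_law M (F 0) (\<lambda>\<omega>. (B s \<omega> - B 0 \<omega>) + (B (s + t) \<omega> - B s \<omega>)) (law s \<star> law t)"
  proof (rule indep_law_add[OF prob_space_axioms subalgebra[of 0] subalgebra[of s] sets_F_mono[OF assms(1)]])
    show "(\<lambda>\<omega>. B s \<omega> - B 0 \<omega>) \<in> borel_measurable (F s)"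
      using assms by (intro borel_measurable_diff B_adapted_le) auto
  qed (use B_indep_law[of 0 s] B_indep_law[of s "s + t"] assms in auto)
  then have "distr M borel (\<lambda>\<omega>. (B s \<omega> - B 0 \<omega>) + (B (s + t) \<omega> - B s \<omega>)) = (law s \<star> law t)"
    by (rule indep_law_distr[OF prob_space_axioms subalgebra])
  moreover have "distr M borel (\<lambda>\<omega>. (B s \<omega> - B 0 \<omega>) + (B (s + t) \<omega> - B s \<omega>)) = law (s + t)"
    unfolding law_def by (rule distr_cong) (auto simp: B_0)
  ultimately show ?thesis by simp
qed

section \<open>The tail of the law at time one and a maximal inequality\<close>

definition tail :: "real \<Rightarrow> real" where
  "tail y = prob {\<omega> \<in> space M. \<bar>B 1 \<omega>\<bar> > y}"

lemma tail_antimono: "x \<le> y \<Longrightarrow> tail y \<le> tail x"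
  unfolding tail_def by (intro finite_measure_mono) (auto intro: le_less_trans)

lemma prob_law: "t \<ge> 0 \<Longrightarrow> prob {\<omega> \<in> space M. \<bar>B t \<omega>\<bar> > x} = measure (law t) {y. \<bar>y\<bar> > x}"
  unfolding law_def by (subst measure_distr) (auto intro!: arg_cong[where f = prob])

lemma prob_increment:
  assumes "0 \<le> s" "s \<le> t"
  shows "prob {\<omega> \<in> space M. \<bar>B t \<omega> - B s \<omega>\<bar> > x} = prob {\<omega> \<in> space M. \<bar>B (t - s) \<omega>\<bar> > x}"
proof -
  have [measurable]: "B s \<in> borel_measurable M" "B t \<in> borel_measurable M" using assms by auto
  have "prob {\<omega> \<in> space M. \<bar>B t \<omega> - B s \<omega>\<bar> > x} = measure (law (t - s)) {y. \<bar>y\<bar> > x}"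
    unfolding indep_law_distr[OF prob_space_axioms subalgebra B_indep_law[OF assms], symmetric]
    by (subst measure_distr) (auto intro!: arg_cong[where f = prob])
  then show ?thesis using prob_law[of "t - s" x] assms by simp
qed

lemma prob_tail:
  assumes "t > 0"
  shows "prob {\<omega> \<in> space M. \<bar>B t \<omega>\<bar> > x} = tail (x / t powr (1 / \<alpha>))"
proof -
  have "law t = distr (law 1) borel (\<lambda>x. t powr (1 / \<alpha>) * x)"
    using law_scaling[of t 1] assms by simp
  then have "measure (law t) {y. \<bar>y\<bar> > x} = measure (law 1) {y. \<bar>t powr (1 / \<alpha>) * y\<bar> > x}"
    by (simp add: measure_distr)
  also have "{y. \<bar>t powr (1 / \<alpha>) * y\<bar> > x} = {y. \<bar>y\<bar> > x / t powr (1 / \<alpha>)}"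
    using assms by (auto simp: abs_mult field_simps)
  finally show ?thesis using assms by (simp add: prob_law tail_def)
qed

text \<open>By self-similarity the tail at a fixed level increases with time. Time 0 is treated
  apart, since the scaling formula needs a positive time; there the process vanishes.\<close>

lemma prob_le_tail:
  assumes "0 \<le> s" "s \<le> t" "x > 0" "t > 0"
  shows "prob {\<omega> \<in> space M. \<bar>B s \<omega>\<bar> > x} \<le> tail (x / t powr (1 / \<alpha>))"
proof (cases "s = 0")
  case True
  then have "{\<omega> \<in> space M. \<bar>B s \<omega>\<bar> > x} = {}" using assms by (auto simp: B_0)
  then show ?thesis by (metis measure_empty measure_nonneg tail_def)
next
  case False
  have "x / t powr (1 / \<alpha>) \<le> x / s powr (1 / \<alpha>)"
    using False assms \<alpha>_pos by (intro divide_left_mono powr_mono2) auto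
  then show ?thesis using False assms by (simp add: prob_tail tail_antimono)
qed

text \<open>Ottaviani's argument: decompose according to the first time the level \<open>2 x\<close> is exceeded.\<close>

lemma maximal_inequality_finite:
  assumes S: "finite S" "S \<subseteq> {0..t}" and x: "x > 0" and t: "t > 0"
    and half: "tail (x / t powr (1 / \<alpha>)) \<le> 1 / 2"
  shows "prob {\<omega> \<in> space M. \<exists>s\<in>S. \<bar>B s \<omega>\<bar> > 2 * x} \<le> 2 * tail (x / t powr (1 / \<alpha>))"
proof -
  have Bm[measurable]: "B t \<in> borel_measurable M" and [measurable]: "\<And>s. s \<in> S \<Longrightarrow> B s \<in> borel_measurable M"
    using S t by auto
  \<comment> \<open>\<open>E s\<close> is known at time \<open>s\<close>, while \<open>G s\<close>
    concerns the rest of the path. On both events the endpoint is beyond \<open>x\<close>, and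
    \<open>G s\<close> is independent of \<open>E s\<close> with probability at least 1 / 2.\<close>
  define E where "E s = {\<omega> \<in> space M. \<bar>B s \<omega>\<bar> > 2 * x \<and> (\<forall>u\<in>S \<inter> {..<s}. \<bar>B u \<omega>\<bar> \<le> 2 * x)}" for s
  define G where "G s = {\<omega> \<in> space M. \<bar>B t \<omega> - B s \<omega>\<bar> \<le> x}" for s
  have EF: "E s \<in> sets (F s)" if "s \<in> S" for s
  proof -
    have [measurable]: "B u \<in> borel_measurable (F s)" if "u \<in> S \<inter> {..s}" for u
      using that S by (intro B_adapted_le) auto
    have "{\<omega> \<in> space (F s). \<bar>B s \<omega>\<bar> > 2 * x \<and> (\<forall>u\<in>S \<inter> {..<s}. \<bar>B u \<omega>\<bar> \<le> 2 * x)} \<in> sets (F s)"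
      using that S by (intro sets.sets_Collect_conj sets.sets_Collect_finite_All) auto
    then show ?thesis by (simp add: E_def space_F)
  qed
  have [measurable]: "E s \<in> events" if "s \<in> S" for s
    using EF[OF that] subalgebra[of s] by (auto simp: subalgebra_def)
  have [measurable]: "G s \<in> events" if "s \<in> S" for s
    using that unfolding G_def by measurable
  have G: "prob (E s) / 2 \<le> prob (E s \<inter> G s)" if s: "s \<in> S" for s
  proof -
    have st: "0 \<le> s" "s \<le> t" using S s by auto
    have "1 - prob (G s) = prob {\<omega> \<in> space M. \<bar>B t \<omega> - B s \<omega>\<bar> > x}"
      using s by (subst prob_compl[symmetric]) (auto simp: G_def intro!: arg_cong[where f = prob])
    also have "\<dots> \<le> 1 / 2"
      using prob_le_tail[of "t - s" t x] half st x t by (simp add: prob_increment)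
    finally have "prob (G s) \<ge> 1 / 2" by simp
    moreover have "prob (E s \<inter> G s) = prob (E s) * prob (G s)"
    proof -
      have C: "{y. \<bar>y\<bar> \<le> x} \<in> sets borel" by measurable
      have eq: "G s = (\<lambda>\<omega>. B t \<omega> - B s \<omega>) -` {y. \<bar>y\<bar> \<le> x} \<inter> space M" by (auto simp: G_def)
      have "emeasure M (A \<inter> G s) = emeasure M A * emeasure (law (t - s)) {y. \<bar>y\<bar> \<le> x}" if "A \<in> sets (F s)" for A
        using B_indep_law[OF st] C that unfolding indep_law_def eq by blast
      from this[OF EF[OF s]] this[of "space M"] sets.top[of "F s"] s
      have "ennreal (prob (E s \<inter> G s)) = ennreal (prob (E s) * prob (G s))"
        by (simp add: space_F prob_space Int_absorb1 sets.sets_into_space emeasure_eq_measure ennreal_mult'')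
      then show ?thesis by (subst (asm) ennreal_inj) auto
    qed
    ultimately show ?thesis using mult_left_mono[of "1/2" "prob (G s)" "prob (E s)"] by simp
  qed
  have disj: "disjoint_family_on E S"
    unfolding disjoint_family_on_def
  proof (intro ballI impI)
    have "E a \<inter> E b = {}" if "a \<in> S" "a < b" for a b
    proof (rule equals0I)
      fix \<omega> assume "\<omega> \<in> E a \<inter> E b"
      then have "\<bar>B a \<omega>\<bar> > 2 * x" "\<bar>B a \<omega>\<bar> \<le> 2 * x" using that by (auto simp: E_def)
      then show False by simp
    qed
    moreover fix s u assume "s \<in> S" "u \<in> S" "s \<noteq> u"
    ultimately show "E s \<inter> E u = {}" by (metis Int_commute linorder_neqE)
  qed
  have "{\<omega> \<in> space M. \<exists>s\<in>S. \<bar>B s \<omega>\<bar> > 2 * x} = (\<Union>s\<in>S. E s)"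
  proof (intro equalityI subsetI)
    fix \<omega> assume \<omega>: "\<omega> \<in> {\<omega> \<in> space M. \<exists>s\<in>S. \<bar>B s \<omega>\<bar> > 2 * x}"
    define R where "R = {s \<in> S. \<bar>B s \<omega>\<bar> > 2 * x}"
    have R: "finite R" "R \<noteq> {}" using S \<omega> by (auto simp: R_def)
    have "Min R \<in> R" "\<And>u. u \<in> R \<Longrightarrow> Min R \<le> u" using R by auto
    then have "Min R \<in> S" "\<omega> \<in> E (Min R)" using \<omega> by (auto simp: R_def E_def not_less[symmetric])
    then show "\<omega> \<in> (\<Union>s\<in>S. E s)" by blast
  qed (auto simp: E_def)
  then have "prob {\<omega> \<in> space M. \<exists>s\<in>S. \<bar>B s \<omega>\<bar> > 2 * x} = (\<Sum>s\<in>S. prob (E s))"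
    using S disj by (simp add: finite_measure_finite_Union image_subset_iff)
  also have "\<dots> \<le> (\<Sum>s\<in>S. 2 * prob (E s \<inter> G s))"
    using G by (intro sum_mono) (auto simp: field_simps)
  also have "\<dots> = 2 * (\<Sum>s\<in>S. prob (E s \<inter> G s))" by (simp add: sum_distrib_left)
  also have "(\<Sum>s\<in>S. prob (E s \<inter> G s)) = prob (\<Union>s\<in>S. E s \<inter> G s)"
    using S disj by (intro finite_measure_finite_Union[symmetric]) (auto simp: disjoint_family_on_def image_subset_iff)
  also have "\<dots> \<le> prob {\<omega> \<in> space M. \<bar>B t \<omega>\<bar> > x}"
    by (intro finite_measure_mono) (auto simp: E_def G_def)
  also have "\<dots> = tail (x / t powr (1 / \<alpha>))" using t by (rule prob_tail)
  finally show ?thesis by simp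
qed

text \<open>The finite bound passes to a countable dense set of times by monotone convergence and to
  all times by right continuity.\<close>

lemma maximal_inequality:
  assumes x: "x > 0" and t: "t > 0" and half: "tail (x / t powr (1 / \<alpha>)) \<le> 1 / 2"
  shows "{\<omega> \<in> space M. \<exists>s\<in>{0..t}. \<bar>B s \<omega>\<bar> > 2 * x} \<in> events"
    and "prob {\<omega> \<in> space M. \<exists>s\<in>{0..t}. \<bar>B s \<omega>\<bar> > 2 * x} \<le> 2 * tail (x / t powr (1 / \<alpha>))"
proof -
  \<comment> \<open>The endpoint \<open>t\<close> is added by hand, as no time of the interval lies
    to its right.\<close>
  define D where "D = insert t ({0..t} \<inter> \<rat>)"
  have D: "countable D" "D \<noteq> {}" "D \<subseteq> {0..t}" using t countable_rat by (auto simp: D_def)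
  define S where "S n = from_nat_into D ` {..n}" for n
  have S: "finite (S n)" "S n \<subseteq> D" for n using D from_nat_into[OF D(2)] by (auto simp: S_def)
  have US: "(\<Union>n. S n) = D" 
  proof -
    have "(\<Union>n. S n) = range (from_nat_into D)" by (force simp: S_def)
    then show ?thesis using range_from_nat_into[OF D(2,1)] by simp
  qed
  define E where "E n = {\<omega> \<in> space M. \<exists>s\<in>S n. \<bar>B s \<omega>\<bar> > 2 * x}" for n
  have [measurable]: "B s \<in> borel_measurable M" if "s \<in> D" for s using that D by auto
  have E: "E n \<in> events" for n
    using S[of n] unfolding E_def by (intro sets.sets_Collect_finite_Ex) auto
  have eq: "{\<omega> \<in> space M. \<exists>s\<in>{0..t}. \<bar>B s \<omega>\<bar> > 2 * x} = (\<Union>n. E n)"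
  proof (intro equalityI subsetI)
    fix \<omega> assume "\<omega> \<in> {\<omega> \<in> space M. \<exists>s\<in>{0..t}. \<bar>B s \<omega>\<bar> > 2 * x}"
    then obtain s where s: "\<omega> \<in> space M" "0 \<le> s" "s \<le> t" "\<bar>B s \<omega>\<bar> > 2 * x" by auto
    have "\<exists>q\<in>D. \<bar>B q \<omega>\<bar> > 2 * x"
    proof (cases "s = t")
      case True
      then show ?thesis using s by (auto simp: D_def)
    next
      case False
      with s have "s < t" by simp
      from rational_after_ge[of "\<lambda>t. B t \<omega>" s "\<lambda>_. 2 * x" t, OF B_right[OF s(1,2)] s(4) tendsto_const this]
      obtain q where "q \<in> \<rat>" "s < q" "q < t" "\<bar>B q \<omega>\<bar> > 2 * x" by blast
      then show ?thesis using s by (intro bexI[of _ q]) (auto simp: D_def)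
    qed
    then show "\<omega> \<in> (\<Union>n. E n)" using US s by (auto simp: E_def)
  qed (use S D in \<open>force simp: E_def\<close>)
  show "{\<omega> \<in> space M. \<exists>s\<in>{0..t}. \<bar>B s \<omega>\<bar> > 2 * x} \<in> events"
    unfolding eq using E by auto
  have "incseq E" by (intro monoI) (auto simp: E_def S_def)
  then have "(\<lambda>n. prob (E n)) \<longlonglongrightarrow> prob (\<Union>n. E n)"
    using E by (intro finite_Lim_measure_incseq) auto
  moreover have "prob (E n) \<le> 2 * tail (x / t powr (1 / \<alpha>))" for n
    unfolding E_def by (rule maximal_inequality_finite[OF S(1) _ x t half]) (use S D in blast)
  ultimately show "prob {\<omega> \<in> space M. \<exists>s\<in>{0..t}. \<bar>B s \<omega>\<bar> > 2 * x} \<le> 2 * tail (x / t powr (1 / \<alpha>))"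
    unfolding eq by (intro LIMSEQ_le_const2) auto
qed

end

lemma tendsto_at_right_shift:
  fixes f :: "real \<Rightarrow> 'b::topological_space"
  assumes "(f \<longlongrightarrow> l) (at_right (c + s))"
  shows "((\<lambda>s. f (c + s)) \<longlongrightarrow> l) (at_right s)"
proof (rule filterlim_compose[OF assms])
  have "((\<lambda>u. c + u) \<longlongrightarrow> c + s) (at_right s)" by (intro tendsto_intros)
  moreover have "eventually (\<lambda>u. c + u \<in> {c + s<..} \<and> c + u \<noteq> c + s) (at_right s)"
    using eventually_at_right_less[of s] by eventually_elim auto
  ultimately show "filterlim (\<lambda>u. c + u) (at_right (c + s)) (at_right s)"
    by (simp add: filterlim_at)
qed

context stable_process
begin

lemma prob_indep_increment:
  assumes "0 \<le> s" "s \<le> t" and A: "A \<in> sets (F s)" and C: "C \<in> sets borel"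
  shows "prob (A \<inter> {\<omega> \<in> space M. B t \<omega> - B s \<omega> \<in> C}) = prob A * prob {\<omega> \<in> space M. B (t - s) \<omega> \<in> C}"
proof -
  have "emeasure M (A \<inter> ((\<lambda>\<omega>. B t \<omega> - B s \<omega>) -` C \<inter> space M)) = emeasure M A * emeasure (law (t - s)) C"
    using B_indep_law[OF assms(1,2)] A C by (simp add: indep_law_def)
  moreover have "emeasure (law (t - s)) C = emeasure M {\<omega> \<in> space M. B (t - s) \<omega> \<in> C}"
    using assms unfolding law_def by (subst emeasure_distr) (auto intro!: arg_cong[where f = "emeasure M"])
  moreover have "(\<lambda>\<omega>. B t \<omega> - B s \<omega>) -` C \<inter> space M = {\<omega> \<in> space M. B t \<omega> - B s \<omega> \<in> C}" by auto
  ultimately have "ennreal (prob (A \<inter> {\<omega> \<in> space M. B t \<omega> - B s \<omega> \<in> C})) =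
      ennreal (prob A * prob {\<omega> \<in> space M. B (t - s) \<omega> \<in> C})"
    by (simp add: emeasure_eq_measure ennreal_mult'')
  then show ?thesis by (subst (asm) ennreal_inj) auto
qed

lemma prob_no_large_increment:
  assumes h: "h \<ge> 0"
  shows "prob {\<omega> \<in> space M. \<forall>i<n. \<bar>B (real (Suc i) * h) \<omega> - B (real i * h) \<omega>\<bar> \<le> y} =
    (1 - prob {\<omega> \<in> space M. \<bar>B h \<omega>\<bar> > y}) ^ n"
proof (induction n)
  case 0
  then show ?case by (simp add: prob_space)
next
  case (Suc n)
  define A where "A = {\<omega> \<in> space M. \<forall>i<n. \<bar>B (real (Suc i) * h) \<omega> - B (real i * h) \<omega>\<bar> \<le> y}"
  have [measurable]: "B h \<in> borel_measurable M" using h by simp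
  have "{\<omega> \<in> space (F (real n * h)). \<forall>i\<in>{..<n}. \<bar>B (real (Suc i) * h) \<omega> - B (real i * h) \<omega>\<bar> \<le> y} \<in> sets (F (real n * h))"
  proof (rule sets.sets_Collect_finite_All)
    fix i assume i: "i \<in> {..<n}"
    have "real (Suc i) * h \<le> real n * h" "real i * h \<le> real n * h"
      using i h by (intro mult_right_mono; simp)+
    moreover have "0 \<le> real (Suc i) * h" "0 \<le> real i * h" using h by simp_all
    ultimately have "(\<lambda>\<omega>. \<bar>B (real (Suc i) * h) \<omega> - B (real i * h) \<omega>\<bar>) \<in> borel_measurable (F (real n * h))"
      by (intro borel_measurable_abs borel_measurable_diff B_adapted_le)
    then show "{\<omega> \<in> space (F (real n * h)). \<bar>B (real (Suc i) * h) \<omega> - B (real i * h) \<omega>\<bar> \<le> y} \<in> sets (F (real n * h))"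
      by (intro borel_measurable_le) auto
  qed simp
  then have A: "A \<in> sets (F (real n * h))" by (simp only: A_def space_F Ball_def lessThan_iff)
  have C: "{x. \<bar>x\<bar> \<le> y} \<in> sets borel" by measurable
  have le: "0 \<le> real n * h" "real n * h \<le> real (Suc n) * h" using h by (auto intro: mult_right_mono)
  have "{\<omega> \<in> space M. \<forall>i<Suc n. \<bar>B (real (Suc i) * h) \<omega> - B (real i * h) \<omega>\<bar> \<le> y} =
      A \<inter> {\<omega> \<in> space M. B (real (Suc n) * h) \<omega> - B (real n * h) \<omega> \<in> {x. \<bar>x\<bar> \<le> y}}"
    by (simp only: A_def less_Suc_eq set_eq_iff Int_iff mem_Collect_eq) blast
  moreover have "real (Suc n) * h - real n * h = h" by (simp add: algebra_simps)
  moreover have "prob {\<omega> \<in> space M. B h \<omega> \<in> {x. \<bar>x\<bar> \<le> y}} = 1 - prob {\<omega> \<in> space M. \<bar>B h \<omega>\<bar> > y}"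
    by (subst prob_compl[symmetric]) (auto intro!: arg_cong[where f = prob])
  ultimately show ?case
    using prob_indep_increment[OF le A C] Suc.IH by (simp add: A_def)
qed

lemma tail_tendsto_0: "(\<lambda>n. tail (real n)) \<longlonglongrightarrow> 0"
proof -
  have "(\<lambda>n. prob {\<omega> \<in> space M. \<bar>B 1 \<omega>\<bar> > real n}) \<longlonglongrightarrow> prob (\<Inter>n. {\<omega> \<in> space M. \<bar>B 1 \<omega>\<bar> > real n})"
    by (intro finite_Lim_measure_decseq) (auto simp: decseq_def)
  moreover have "(\<Inter>n. {\<omega> \<in> space M. \<bar>B 1 \<omega>\<bar> > real n}) = {}"
  proof (intro equals0I)
    fix \<omega> assume *: "\<omega> \<in> (\<Inter>n. {\<omega> \<in> space M. \<bar>B 1 \<omega>\<bar> > real n})"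
    obtain n :: nat where "\<bar>B 1 \<omega>\<bar> < real n" using reals_Archimedean2 by blast
    moreover have "real n < \<bar>B 1 \<omega>\<bar>" using * by blast
    ultimately show False by simp
  qed
  ultimately show ?thesis by (simp add: tail_def)
qed

text \<open>If one of the \<open>n\<close> independent increments over \<open>[0, 1]\<close> exceeds \<open>4 x\<close>, then the process exceeds
  \<open>2 x\<close>; comparing probabilities for all \<open>n\<close> gives the tail.\<close>

lemma tail_bound:
  obtains C where "C > 0" "\<And>y. y > 0 \<Longrightarrow> tail y \<le> C * y powr (- \<alpha>)"
proof -
  have "eventually (\<lambda>n. tail (real n) < 1 / 4) sequentially"
    using tail_tendsto_0 by (intro order_tendstoD) auto
  then obtain m where "m \<ge> 1" "tail (real m) < 1 / 4"
    unfolding eventually_sequentially by (metis linorder_linear)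
  then obtain x where x: "x > 0" "tail x \<le> 1 / 4" by (intro that[of "real m"]) auto
  have *: "tail (4 * x * real n powr (1 / \<alpha>)) \<le> 1 / real n" if n: "n \<ge> 1" for n :: nat
  proof -
    define h where "h = 1 / real n"
    have h: "h > 0" "real n * h = 1" using n by (auto simp: h_def)
    define p where "p = prob {\<omega> \<in> space M. \<bar>B h \<omega>\<bar> > 4 * x}"
    have p: "p = tail (4 * x * real n powr (1 / \<alpha>))"
      using h n unfolding p_def by (subst prob_tail) (auto simp: h_def powr_divide)
    define S where "S = (\<lambda>i. real i * h) ` {..n}"
    have S: "finite S" "S \<subseteq> {0..1}"
    proof -
      have "real i * h \<le> 1" if "i \<le> n" for i
        using that h mult_right_mono[of "real i" "real n" h] by simp
      then show "finite S" "S \<subseteq> {0..1}" using h by (auto simp: S_def)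
    qed
    have Sm: "B s \<in> borel_measurable M" if "s \<in> S" for s using that S by auto
    have max: "prob {\<omega> \<in> space M. \<exists>s\<in>S. \<bar>B s \<omega>\<bar> > 2 * x} \<le> 1 / 2"
      using maximal_inequality_finite[OF S x(1)] x by simp
    have ev: "{\<omega> \<in> space M. \<exists>s\<in>S. \<bar>B s \<omega>\<bar> > 2 * x} \<in> events"
      using S Sm by (intro sets.sets_Collect_finite_Ex) auto
    have "1 / 2 \<le> 1 - prob {\<omega> \<in> space M. \<exists>s\<in>S. \<bar>B s \<omega>\<bar> > 2 * x}" using max by simp
    also have "\<dots> = prob (space M - {\<omega> \<in> space M. \<exists>s\<in>S. \<bar>B s \<omega>\<bar> > 2 * x})"
      by (rule prob_compl[OF ev, symmetric])
    also have "\<dots> \<le> prob {\<omega> \<in> space M. \<forall>i<n. \<bar>B (real (Suc i) * h) \<omega> - B (real i * h) \<omega>\<bar> \<le> 4 * x}"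
    proof (rule finite_measure_mono)
      show "space M - {\<omega> \<in> space M. \<exists>s\<in>S. \<bar>B s \<omega>\<bar> > 2 * x} \<subseteq>
        {\<omega> \<in> space M. \<forall>i<n. \<bar>B (real (Suc i) * h) \<omega> - B (real i * h) \<omega>\<bar> \<le> 4 * x}"
      proof (intro subsetI CollectI conjI allI impI)
        fix \<omega> i assume \<omega>: "\<omega> \<in> space M - {\<omega> \<in> space M. \<exists>s\<in>S. \<bar>B s \<omega>\<bar> > 2 * x}" and i: "i < n"
        have "real (Suc i) * h \<in> S" "real i * h \<in> S" using i unfolding S_def by (intro imageI; simp)+
        then have "\<bar>B (real (Suc i) * h) \<omega>\<bar> \<le> 2 * x" "\<bar>B (real i * h) \<omega>\<bar> \<le> 2 * x"
          using \<omega> by (auto simp: not_less simp del: of_nat_Suc)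
        then show "\<bar>B (real (Suc i) * h) \<omega> - B (real i * h) \<omega>\<bar> \<le> 4 * x" by linarith
      qed auto
      have "{\<omega> \<in> space M. \<forall>i\<in>{..<n}. \<bar>B (real (Suc i) * h) \<omega> - B (real i * h) \<omega>\<bar> \<le> 4 * x} \<in> events"
      proof (rule sets.sets_Collect_finite_All)
        fix i :: nat
        have "0 \<le> real (Suc i) * h" "0 \<le> real i * h" using h by simp_all
        then have "(\<lambda>\<omega>. \<bar>B (real (Suc i) * h) \<omega> - B (real i * h) \<omega>\<bar>) \<in> borel_measurable M"
          by (intro borel_measurable_abs borel_measurable_diff B_measurable)
        then show "{\<omega> \<in> space M. \<bar>B (real (Suc i) * h) \<omega> - B (real i * h) \<omega>\<bar> \<le> 4 * x} \<in> events"
          by (intro borel_measurable_le) auto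
      qed simp
      then show "{\<omega> \<in> space M. \<forall>i<n. \<bar>B (real (Suc i) * h) \<omega> - B (real i * h) \<omega>\<bar> \<le> 4 * x} \<in> events"
        by (simp only: Ball_def lessThan_iff)
    qed
    also have "\<dots> = (1 - p) ^ n" unfolding p_def using h by (intro prob_no_large_increment) simp
    finally have half: "1 / 2 \<le> (1 - p) ^ n" .
    have p01: "0 \<le> p" "p \<le> 1" by (auto simp: p_def)
    \<comment> \<open>Multiplying by \<open>(1 - p) ^ n\<close> and using
      \<open>(1 - p) * (1 + p) \<le> 1\<close> bounds \<open>(1 - p) ^ n * (1 + n * p)\<close> by 1;
      since \<open>(1 - p) ^ n \<ge> 1 / 2\<close>, this forces
      \<open>n * p \<le> 1\<close>.\<close>
    have "1 + real n * p \<le> (1 + p) ^ n" using p01 by (intro Bernoulli_inequality) auto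
    then have "(1 - p) ^ n * (1 + real n * p) \<le> (1 - p) ^ n * (1 + p) ^ n"
      using p01 by (intro mult_left_mono) auto
    also have "\<dots> = (1 - p\<^sup>2) ^ n"
      by (simp add: power_mult_distrib[symmetric] power2_eq_square algebra_simps)
    also have "\<dots> \<le> 1" using p01 by (intro power_le_one) (auto simp: abs_square_le_1 power_le_one)
    finally have "(1 - p) ^ n * (1 + real n * p) \<le> 1" .
    moreover have "1 / 2 * (1 + real n * p) \<le> (1 - p) ^ n * (1 + real n * p)"
      using half p01 by (intro mult_right_mono) auto
    ultimately have "real n * p \<le> 1" by simp
    then have "p \<le> 1 / real n" using n by (simp add: field_simps)
    then show ?thesis by (simp add: p)
  qed
  \<comment> \<open>The factor 2 pays for rounding \<open>z\<close> down to an integer; for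
    \<open>y\<close> below \<open>4 * x\<close> the bound exceeds 1 and is trivial.\<close>
  define C where "C = 2 * (4 * x) powr \<alpha>"
  have "tail y \<le> C * y powr (- \<alpha>)" if y: "y > 0" for y
  proof (cases "y \<ge> 4 * x")
    case True
    define z where "z = (y / (4 * x)) powr \<alpha>"
    have z: "z \<ge> 1" unfolding z_def using True x \<alpha>_pos by (intro ge_one_powr_ge_zero) auto
    define n where "n = nat \<lfloor>z\<rfloor>"
    have n: "n \<ge> 1" "real n \<le> z" "z < real n + 1" using z by (auto simp: n_def) linarith
    have z2: "z \<le> 2 * real n" using n by linarith
    have "4 * x * real n powr (1 / \<alpha>) \<le> 4 * x * z powr (1 / \<alpha>)"
      using n x \<alpha>_pos by (intro mult_left_mono powr_mono2) auto
    also have "\<dots> = y" using x y \<alpha>_pos by (simp add: z_def powr_powr)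
    finally have "tail y \<le> tail (4 * x * real n powr (1 / \<alpha>))" by (rule tail_antimono)
    also have "\<dots> \<le> 1 / real n" by (rule *[OF n(1)])
    also have "\<dots> \<le> 2 / z" using z2 n(1) z by (simp add: field_simps)
    also have "\<dots> = C * y powr (- \<alpha>)"
      using x y by (simp add: z_def C_def powr_divide powr_minus field_simps)
    finally show ?thesis .
  next
    case False
    have "tail y \<le> 1" by (simp add: tail_def)
    also have "1 \<le> (4 * x / y) powr \<alpha>" using False x y \<alpha>_pos by (intro ge_one_powr_ge_zero) auto
    also have "\<dots> \<le> 2 * (4 * x / y) powr \<alpha>" by simp
    also have "\<dots> = C * y powr (- \<alpha>)"
      using x y by (simp add: C_def powr_divide powr_minus field_simps)
    finally show ?thesis .
  qed
  moreover have "C > 0" using x by (simp add: C_def)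
  ultimately show thesis using that by blast
qed

section \<open>Almost sure growth at infinity and at zero\<close>

text \<open>At level \<open>2 powr (\<epsilon> * k)\<close> in self-similar units the tail bound is
  geometric in \<open>k\<close>, so Borel-Cantelli applies. The times \<open>\<tau> k\<close> stay
  free: powers of two give growth at infinity, their inverses growth at 0.\<close>

lemma AE_eventually_bounded:
  fixes \<tau> :: "nat \<Rightarrow> real"
  assumes \<tau>: "\<And>k. \<tau> k > 0" and \<epsilon>: "\<epsilon> > 0"
  shows "AE \<omega> in M. eventually (\<lambda>k. \<forall>s\<in>{0..\<tau> k}. \<bar>B s \<omega>\<bar> \<le> 2 * (\<tau> k powr (1 / \<alpha>) * 2 powr (\<epsilon> * real k))) sequentially"
proof -
  obtain C where C: "C > 0" "\<And>y. y > 0 \<Longrightarrow> tail y \<le> C * y powr (- \<alpha>)"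
    using tail_bound by blast
  define z where "z = 2 powr (- \<epsilon> * \<alpha>)"
  have z: "0 < z" "z < 1" using \<epsilon> \<alpha>_pos by (auto simp: z_def powr_less_one)
  have tail_le: "tail (2 powr (\<epsilon> * real k)) \<le> C * z ^ k" for k
    using C(2)[of "2 powr (\<epsilon> * real k)"] by (simp add: z_def powr_powr powr_power mult_ac)
  define x where "x k = \<tau> k powr (1 / \<alpha>) * 2 powr (\<epsilon> * real k)" for k
  have x: "x k > 0" for k using \<tau>[of k] by (simp add: x_def)
  have xt: "x k / \<tau> k powr (1 / \<alpha>) = 2 powr (\<epsilon> * real k)" for k using \<tau>[of k] by (simp add: x_def)
  have "(\<lambda>k. C * z ^ k) \<longlonglongrightarrow> C * 0" using z by (intro tendsto_intros) auto
  then have "eventually (\<lambda>k. C * z ^ k < 1 / 2) sequentially" by (intro order_tendstoD) auto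
  then obtain k0 where k0: "\<And>k. k \<ge> k0 \<Longrightarrow> C * z ^ k < 1 / 2" by (auto simp: eventually_sequentially)
  \<comment> \<open>The index is shifted by \<open>k0\<close> because the maximal inequality needs a
    tail of at most 1 / 2.\<close>
  define E where "E k = {\<omega> \<in> space M. \<exists>s\<in>{0..\<tau> (k + k0)}. \<bar>B s \<omega>\<bar> > 2 * x (k + k0)}" for k
  have half: "tail (x (k + k0) / \<tau> (k + k0) powr (1 / \<alpha>)) \<le> 1 / 2" for k
    using tail_le[of "k + k0"] k0[of "k + k0"] unfolding xt by simp
  have E: "E k \<in> events" for k
    unfolding E_def by (rule maximal_inequality(1)[OF x \<tau> half])
  have PE: "prob (E k) \<le> 2 * (C * z ^ (k + k0))" for k
    using maximal_inequality(2)[OF x \<tau> half, of k] tail_le[of "k + k0"] unfolding E_def xt by simp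
  have "summable (\<lambda>k. 2 * C * z ^ k0 * z ^ k)"
    using z by (intro summable_mult summable_geometric) auto
  then have "summable (\<lambda>k. prob (E k))"
    by (rule summable_comparison_test'[where N = 0]) (use PE in \<open>auto simp: power_add mult_ac\<close>)
  then have "AE \<omega> in M. eventually (\<lambda>k. \<omega> \<in> space M - E k) sequentially"
    using E by (intro borel_cantelli_AE1) (auto simp: emeasure_eq_measure)
  then show ?thesis
  proof eventually_elim
    case (elim \<omega>)
    then have "eventually (\<lambda>k. \<forall>s\<in>{0..\<tau> (k + k0)}. \<bar>B s \<omega>\<bar> \<le> 2 * x (k + k0)) sequentially"
      by eventually_elim (auto simp: E_def not_less)
    then show ?case unfolding x_def by (subst (asm) eventually_sequentially_seg)
  qed
qed

lemma AE_growth_at_top: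
  assumes \<epsilon>: "\<epsilon> > 0"
  shows "AE \<omega> in M. \<exists>C. \<forall>t\<ge>0. \<bar>B t \<omega>\<bar> \<le> C * (1 + t) powr (1 / \<alpha> + \<epsilon>)"
proof -
  define e where "e = 1 / \<alpha> + \<epsilon>"
  have e: "e > 0" using \<alpha>_pos \<epsilon> by (simp add: e_def add_pos_pos)
  show ?thesis
    using AE_eventually_bounded[of "\<lambda>k. 2 ^ k", OF _ \<epsilon>, simplified]
  proof eventually_elim
    case (elim \<omega>)
    then obtain k0 where "\<forall>k\<ge>k0. \<forall>s\<in>{0..2 ^ k}. \<bar>B s \<omega>\<bar> \<le> 2 * ((2 ^ k) powr (1 / \<alpha>) * 2 powr (\<epsilon> * real k))"
      unfolding eventually_sequentially by blast
    then have k0: "\<And>k s. k \<ge> k0 \<Longrightarrow> 0 \<le> s \<Longrightarrow> s \<le> 2 ^ k \<Longrightarrow>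
        \<bar>B s \<omega>\<bar> \<le> 2 * ((2 ^ k) powr (1 / \<alpha>) * 2 powr (\<epsilon> * real k))"
      by simp
    have le: "\<bar>B s \<omega>\<bar> \<le> 2 * (2 ^ k) powr e" if "k \<ge> k0" "0 \<le> s" "s \<le> 2 ^ k" for k s
    proof -
      have "(2 ^ k) powr (1 / \<alpha>) * 2 powr (\<epsilon> * real k) = (2 ^ k :: real) powr e"
        by (simp add: e_def powr_add powr_powr mult_ac flip: powr_realpow)
      then show ?thesis using k0[OF that] by simp
    qed
    define C where "C = 2 * (2 * 2 ^ k0) powr e"
    have "\<bar>B t \<omega>\<bar> \<le> C * (1 + t) powr e" if t: "t \<ge> 0" for t
    proof -
      define n where "n = nat \<lfloor>log 2 (1 + t)\<rfloor>"
      have l: "log 2 (1 + t) \<ge> 0" using t by simp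
      then have n: "real n \<le> log 2 (1 + t)" "log 2 (1 + t) < real n + 1"
        unfolding n_def by linarith+
      have "1 + t = 2 powr log 2 (1 + t)" using t by simp
      also have "\<dots> < 2 powr (real n + 1)" using n by (intro powr_less_mono) auto
      finally have n1: "1 + t < 2 * 2 ^ n" by (simp add: powr_add powr_realpow)
      have "2 ^ n = 2 powr real n" by (simp add: powr_realpow)
      also have "\<dots> \<le> 2 powr log 2 (1 + t)" using n by (intro powr_mono) auto
      finally have n2: "2 ^ n \<le> 1 + t" using t by simp
      \<comment> \<open>The exponent \<open>n + 1 + k0\<close> is at least \<open>k0\<close> for
        every \<open>t\<close>, so early times are covered too; the surplus factor goes into
        \<open>C\<close>.\<close>
      have "\<bar>B t \<omega>\<bar> \<le> 2 * (2 ^ (n + 1 + k0)) powr e"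
      proof (rule le)
        have "t \<le> 2 * 2 ^ n * 1" using n1 by simp
        also have "\<dots> \<le> 2 * 2 ^ n * 2 ^ k0" by (intro mult_left_mono) auto
        finally show "t \<le> 2 ^ (n + 1 + k0)" by (simp add: power_add)
      qed (use t in auto)
      also have "(2 ^ (n + 1 + k0) :: real) = (2 * 2 ^ k0) * 2 ^ n" by (simp add: power_add)
      also have "((2 * 2 ^ k0) * 2 ^ n :: real) powr e = (2 * 2 ^ k0) powr e * (2 ^ n) powr e" by (rule powr_mult)
      also have "2 * ((2 * 2 ^ k0) powr e * (2 ^ n) powr e) \<le> 2 * ((2 * 2 ^ k0) powr e * (1 + t) powr e)"
        using n2 e by (intro mult_left_mono powr_mono2) auto
      finally show ?thesis by (simp add: C_def)
    qed
    then show ?case unfolding e_def by blast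
  qed
qed

lemma AE_growth_at_0:
  assumes e: "0 < e" "e < 1 / \<alpha>"
  shows "AE \<omega> in M. \<exists>C d. d > 0 \<and> (\<forall>t. 0 < t \<and> t \<le> d \<longrightarrow> \<bar>B t \<omega>\<bar> \<le> C * t powr e)"
proof -
  define \<epsilon> where "\<epsilon> = 1 / \<alpha> - e"
  have \<epsilon>: "\<epsilon> > 0" using e by (simp add: \<epsilon>_def)
  show ?thesis
    using AE_eventually_bounded[of "\<lambda>k. 2 powr (- real k)", OF _ \<epsilon>, simplified]
  proof eventually_elim
    case (elim \<omega>)
    then obtain k0 where "\<forall>k\<ge>k0. \<forall>s\<in>{0..2 powr (- real k)}. \<bar>B s \<omega>\<bar> \<le> 2 * ((2 powr (- real k)) powr (1 / \<alpha>) * 2 powr (\<epsilon> * real k))"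
      unfolding eventually_sequentially by blast
    then have k0: "\<And>k s. k \<ge> k0 \<Longrightarrow> 0 \<le> s \<Longrightarrow> s \<le> 2 powr (- real k) \<Longrightarrow>
        \<bar>B s \<omega>\<bar> \<le> 2 * ((2 powr (- real k)) powr (1 / \<alpha>) * 2 powr (\<epsilon> * real k))"
      by simp
    have le: "\<bar>B s \<omega>\<bar> \<le> 2 * (2 powr (- real k)) powr e" if "k \<ge> k0" "0 \<le> s" "s \<le> 2 powr (- real k)" for k s
    proof -
      have "(2 powr (- real k)) powr (1 / \<alpha>) * 2 powr (\<epsilon> * real k) = 2 powr (- real k * (1 / \<alpha>) + \<epsilon> * real k)"
        by (simp add: powr_powr flip: powr_add)
      also have "- real k * (1 / \<alpha>) + \<epsilon> * real k = - real k * e"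
        by (simp add: \<epsilon>_def algebra_simps)
      also have "2 powr (- real k * e) = (2 powr (- real k)) powr e" by (simp add: powr_powr)
      finally show ?thesis using k0[OF that] by simp
    qed
    have "\<bar>B t \<omega>\<bar> \<le> 2 * 2 powr e * t powr e" if t: "0 < t" "t \<le> 2 powr (- real k0 - 1)" for t
    proof -
      have "log 2 t \<le> - real k0 - 1" using t by (simp add: log_le_iff)
      \<comment> \<open>Then \<open>t\<close> lies between \<open>2 powr (- k - 1)\<close> and
        \<open>2 powr (- k)\<close>; rounding it up costs the factor
        \<open>2 powr e\<close>.\<close>
      define k where "k = nat \<lfloor>- log 2 t\<rfloor>"
      have k: "real k \<le> - log 2 t" "- log 2 t < real k + 1" "k \<ge> k0"
        using \<open>log 2 t \<le> - real k0 - 1\<close> unfolding k_def by linarith+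
      have "t = 2 powr log 2 t" using t by simp
      also have "\<dots> \<le> 2 powr (- real k)" using k by (intro powr_mono) auto
      finally have "\<bar>B t \<omega>\<bar> \<le> 2 * (2 powr (- real k)) powr e" using t k by (intro le) auto
      also have "2 powr (- real k) \<le> 2 powr (1 + log 2 t)" using k by (intro powr_mono) auto
      then have "(2 powr (- real k)) powr e \<le> (2 powr (1 + log 2 t)) powr e" using e by (intro powr_mono2) auto
      also have "2 powr (1 + log 2 t) = 2 * t" using t by (simp add: powr_add)
      also have "(2 * t) powr e = 2 powr e * t powr e" using t by (simp add: powr_mult)
      finally show ?thesis by simp
    qed
    then show ?case by (intro exI[of _ "2 * 2 powr e"] exI[of _ "2 powr (- real k0 - 1)"]) auto
  qed
qed

section \<open>Negligible noise after late times\<close>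

text \<open>The law of the whole path is compared, because the event used in the restart argument
  involves all times after \<open>T\<close>.\<close>

lemma distr_shift:
  assumes T: "T \<ge> 0"
  shows "distr M (Pi\<^sub>M {0..} (\<lambda>_. borel)) (\<lambda>\<omega>. \<lambda>s\<in>{0..}. B (T + s) \<omega> - B T \<omega>) =
    distr M (Pi\<^sub>M {0..} (\<lambda>_. borel)) (\<lambda>\<omega>. \<lambda>s\<in>{0..}. B s \<omega>)"
proof (rule distr_eq_of_indep_increments[where F = "\<lambda>s. F (T + s)" and F' = F and \<nu> = "\<lambda>s t. law (t - s)"])
  show "filtration (space M) (\<lambda>s. F (T + s))"
    using sets_F_mono by (auto simp: filtration_def space_F)
  show "(\<lambda>\<omega>. B (T + t) \<omega> - B T \<omega>) \<in> borel_measurable (F (T + t))" if "t \<ge> 0" for t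
    using that T by (intro borel_measurable_diff B_adapted_le) auto
  show "indep_law M (F (T + s)) (\<lambda>\<omega>. B (T + t) \<omega> - B T \<omega> - (B (T + s) \<omega> - B T \<omega>)) (law (t - s))"
    if "0 \<le> s" "s \<le> t" for s t
    using B_indep_law[of "T + s" "T + t"] that T by simp
  show "distr M borel (\<lambda>\<omega>. B (T + 0) \<omega> - B T \<omega>) = distr M borel (B 0)"
    by (rule distr_cong) (auto simp: B_0)
qed (use prob_space_axioms filtration subalgebra B_adapted B_indep_law in auto)

text \<open>The probability that the increments after a deterministic time \<open>T\<close> ever
  exceed \<open>\<delta> * (n + s) powr p\<close> does not depend on \<open>T\<close> and tends to 0
  in \<open>n\<close>, as \<open>p > 1 / \<alpha>\<close>. For fixed \<open>n\<close> the
  probability of \<open>X T \<ge> n powr p\<close> tends to 1 in \<open>T\<close>. Letting first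
  \<open>T\<close> and then \<open>n\<close> tend to infinity, a union bound shows that almost
  surely some pair satisfies both requirements.\<close>

lemma AE_restart:
  assumes p: "p > 1 / \<alpha>" and Xm: "\<And>t. t \<ge> 0 \<Longrightarrow> X t \<in> borel_measurable M"
    and X: "AE \<omega> in M. filterlim (\<lambda>t. X t \<omega>) at_top at_top"
  shows "AE \<omega> in M. \<forall>\<delta>>0. \<forall>N. \<exists>T\<ge>0. \<exists>n\<ge>N. X T \<omega> \<ge> n powr p \<and>
      (\<forall>s\<ge>0. \<bar>B (T + s) \<omega> - B T \<omega>\<bar> \<le> \<delta> * (n + s) powr p)"
proof -
  have p0: "p > 0" using p \<alpha>_pos by (meson divide_pos_pos less_trans zero_less_one)
  define D where "D = \<rat> \<inter> {0::real..}"
  have D: "countable D" "D \<subseteq> {0..}" using countable_rat by (auto simp: D_def)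
  define R where "R \<delta> n = {x \<in> space (Pi\<^sub>M {0::real..} (\<lambda>_. borel :: real measure)). \<exists>s\<in>D. \<bar>x s\<bar> > \<delta> * (real n + s) powr p}" for \<delta> n
  have R: "R \<delta> n \<in> sets (Pi\<^sub>M {0..} (\<lambda>_. borel))" for \<delta> n
  proof -
    have [measurable]: "(\<lambda>x. x s) \<in> borel_measurable (Pi\<^sub>M {0..} (\<lambda>_. borel :: real measure))" if "s \<in> D" for s
      using that D by (intro measurable_component_singleton) auto
    show ?thesis unfolding R_def using D(1) by (intro sets.sets_Collect_countable_Ex') auto
  qed
  define Q where "Q \<delta> n T = {\<omega> \<in> space M. \<exists>s\<in>D. \<bar>B (T + s) \<omega> - B T \<omega>\<bar> > \<delta> * (real n + s) powr p}" for \<delta> n T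
  have Q: "Q \<delta> n T \<in> events" and PQ: "prob (Q \<delta> n T) = prob (Q \<delta> n 0)" if "T \<ge> 0" for \<delta> n T
  proof -
    have m: "(\<lambda>\<omega>. \<lambda>s\<in>{0..}. B (T + s) \<omega> - B T \<omega>) \<in> M \<rightarrow>\<^sub>M Pi\<^sub>M {0..} (\<lambda>_. borel)" if "T \<ge> 0" for T
      using that by (auto intro!: measurable_restrict borel_measurable_diff)
    have pre: "Q \<delta> n T = (\<lambda>\<omega>. \<lambda>s\<in>{0..}. B (T + s) \<omega> - B T \<omega>) -` R \<delta> n \<inter> space M" for T
      using D by (auto simp: Q_def R_def space_PiM subset_iff)
    show "Q \<delta> n T \<in> events" unfolding pre by (rule measurable_sets[OF m[OF that] R])
    have P: "prob (Q \<delta> n T) = measure (distr M (Pi\<^sub>M {0..} (\<lambda>_. borel)) (\<lambda>\<omega>. \<lambda>s\<in>{0..}. B s \<omega>)) (R \<delta> n)" if "T \<ge> 0" for T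
      unfolding pre distr_shift[OF that, symmetric] by (rule measure_distr[OF m[OF that] R, symmetric])
    show "prob (Q \<delta> n T) = prob (Q \<delta> n 0)" using P[OF that] P[of 0] by simp
  qed
  have Q_lim: "(\<lambda>n. prob (Q \<delta> n 0)) \<longlonglongrightarrow> 0" if \<delta>: "\<delta> > 0" for \<delta>
  proof -
    have mono: "decseq (\<lambda>n. Q \<delta> n 0)"
    proof (rule decseq_SucI, rule subsetI)
      fix n \<omega> assume "\<omega> \<in> Q \<delta> (Suc n) 0"
      then obtain s where s: "\<omega> \<in> space M" "s \<in> D" "\<bar>B s \<omega> - B 0 \<omega>\<bar> > \<delta> * (real (Suc n) + s) powr p"
        by (auto simp: Q_def)
      have "\<delta> * (real n + s) powr p \<le> \<delta> * (real (Suc n) + s) powr p"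
        using s D \<delta> p0 by (intro mult_left_mono powr_mono2) auto
      then show "\<omega> \<in> Q \<delta> n 0" using s by (auto simp: Q_def intro!: bexI[of _ s])
    qed
    have "(\<lambda>n. prob (Q \<delta> n 0)) \<longlonglongrightarrow> prob (\<Inter>n. Q \<delta> n 0)"
      using Q[of 0] mono by (intro finite_Lim_measure_decseq) auto
    moreover have "prob (\<Inter>n. Q \<delta> n 0) = 0"
    proof -
      \<comment> \<open>Half of this excess is spent on the growth bound; the other half makes the
        ratio to \<open>(n + s) powr p\<close> decay in \<open>n\<close>.\<close>
      define \<epsilon> where "\<epsilon> = p - 1 / \<alpha>"
      have "AE \<omega> in M. \<exists>C. \<forall>t\<ge>0. \<bar>B t \<omega>\<bar> \<le> C * (1 + t) powr (1 / \<alpha> + \<epsilon> / 2)"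
        using p by (intro AE_growth_at_top) (auto simp: \<epsilon>_def)
      then have "AE \<omega> in M. \<omega> \<notin> (\<Inter>n. Q \<delta> n 0)"
        using AE_space
      proof eventually_elim
        case (elim \<omega>)
        then obtain C where C: "\<And>t. t \<ge> 0 \<Longrightarrow> \<bar>B t \<omega>\<bar> \<le> C * (1 + t) powr (1 / \<alpha> + \<epsilon> / 2)" by blast
        have e: "1 / \<alpha> + \<epsilon> / 2 = p - \<epsilon> / 2" "\<epsilon> > 0" using p by (auto simp: \<epsilon>_def field_simps)
        have "((\<lambda>n. \<bar>C\<bar> * (1 + real n) powr (- (\<epsilon> / 2))) \<longlongrightarrow> 0) sequentially"
          by (intro tendsto_mult_right_zero tendsto_neg_powr filterlim_tendsto_add_at_top[OF tendsto_const]
            filterlim_real_sequentially) (use e in auto)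
        then have "eventually (\<lambda>n. \<bar>C\<bar> * (1 + real n) powr (- (\<epsilon> / 2)) < \<delta>) sequentially"
          using \<delta> by (intro order_tendstoD) auto
        then obtain n where n: "\<bar>C\<bar> * (1 + real n) powr (- (\<epsilon> / 2)) < \<delta>"
          by (auto simp: eventually_sequentially)
        have "\<omega> \<notin> Q \<delta> (Suc n) 0"
        proof
          assume "\<omega> \<in> Q \<delta> (Suc n) 0"
          then obtain s where s: "s \<in> D" "\<bar>B s \<omega>\<bar> > \<delta> * (1 + real n + s) powr p"
            using elim by (auto simp: Q_def B_0 add_ac)
          have s0: "s \<ge> 0" using s D by auto
          have "\<bar>B s \<omega>\<bar> \<le> C * (1 + s) powr (p - \<epsilon> / 2)" using C[OF s0] e by simp
          also have "\<dots> \<le> \<bar>C\<bar> * (1 + s) powr (p - \<epsilon> / 2)" by (intro mult_right_mono) auto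
          also have "\<dots> \<le> \<bar>C\<bar> * (1 + real n + s) powr (p - \<epsilon> / 2)"
          proof -
            have "1 / \<alpha> + \<epsilon> / 2 \<ge> 0" using \<alpha>_pos e(2) by (intro add_nonneg_nonneg) auto
            then have "p - \<epsilon> / 2 \<ge> 0" unfolding e(1) .
            then show ?thesis using s0 by (intro mult_left_mono powr_mono2) auto
          qed
          also have "\<dots> = \<bar>C\<bar> * (1 + real n + s) powr (- (\<epsilon> / 2)) * (1 + real n + s) powr p"
            using s0 by (simp flip: powr_add)
          also have "\<dots> \<le> \<bar>C\<bar> * (1 + real n) powr (- (\<epsilon> / 2)) * (1 + real n + s) powr p"
            using s0 e by (intro mult_right_mono mult_left_mono powr_mono2') auto
          also have "\<dots> \<le> \<delta> * (1 + real n + s) powr p" using n by (intro mult_right_mono) auto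
          finally show False using s by simp
        qed
        then show ?case by blast
      qed
      moreover have "(\<Inter>n. Q \<delta> n 0) \<in> events" using Q[of 0] by auto
      ultimately show ?thesis by (simp add: prob_eq_0)
    qed
    ultimately show ?thesis by simp
  qed
  have main: "AE \<omega> in M. \<exists>T::nat. \<exists>n\<ge>N. X (real T) \<omega> \<ge> real n powr p \<and> \<omega> \<notin> Q \<delta> n (real T)"
    if \<delta>: "\<delta> > 0" for \<delta> :: real and N :: nat
  proof -
    define bad where "bad = {\<omega> \<in> space M. \<forall>T::nat. \<forall>n\<ge>N. X (real T) \<omega> < real n powr p \<or> \<omega> \<in> Q \<delta> n (real T)}"
    define low where "low n T = {\<omega> \<in> space M. X (real T) \<omega> < real n powr p}" for n T :: nat
    have [measurable]: "X (real T) \<in> borel_measurable M" "Q \<delta> n (real T) \<in> events" for T n :: nat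
      using Xm Q by auto
    have bad: "bad \<in> events" unfolding bad_def by measurable
    have low: "low n T \<in> events" for n T unfolding low_def by measurable
    have low_lim: "(\<lambda>T. prob (low n T)) \<longlonglongrightarrow> 0" for n
    proof -
      have "(\<lambda>T. \<integral>\<omega>. indicator (low n T) \<omega> \<partial>M) \<longlonglongrightarrow> (\<integral>\<omega>. 0 \<partial>M :: real)"
      proof (rule integral_dominated_convergence[where w = "\<lambda>_. 1"])
        show "AE \<omega> in M. (\<lambda>T. indicator (low n T) \<omega> :: real) \<longlonglongrightarrow> 0"
          using X
        proof eventually_elim
          case (elim \<omega>)
          have "filterlim (\<lambda>T::nat. X (real T) \<omega>) at_top sequentially"
            by (rule filterlim_compose[OF elim filterlim_real_sequentially])
          then have "eventually (\<lambda>T::nat. X (real T) \<omega> \<ge> real n powr p) sequentially"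
            by (simp add: filterlim_at_top)
          then have "eventually (\<lambda>T. indicator (low n T) \<omega> = (0 :: real)) sequentially"
            by eventually_elim (auto simp: low_def)
          then show ?case by (rule tendsto_eventually)
        qed
      qed (use low in \<open>auto simp: indicator_def\<close>)
      then show ?thesis using low by simp
    qed
    have "prob bad \<le> prob (Q \<delta> n 0)" if n: "n \<ge> N" for n
    proof -
      have "prob bad \<le> prob (low n T) + prob (Q \<delta> n 0)" for T
      proof -
        have "prob bad \<le> prob (low n T \<union> Q \<delta> n (real T))"
          by (intro finite_measure_mono) (use n low in \<open>auto simp: bad_def low_def\<close>)
        also have "\<dots> \<le> prob (low n T) + prob (Q \<delta> n (real T))"
          using low by (intro measure_Un_le) auto
        finally show ?thesis using PQ[of "real T" \<delta> n] by simp
      qed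
      moreover have "(\<lambda>T. prob (low n T) + prob (Q \<delta> n 0)) \<longlonglongrightarrow> 0 + prob (Q \<delta> n 0)"
        by (intro tendsto_intros low_lim)
      ultimately have "prob bad \<le> 0 + prob (Q \<delta> n 0)" by (intro LIMSEQ_le_const) auto
      then show ?thesis by simp
    qed
    then have "prob bad \<le> 0" by (intro LIMSEQ_le_const[OF Q_lim[OF \<delta>]]) auto
    then have "AE \<omega> in M. \<omega> \<notin> bad" using bad by (simp add: prob_eq_0[symmetric] measure_le_0_iff)
    then show ?thesis using AE_space
      by eventually_elim (auto simp: bad_def not_less)
  qed
  \<comment> \<open>Countably many values \<open>1 / Suc j\<close> of \<delta> and integers
    \<open>N\<close> give one exceptional null set for all of them.\<close>
  have "AE \<omega> in M. \<forall>j N::nat. \<exists>T::nat. \<exists>n\<ge>N. X (real T) \<omega> \<ge> real n powr p \<and> \<omega> \<notin> Q (1 / real (Suc j)) n (real T)"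
    unfolding AE_all_countable by (intro allI main) simp
  then show ?thesis using AE_space
  proof eventually_elim
    case (elim \<omega>)
    show ?case
    proof (intro allI impI)
      fix \<delta> N :: real assume \<delta>: "\<delta> > 0"
      obtain j :: nat where j: "1 / real (Suc j) < \<delta>" using \<delta> by (rule nat_approx_posE)
      from elim(1)[rule_format, of "nat \<lceil>N\<rceil>" j] obtain T n :: nat where Tn: "n \<ge> nat \<lceil>N\<rceil>"
        "X (real T) \<omega> \<ge> real n powr p" "\<omega> \<notin> Q (1 / real (Suc j)) n (real T)" by blast
      \<comment> \<open>The event \<open>Q\<close> only looks at rational times; an exceedance at a
        real \<open>s\<close> would recur at a rational one shortly after.\<close>
      have "\<bar>B (real T + s) \<omega> - B (real T) \<omega>\<bar> \<le> \<delta> * (real n + s) powr p" if s: "s \<ge> 0" for s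
      proof (rule ccontr)
        assume "\<not> \<bar>B (real T + s) \<omega> - B (real T) \<omega>\<bar> \<le> \<delta> * (real n + s) powr p"
        moreover have "1 / real (Suc j) * (real n + s) powr p \<le> \<delta> * (real n + s) powr p"
          using j by (intro mult_right_mono) auto
        ultimately have gt: "\<bar>B (real T + s) \<omega> - B (real T) \<omega>\<bar> > 1 / real (Suc j) * (real n + s) powr p" by linarith
        have "((\<lambda>s. B (real T + s) \<omega>) \<longlongrightarrow> B (real T + s) \<omega>) (at_right s)"
          using B_right[OF elim(2), of "real T + s"] s by (intro tendsto_at_right_shift) auto
        then have lim: "((\<lambda>s. B (real T + s) \<omega> - B (real T) \<omega>) \<longlongrightarrow> B (real T + s) \<omega> - B (real T) \<omega>) (at_right s)"
          by (intro tendsto_intros)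
        have lim2: "((\<lambda>s. 1 / real (Suc j) * (real n + s) powr p) \<longlongrightarrow> 1 / real (Suc j) * (real n + s) powr p) (at_right s)"
        proof -
          have "eventually (\<lambda>u. 0 \<le> real n + u) (at_right s)"
            using eventually_at_right_less[of s] by eventually_elim (use s in auto)
          then show ?thesis using p0 by (intro tendsto_intros) auto
        qed
        obtain q where "q \<in> \<rat>" "s < q" "\<bar>B (real T + q) \<omega> - B (real T) \<omega>\<bar> > 1 / real (Suc j) * (real n + q) powr p"
          using rational_after_ge[OF lim gt lim2, of "s + 1"] by auto
        then show False using Tn(3) s elim(2) by (auto simp: Q_def D_def)
      qed
      then show "\<exists>T\<ge>0. \<exists>n\<ge>N. X T \<omega> \<ge> n powr p \<and> (\<forall>s\<ge>0. \<bar>B (T + s) \<omega> - B T \<omega>\<bar> \<le> \<delta> * (n + s) powr p)"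
        using Tn by (intro exI[of _ "real T"] conjI exI[of _ "real n"]) auto
    qed
  qed
qed

end

section \<open>Integrals against a stable process\<close>

text \<open>Bisection: around each point the two one-sided limits bound the path.\<close>

lemma cadlag_on_imp_bounded:
  assumes x: "cadlag_on {0..} x" and st: "0 \<le> s" "s \<le> t"
  obtains C where "C \<ge> 0" "\<And>u. u \<in> {s..t} \<Longrightarrow> \<bar>x u\<bar> \<le> C"
proof -
  have "\<exists>C. \<forall>u\<in>{s..t} \<inter> {s..t}. \<bar>x u\<bar> \<le> C"
  \<comment> \<open>The intersection with \<open>{s..t}\<close> is there because small intervals
    around an endpoint stick out.\<close>
  proof (rule Bolzano[where P = "\<lambda>a b. \<exists>C. \<forall>u\<in>{a..b} \<inter> {s..t}. \<bar>x u\<bar> \<le> C"])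
    fix a b c assume "\<exists>C. \<forall>u\<in>{a..b} \<inter> {s..t}. \<bar>x u\<bar> \<le> C" "\<exists>C. \<forall>u\<in>{b..c} \<inter> {s..t}. \<bar>x u\<bar> \<le> C"
    then obtain C D where "\<forall>u\<in>{a..b} \<inter> {s..t}. \<bar>x u\<bar> \<le> C" "\<forall>u\<in>{b..c} \<inter> {s..t}. \<bar>x u\<bar> \<le> D" by blast
    then show "\<exists>C. \<forall>u\<in>{a..c} \<inter> {s..t}. \<bar>x u\<bar> \<le> C"
      by (intro exI[of _ "max C D"]) (force simp: le_max_iff_disj)
  next
    fix u assume "s \<le> u" "u \<le> t"
    then have u: "u \<in> {0..}" using st by auto
    then obtain l where l: "(x \<longlongrightarrow> l) (at u within {0..} \<inter> {..<u})" and r: "(x \<longlongrightarrow> x u) (at u within {0..} \<inter> {u<..})"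
      using x by (auto simp: cadlag_on_def)
    obtain d1 where d1: "d1 > 0" "\<And>v. v \<in> {0..} \<inter> {..<u} \<Longrightarrow> v \<noteq> u \<Longrightarrow> dist v u < d1 \<Longrightarrow> dist (x v) l < 1"
      using tendstoD[OF l, of 1] by (auto simp: eventually_at)
    obtain d2 where d2: "d2 > 0" "\<And>v. v \<in> {0..} \<inter> {u<..} \<Longrightarrow> v \<noteq> u \<Longrightarrow> dist v u < d2 \<Longrightarrow> dist (x v) (x u) < 1"
      using tendstoD[OF r, of 1] by (auto simp: eventually_at)
    have "\<bar>x v\<bar> \<le> max (\<bar>l\<bar> + 1) (\<bar>x u\<bar> + 1)"
      if "a \<le> u \<and> u \<le> b \<and> b - a < min d1 d2" "v \<in> {a..b} \<inter> {s..t}" for a b v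
    proof -
      have v: "\<bar>v - u\<bar> < min d1 d2" "v \<ge> 0" using that st by (auto simp: abs_le_iff)
      consider "v < u" | "v = u" | "v > u" by linarith
      then show ?thesis
      proof cases
        case 1
        then have "dist (x v) l < 1" using v by (intro d1) (auto simp: dist_real_def)
        then show ?thesis by (auto simp: dist_real_def)
      next
        case 3
        then have "dist (x v) (x u) < 1" using v by (intro d2) (auto simp: dist_real_def)
        then show ?thesis by (auto simp: dist_real_def)
      qed auto
    qed
    then show "\<exists>d>0. \<forall>a b. a \<le> u \<and> u \<le> b \<and> b - a < d \<longrightarrow> (\<exists>C. \<forall>v\<in>{a..b} \<inter> {s..t}. \<bar>x v\<bar> \<le> C)"
      using d1(1) d2(1)
      by (intro exI[of _ "min d1 d2"] conjI allI impI exI[of _ "max (\<bar>l\<bar> + 1) (\<bar>x u\<bar> + 1)"] ballI) auto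
  qed fact
  then obtain C where "\<forall>u\<in>{s..t}. \<bar>x u\<bar> \<le> C" by auto
  then show thesis by (intro that[of "max C 0"]) (auto simp: le_max_iff_disj)
qed

lemma right_continuous_sequentially:
  fixes x :: "real \<Rightarrow> real"
  assumes "(x \<longlongrightarrow> x u) (at_right u)" "v \<longlonglongrightarrow> u" "\<And>n. v n \<ge> u"
  shows "(\<lambda>n. x (v n)) \<longlonglongrightarrow> x u"
proof -
  have "continuous (at u within {u..}) x"
    using assms(1) by (simp add: continuous_within at_within_Ici_at_right)
  then show ?thesis using assms(2,3) by (simp add: continuous_within_sequentially o_def)
qed

text \<open>Limit of step functions that sample the path on a grid strictly to the right of
  \<open>u\<close>, where right continuity applies. The indicator removes negative times, at which
  the path is unconstrained.\<close>

lemma cadlag_on_measurable: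
  assumes x: "cadlag_on {0..} x"
  shows "(\<lambda>u. indicator {0..} u * x u :: real) \<in> borel_measurable borel"
proof (rule borel_measurable_LIMSEQ_real)
  define g where "g n u = indicator {0..} u * x ((of_int \<lfloor>real (Suc n) * u\<rfloor> + 1) / real (Suc n))" for n and u :: real
  show "g n \<in> borel_measurable borel" for n
  proof -
    have "(\<lambda>u::real. x ((of_int \<lfloor>real (Suc n) * u\<rfloor> + 1) / real (Suc n))) \<in> borel_measurable borel"
      by (rule measurable_compose[where g = "\<lambda>k. x ((of_int k + 1) / real (Suc n))" and f = "\<lambda>u. \<lfloor>real (Suc n) * u\<rfloor>"
          and N = "count_space UNIV"]) measurable
    then show ?thesis unfolding g_def by measurable
  qed
  fix u :: real
  show "(\<lambda>n. g n u) \<longlonglongrightarrow> indicator {0..} u * x u"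
  proof (cases "u \<ge> 0")
    case True
    have r: "(x \<longlongrightarrow> x u) (at_right u)" using True by (intro cadlag_on_right[OF x]) auto
    define v where "v n = (of_int \<lfloor>real (Suc n) * u\<rfloor> + 1) / real (Suc n)" for n
    have v: "u \<le> v n" "v n \<le> u + 1 / real (Suc n)" for n
    proof -
      have "real (Suc n) * u \<le> of_int \<lfloor>real (Suc n) * u\<rfloor> + 1" by linarith
      then show "u \<le> v n" unfolding v_def by (simp add: pos_le_divide_eq mult.commute del: of_nat_Suc)
      have "of_int \<lfloor>real (Suc n) * u\<rfloor> + 1 \<le> real (Suc n) * u + 1" by linarith
      then have "v n \<le> (real (Suc n) * u + 1) / real (Suc n)" unfolding v_def by (intro divide_right_mono) auto
      then show "v n \<le> u + 1 / real (Suc n)" by (simp add: add_divide_distrib)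
    qed
    have "v \<longlonglongrightarrow> u"
    proof (rule tendsto_sandwich[of "\<lambda>_. u" v sequentially "\<lambda>n. u + 1 / real (Suc n)"])
      show "(\<lambda>n. u + 1 / real (Suc n)) \<longlonglongrightarrow> u"
        using LIMSEQ_inverse_real_of_nat_add[of u] by (simp add: inverse_eq_divide)
    qed (use v in auto)
    then have "(\<lambda>n. x (v n)) \<longlonglongrightarrow> x u" by (rule right_continuous_sequentially[OF r _ v(1)])
    moreover have "g n u = x (v n)" for n using True by (simp add: g_def v_def)
    ultimately show ?thesis using True by simp
  qed (simp add: g_def)
qed

lemma cadlag_on_compose:
  fixes f :: "real \<Rightarrow> real"
  assumes "cadlag_on I x" "continuous_on UNIV f"
  shows "cadlag_on I (\<lambda>t. f (x t))"
proof -
  have f: "isCont f y" for y using assms(2) by (simp add: continuous_on_eq_continuous_at)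
  show ?thesis unfolding cadlag_on_def
  proof (intro ballI conjI)
    fix t assume t: "t \<in> I"
    show "((\<lambda>t. f (x t)) \<longlongrightarrow> f (x t)) (at t within I \<inter> {t<..})"
      using assms(1) t by (intro isCont_tendsto_compose[OF f]) (auto simp: cadlag_on_def)
    obtain l where "(x \<longlongrightarrow> l) (at t within I \<inter> {..<t})" using assms(1) t by (auto simp: cadlag_on_def)
    then show "\<exists>l. ((\<lambda>t. f (x t)) \<longlongrightarrow> l) (at t within I \<inter> {..<t})"
      using isCont_tendsto_compose[OF f] by blast
  qed
qed

lemma cadlag_on_set_integrable:
  assumes x: "cadlag_on {0..} x" and st: "0 \<le> s"
  shows "set_integrable lborel {s..t} x"
proof (cases "s \<le> t")
  case True
  obtain C where C: "\<And>u. u \<in> {s..t} \<Longrightarrow> \<bar>x u\<bar> \<le> C" using cadlag_on_imp_bounded[OF x st True] by blast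
  have "(\<lambda>u. indicator {s..t} u * (indicator {0..} u * x u)) \<in> borel_measurable borel"
    using cadlag_on_measurable[OF x] by measurable
  also have "(\<lambda>u. indicator {s..t} u * (indicator {0..} u * x u)) = (\<lambda>u. indicator {s..t} u *\<^sub>R x u)"
    using st by (auto simp: indicator_def fun_eq_iff)
  finally have m: "(\<lambda>u. indicator {s..t} u *\<^sub>R x u) \<in> borel_measurable lborel" by simp
  show ?thesis unfolding set_integrable_def
  proof (rule Bochner_Integration.integrable_bound[OF _ m])
    show "integrable lborel (\<lambda>u. indicator {s..t} u *\<^sub>R C)"
      by (intro integrable_scaleR_left integrable_real_indicator) (auto simp: emeasure_lborel_Icc_eq)
    have "norm (indicator {s..t} u *\<^sub>R x u) \<le> norm (indicator {s..t} u *\<^sub>R C)" for u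
      using C[of u] by (cases "u \<in> {s..t}") (auto intro: order_trans[OF _ abs_ge_self])
    then show "AE u in lborel. norm (indicator {s..t} u *\<^sub>R x u) \<le> norm (indicator {s..t} u *\<^sub>R C)"
      by (intro AE_I2)
  qed
qed (simp add: set_integrable_def)

lemma cadlag_on_integral:
  assumes x: "cadlag_on {0..} x" and st: "0 \<le> s"
  shows "x integrable_on {s..t}" and "(LBINT u:{s..t}. x u) = integral {s..t} x"
  using set_borel_integral_eq_integral[OF cadlag_on_set_integrable[OF assms]] by auto

text \<open>Only the right limit of the integrand is available, so the fundamental theorem is
  applied on \<open>{t..t + 1}\<close>, where \<open>g\<close> is continuous at \<open>t\<close>; it
  yields the one-sided derivative used with barriers.\<close>

lemma integral_right_derivative:
  fixes g :: "real \<Rightarrow> real"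
  assumes int: "\<And>t. g integrable_on {a..t}" and t: "t \<ge> a" and r: "(g \<longlongrightarrow> g t) (at_right t)"
  shows "((\<lambda>t. integral {a..t} g) has_real_derivative g t) (at_right t)"
proof -
  have i: "g integrable_on {t..t + 1}"
    by (rule integrable_subinterval_real[OF int[of "t + 1"]]) (use t in auto)
  have "continuous (at t within {t..t + 1}) g"
    using r by (simp add: continuous_within at_within_Icc_at_right)
  then have "((\<lambda>u. integral {t..u} g) has_vector_derivative g t) (at t within {t..t + 1} - {})"
    by (intro integral_has_vector_derivative_continuous_at i) auto
  then have "((\<lambda>u. integral {t..u} g) has_real_derivative g t) (at_right t)"
    by (simp add: at_within_Icc_at_right has_real_derivative_iff_has_vector_derivative)
  then have "((\<lambda>u. integral {a..t} g + integral {t..u} g) has_real_derivative 0 + g t) (at_right t)"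
    by (intro derivative_intros)
  then have d: "((\<lambda>u. integral {a..t} g + integral {t..u} g) has_real_derivative g t) (at t within {t..})"
    by (simp add: at_within_Ici_at_right)
  have eq: "integral {a..t} g + integral {t..u} g = integral {a..u} g" if "u \<in> {t..}" for u
    using that t int by (intro Henstock_Kurzweil_Integration.integral_combine) auto
  have "((\<lambda>t. integral {a..t} g) has_real_derivative g t) (at t within {t..})"
    by (rule has_field_derivative_transform_within[OF d zero_less_one]) (auto intro: eq)
  then show ?thesis by (simp add: at_within_Ici_at_right)
qed

text \<open>Sums with right endpoints, because the integrand is only right continuous.\<close>

lemma right_Riemann_sums:
  fixes g A A' :: "real \<Rightarrow> real"
  assumes st: "s \<le> t" and g: "\<And>u. u \<in> {s..t} \<Longrightarrow> (g \<longlongrightarrow> g u) (at_right u)"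
    and C: "\<And>u. u \<in> {s..t} \<Longrightarrow> \<bar>g u\<bar> \<le> C"
    and A: "\<And>u. u \<in> {s..t} \<Longrightarrow> (A has_real_derivative A' u) (at u)" and A': "continuous_on {s..t} A'"
  defines "\<tau> \<equiv> \<lambda>n i. s + real i * ((t - s) / real (Suc n))"
  shows "(\<lambda>n. \<Sum>i<Suc n. g (\<tau> n (Suc i)) * (A (\<tau> n (Suc i)) - A (\<tau> n i))) \<longlonglongrightarrow> integral {s..t} (\<lambda>u. g u * A' u)"
proof (cases "s = t")
  case True
  then show ?thesis by (simp add: \<tau>_def)
next
  case False
  with st have st: "s < t" by simp
  define h where "h n = (t - s) / real (Suc n)" for n
  have h: "h n > 0" "real (Suc n) * h n = t - s" for n using st by (auto simp: h_def)
  have \<tau>: "\<tau> n i = s + real i * h n" for n i by (simp add: \<tau>_def h_def)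
  have \<tau>_mem: "\<tau> n i \<in> {s..t}" if "i \<le> Suc n" for n i
  proof -
    have "real i * h n \<le> real (Suc n) * h n" using that h(1)[of n] by (intro mult_right_mono) auto
    then have "real i * h n \<le> t - s" by (simp only: h(2))
    then show ?thesis using h(1)[of n] by (simp add: \<tau> less_imp_le)
  qed
  \<comment> \<open>The right endpoint of the grid cell containing \<open>u\<close>. With it the
    Riemann sum is exactly the integral of \<open>g (v n u) * A' u\<close>, and dominated
    convergence finishes the proof.\<close>
  define v where "v n u = s + of_int \<lceil>(u - s) / h n\<rceil> * h n" for n u
  have v_eq: "v n u = \<tau> n (Suc i)" if "u \<in> {\<tau> n i<..\<tau> n (Suc i)}" for n i u
  proof -
    have "real i < (u - s) / h n" "(u - s) / h n \<le> real i + 1"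
      using that h(1)[of n] by (auto simp: \<tau> field_simps)
    then have "\<lceil>(u - s) / h n\<rceil> = int i + 1" by linarith
    then show ?thesis by (simp add: v_def \<tau>)
  qed
  have sums: "((\<lambda>u. g (v n u) * A' u) has_integral (\<Sum>i<k. g (\<tau> n (Suc i)) * (A (\<tau> n (Suc i)) - A (\<tau> n i)))) {s..\<tau> n k}"
    if "k \<le> Suc n" for n k
    using that
  proof (induction k)
    case 0
    then show ?case by (simp add: \<tau> has_integral_refl)
  next
    case (Suc k)
    have le: "\<tau> n k \<le> \<tau> n (Suc k)" using h(1)[of n] by (simp add: \<tau> algebra_simps)
    have sub: "{\<tau> n k..\<tau> n (Suc k)} \<subseteq> {s..t}" using \<tau>_mem[of k n] \<tau>_mem[of "Suc k" n] Suc.prems by auto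
    have "(A' has_integral (A (\<tau> n (Suc k)) - A (\<tau> n k))) {\<tau> n k..\<tau> n (Suc k)}"
      using A sub by (intro fundamental_theorem_of_calculus le)
        (auto simp: has_real_derivative_iff_has_vector_derivative[symmetric] intro: has_field_derivative_at_within)
    then have "((\<lambda>u. g (\<tau> n (Suc k)) * A' u) has_integral g (\<tau> n (Suc k)) * (A (\<tau> n (Suc k)) - A (\<tau> n k))) {\<tau> n k..\<tau> n (Suc k)}"
      by (rule has_integral_mult_right)
    \<comment> \<open>The left end of the cell is sampled with the previous cell; one point does not
      affect the integral.\<close>
    then have "((\<lambda>u. g (v n u) * A' u) has_integral g (\<tau> n (Suc k)) * (A (\<tau> n (Suc k)) - A (\<tau> n k))) {\<tau> n k..\<tau> n (Suc k)}"
    proof (rule has_integral_spike_finite[where S = "{\<tau> n k}", rotated 2])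
      fix u assume "u \<in> {\<tau> n k..\<tau> n (Suc k)} - {\<tau> n k}"
      then have "v n u = \<tau> n (Suc k)" by (intro v_eq) auto
      then show "g (v n u) * A' u = g (\<tau> n (Suc k)) * A' u" by simp
    qed simp
    moreover have "s \<le> \<tau> n k" using \<tau>_mem[of k n] Suc.prems by auto
    ultimately show ?case
      using has_integral_combine[OF _ le Suc.IH, of "g (\<tau> n (Suc k)) * (A (\<tau> n (Suc k)) - A (\<tau> n k))"] Suc.prems
      by simp
  qed
  have \<tau>_last: "\<tau> n (Suc n) = t" for n using h(2)[of n] by (simp add: \<tau> del: of_nat_Suc)
  have int: "((\<lambda>u. g (v n u) * A' u) has_integral (\<Sum>i<Suc n. g (\<tau> n (Suc i)) * (A (\<tau> n (Suc i)) - A (\<tau> n i)))) {s..t}" for n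
    using sums[of "Suc n" n] by (simp add: \<tau>_last)
  have v: "u \<le> v n u" "v n u \<le> u + h n" "v n u \<le> t" if "u \<in> {s..t}" for n u
  proof -
    have "(u - s) / h n * h n \<le> of_int \<lceil>(u - s) / h n\<rceil> * h n" using h(1)[of n] by (intro mult_right_mono) auto
    then show "u \<le> v n u" using h(1)[of n] by (simp add: v_def)
    have "of_int \<lceil>(u - s) / h n\<rceil> * h n \<le> ((u - s) / h n + 1) * h n" using h(1)[of n] by (intro mult_right_mono) linarith+
    then show "v n u \<le> u + h n" using h(1)[of n] by (simp add: v_def distrib_right)
    have "(u - s) / h n \<le> real (Suc n)" using that h[of n] by (simp add: pos_divide_le_eq del: of_nat_Suc)
    then have "\<lceil>(u - s) / h n\<rceil> \<le> int (Suc n)" by (simp add: ceiling_le_iff)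
    then have "real_of_int \<lceil>(u - s) / h n\<rceil> \<le> real (Suc n)" by linarith
    then have "of_int \<lceil>(u - s) / h n\<rceil> * h n \<le> real (Suc n) * h n" using h(1)[of n] by (intro mult_right_mono) auto
    then show "v n u \<le> t" unfolding h(2) by (simp add: v_def)
  qed
  have h0: "h \<longlonglongrightarrow> 0"
  proof -
    have "h = (\<lambda>n. (t - s) * inverse (real (Suc n)))" by (simp only: fun_eq_iff h_def divide_inverse simp_thms)
    then show ?thesis using tendsto_mult_right_zero[OF LIMSEQ_inverse_real_of_nat, of "t - s"] by simp
  qed
  have "(\<lambda>n. integral {s..t} (\<lambda>u. g (v n u) * A' u)) \<longlonglongrightarrow> integral {s..t} (\<lambda>u. g u * A' u)"
  proof (rule dominated_convergence(2)[where h = "\<lambda>u. C * \<bar>A' u\<bar>"])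
    show "(\<lambda>u. C * \<bar>A' u\<bar>) integrable_on {s..t}"
      using A' by (intro integrable_continuous_real continuous_intros)
    show "norm (g (v n u) * A' u) \<le> C * \<bar>A' u\<bar>" if "u \<in> {s..t}" for n u
      using C[of "v n u"] v[OF that, of n] that by (auto simp: abs_mult intro!: mult_right_mono)
    show "(\<lambda>n. g (v n u) * A' u) \<longlonglongrightarrow> g u * A' u" if u: "u \<in> {s..t}" for u
    proof -
      have "(\<lambda>n. v n u) \<longlonglongrightarrow> u"
      proof (rule tendsto_sandwich)
        show "eventually (\<lambda>n. u \<le> v n u) sequentially" "eventually (\<lambda>n. v n u \<le> u + h n) sequentially"
          using v[OF u] by (auto intro: always_eventually)
        show "(\<lambda>n. u + h n) \<longlonglongrightarrow> u"
          using tendsto_add[OF tendsto_const h0, of u] unfolding add_0_right .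
      qed (rule tendsto_const)
      then have "(\<lambda>n. g (v n u)) \<longlonglongrightarrow> g u"
        by (rule right_continuous_sequentially[OF g[OF u] _ v(1)[OF u]])
      then show ?thesis by (rule tendsto_mult_right)
    qed
  qed (use int in blast)
  then show ?thesis using integral_unique[OF int] by simp
qed


lemma continuous_on_atLeastI:
  fixes f :: "real \<Rightarrow> 'b::topological_space"
  assumes "\<And>T. continuous_on {a..T} f"
  shows "continuous_on {a..} f"
  unfolding continuous_on_def
proof
  fix x assume x: "x \<in> {a..}"
  have "(f \<longlongrightarrow> f x) (at x within {a..x + 1})"
    using assms[of "x + 1"] x by (auto simp: continuous_on_def)
  also have "at x within {a..x + 1} = at x within {a..}"
    by (rule at_within_nhd[where S = "{..<x + 1}"]) auto
  finally show "(f \<longlongrightarrow> f x) (at x within {a..})" .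
qed

text \<open>The growth bound with \<open>e > \<gamma>\<close> makes
  \<open>C * u powr (e - \<gamma> - 1)\<close> an integrable majorant near 0; on compact intervals
  away from 0 the integrand is bounded. The last part gives the rate
  \<open>t powr (e - \<gamma>)\<close> at 0.\<close>

lemma singular_integral:
  fixes b :: "real \<Rightarrow> real"
  assumes b: "cadlag_on {0..} b" and d: "d > 0" and growth: "\<forall>t. 0 < t \<and> t \<le> d \<longrightarrow> \<bar>b t\<bar> \<le> C * t powr e"
    and e: "\<gamma> < e"
  defines "g \<equiv> \<lambda>u. u powr (- \<gamma> - 1) * b u"
  shows "g integrable_on {0..t}"
    and "continuous_on {0..} (\<lambda>t. integral {0..t} g)"
    and "t > 0 \<Longrightarrow> ((\<lambda>t. integral {0..t} g) has_real_derivative t powr (- \<gamma> - 1) * b t) (at_right t)"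
    and "0 \<le> t \<Longrightarrow> t \<le> d \<Longrightarrow> \<bar>integral {0..t} g\<bar> \<le> C * t powr (e - \<gamma>) / (e - \<gamma>)"
proof -
  have meas: "g \<in> borel_measurable (lebesgue_on {s..t})" if "s \<ge> 0" for s t
  proof -
    have "(\<lambda>u. u powr (- \<gamma> - 1) * (indicator {0..} u * b u)) \<in> borel_measurable borel"
      using cadlag_on_measurable[OF b] by measurable
    then have "(\<lambda>u. u powr (- \<gamma> - 1) * (indicator {0..} u * b u)) \<in> borel_measurable (lebesgue_on {s..t})"
      by (intro measurable_restrict_space1 measurable_completion) simp
    then show ?thesis
      by (rule measurable_cong[THEN iffD1, rotated]) (use that in \<open>auto simp: g_def\<close>)
  qed
  \<comment> \<open>At \<open>u = 0\<close> both sides vanish, since \<open>0 powr y = 0\<close> for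
    every \<open>y\<close>.\<close>
  have bound: "norm (g u) \<le> C * u powr (e - \<gamma> - 1)" if "u \<in> {0..d}" for u
  proof (cases "u = 0")
    case False
    then have u: "0 < u" "u \<le> d" using that by auto
    have "norm (g u) = u powr (- \<gamma> - 1) * \<bar>b u\<bar>" by (simp add: g_def abs_mult)
    also have "\<dots> \<le> u powr (- \<gamma> - 1) * (C * u powr e)" by (intro mult_left_mono growth[rule_format] conjI u) auto
    also have "\<dots> = C * u powr (e - \<gamma> - 1)" using u by (simp add: algebra_simps flip: powr_add)
    finally show ?thesis .
  qed (simp add: g_def)
  have powr_int: "((\<lambda>u. C * u powr (e - \<gamma> - 1)) has_integral C * (t powr (e - \<gamma>) / (e - \<gamma>))) {0..t}" if "t \<ge> 0" for t
    using has_integral_powr_from_0[of "e - \<gamma> - 1" t] e that by (intro has_integral_mult_right) simp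
  have near: "g integrable_on {0..t}" if "0 \<le> t" "t \<le> d" for t
    using bound that powr_int[OF that(1)]
    by (intro measurable_bounded_by_integrable_imp_integrable[OF meas, where g = "\<lambda>u. C * u powr (e - \<gamma> - 1)"]) auto
  have far: "g integrable_on {d..t}" for t
  proof (cases "d \<le> t")
    case True
    obtain D where D: "\<And>u. u \<in> {d..t} \<Longrightarrow> \<bar>b u\<bar> \<le> D" using cadlag_on_imp_bounded[OF b _ True] d by auto
    show ?thesis
    proof (rule measurable_bounded_by_integrable_imp_integrable[OF meas])
      show "(\<lambda>u. u powr (- \<gamma> - 1) * D) integrable_on {d..t}"
        using d by (intro integrable_continuous_real continuous_intros) auto
      show "norm (g u) \<le> u powr (- \<gamma> - 1) * D" if "u \<in> {d..t}" for u
        using D[OF that] by (auto simp: g_def abs_mult intro!: mult_left_mono)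
    qed (use d in auto)
  qed (simp add: integrable_on_empty)
  have int: "g integrable_on {0..t}" for t
  proof (cases "t \<le> d")
    case True
    then show ?thesis using near[of t] by (cases "t \<ge> 0") (auto simp: integrable_on_empty)
  next
    case False
    then show ?thesis
      using near[of d] far[of t] d by (intro Henstock_Kurzweil_Integration.integrable_combine[of 0 d t]) auto
  qed
  then show "g integrable_on {0..t}" .
  show "continuous_on {0..} (\<lambda>t. integral {0..t} g)"
    by (intro continuous_on_atLeastI indefinite_integral_continuous_1 int)
  show "((\<lambda>t. integral {0..t} g) has_real_derivative t powr (- \<gamma> - 1) * b t) (at_right t)" if "t > 0"
  proof -
    have "(g \<longlongrightarrow> g t) (at_right t)" unfolding g_def
      using that by (intro tendsto_intros cadlag_on_right[OF b]) auto
    from integral_right_derivative[OF int _ this] that show ?thesis by (simp add: g_def)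
  qed
  show "\<bar>integral {0..t} g\<bar> \<le> C * t powr (e - \<gamma>) / (e - \<gamma>)" if "0 \<le> t" "t \<le> d"
  proof -
    have "norm (integral {0..t} g) \<le> integral {0..t} (\<lambda>u. C * u powr (e - \<gamma> - 1))"
      using bound that powr_int[OF that(1)] by (intro integral_norm_bound_integral int) auto
    also have "\<dots> = C * (t powr (e - \<gamma>) / (e - \<gamma>))" using powr_int[OF that(1)] by (rule integral_unique)
    finally show ?thesis by simp
  qed
qed

context stable_process
begin

section \<open>The law of the integral over intervals away from zero\<close>

lemma real_distribution_law: "t \<ge> 0 \<Longrightarrow> real_distribution (law t)"
  unfolding law_def by (intro real_distribution_distr) measurable

lemma char_law: "t \<ge> 0 \<Longrightarrow> char (law t) \<theta> = char (law 1) (t powr (1 / \<alpha>) * \<theta>)"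
proof -
  assume t: "t \<ge> 0"
  have [measurable]: "B t \<in> borel_measurable M" "B 1 \<in> borel_measurable M" using t by auto
  show ?thesis
  proof (cases "t = 0")
    case True
    have "char (law 0) \<theta> = (CLINT \<omega>|M. iexp (\<theta> * B 0 \<omega>))"
      unfolding law_def char_def by (subst integral_distr) (use True in auto)
    also have "\<dots> = (CLINT \<omega>|M. 1)" by (rule Bochner_Integration.integral_cong) (auto simp: B_0)
    finally show ?thesis using True real_distribution.char_zero[OF real_distribution_law[of 1]]
      by (simp add: prob_space)
  next
    case False
    then have "law t = distr (law 1) borel (\<lambda>x. t powr (1 / \<alpha>) * x)"
      using law_scaling[of t 1] t by simp
    then have "char (law t) \<theta> = (CLINT x|law 1. iexp (\<theta> * (t powr (1 / \<alpha>) * x)))"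
      by (simp add: char_def integral_distr)
    then show ?thesis by (simp add: char_def mult_ac)
  qed
qed

text \<open>Self-similarity reduces weak continuity of the laws in time to continuity of the
  characteristic function of \<open>B 1\<close>.\<close>

lemma char_law_tendsto:
  assumes "w \<longlonglongrightarrow> v" "\<And>n. w n \<ge> 0" "v \<ge> 0"
  shows "(\<lambda>n. char (law (w n)) \<theta>) \<longlonglongrightarrow> char (law v) \<theta>"
proof -
  interpret L: real_distribution "law 1" by (rule real_distribution_law) simp
  have "(\<lambda>n. w n powr (1 / \<alpha>) * \<theta>) \<longlonglongrightarrow> v powr (1 / \<alpha>) * \<theta>"
    using assms \<alpha>_pos by (intro tendsto_intros) auto
  then have "(\<lambda>n. char (law 1) (w n powr (1 / \<alpha>) * \<theta>)) \<longlonglongrightarrow> char (law 1) (v powr (1 / \<alpha>) * \<theta>)"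
    by (rule isCont_tendsto_compose[OF L.isCont_char])
  then show ?thesis unfolding char_law[OF assms(2)] char_law[OF assms(3)] .
qed

text \<open>By self-similarity the weight \<open>a i\<close> acts as the factor
  \<open>a i powr \<alpha>\<close> on the elapsed time, and independent pieces add their times.
  Measurability and the order of the times are carried along because the induction step uses
  them.\<close>

lemma indep_law_weighted_sum:
  assumes \<tau>: "0 \<le> \<tau> 0" "\<And>i. i < k \<Longrightarrow> \<tau> i \<le> \<tau> (Suc i)" and a: "\<And>i. i < k \<Longrightarrow> a i > 0"
  shows "indep_law M (F (\<tau> 0)) (\<lambda>\<omega>. \<Sum>i<k. a i * (B (\<tau> (Suc i)) \<omega> - B (\<tau> i) \<omega>))
      (law (\<Sum>i<k. a i powr \<alpha> * (\<tau> (Suc i) - \<tau> i))) \<and>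
    (\<lambda>\<omega>. \<Sum>i<k. a i * (B (\<tau> (Suc i)) \<omega> - B (\<tau> i) \<omega>)) \<in> borel_measurable (F (\<tau> k)) \<and>
    \<tau> 0 \<le> \<tau> k"
  using assms
proof (induction k)
  case 0
  then show ?case using B_indep_law[of "\<tau> 0" "\<tau> 0"] by simp
next
  case (Suc k)
  define Z1 where "Z1 = (\<lambda>\<omega>. \<Sum>i<k. a i * (B (\<tau> (Suc i)) \<omega> - B (\<tau> i) \<omega>))"
  define w where "w = (\<Sum>i<k. a i powr \<alpha> * (\<tau> (Suc i) - \<tau> i))"
  have IH: "indep_law M (F (\<tau> 0)) Z1 (law w)" "Z1 \<in> borel_measurable (F (\<tau> k))" "\<tau> 0 \<le> \<tau> k"
    using Suc by (auto simp: Z1_def w_def)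
  have k: "0 \<le> \<tau> k" "\<tau> k \<le> \<tau> (Suc k)" "a k > 0" using IH Suc.prems by auto
  have w: "w \<ge> 0" unfolding w_def using Suc.prems by (intro sum_nonneg) auto
  have Z2: "indep_law M (F (\<tau> k)) (\<lambda>\<omega>. a k * (B (\<tau> (Suc k)) \<omega> - B (\<tau> k) \<omega>)) (law (a k powr \<alpha> * (\<tau> (Suc k) - \<tau> k)))"
    using indep_law_scale[OF B_indep_law[OF k(1,2)], of "a k"] law_scaling'[OF k(3), of "\<tau> (Suc k) - \<tau> k"] k by simp
  have "indep_law M (F (\<tau> 0)) (\<lambda>\<omega>. Z1 \<omega> + a k * (B (\<tau> (Suc k)) \<omega> - B (\<tau> k) \<omega>))
      (law w \<star> law (a k powr \<alpha> * (\<tau> (Suc k) - \<tau> k)))"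
    by (rule indep_law_add[OF prob_space_axioms subalgebra subalgebra sets_F_mono[OF IH(3)] IH(1,2) Z2])
  also have "(law w \<star> law (a k powr \<alpha> * (\<tau> (Suc k) - \<tau> k))) = law (w + a k powr \<alpha> * (\<tau> (Suc k) - \<tau> k))"
    using w k by (intro law_add) auto
  finally have 1: "indep_law M (F (\<tau> 0)) (\<lambda>\<omega>. Z1 \<omega> + a k * (B (\<tau> (Suc k)) \<omega> - B (\<tau> k) \<omega>))
      (law (w + a k powr \<alpha> * (\<tau> (Suc k) - \<tau> k)))" .
  have "Z1 \<in> borel_measurable (F (\<tau> (Suc k)))"
    using IH(2) sets_F_mono[OF k(2)] by (auto simp: measurable_def space_F)
  then have "(\<lambda>\<omega>. Z1 \<omega> + a k * (B (\<tau> (Suc k)) \<omega> - B (\<tau> k) \<omega>)) \<in> borel_measurable (F (\<tau> (Suc k)))"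
    using k by (intro borel_measurable_add borel_measurable_times borel_measurable_diff B_adapted_le) auto
  with 1 IH(3) k show ?case by (simp add: Z1_def w_def)
qed

text \<open>For \<open>s > 0\<close> this is the integral of \<open>u powr (- \<gamma>)\<close>
  against \<open>dB u\<close> over \<open>{s..t}\<close> after integration by parts; in this form it
  makes sense for every cadlag path.\<close>

definition weighted_increment :: "real \<Rightarrow> real \<Rightarrow> real \<Rightarrow> 'a \<Rightarrow> real" where
  "weighted_increment \<gamma> s t \<omega> = t powr (- \<gamma>) * B t \<omega> - s powr (- \<gamma>) * B s \<omega> +
     \<gamma> * integral {s..t} (\<lambda>u. u powr (- \<gamma> - 1) * B u \<omega>)"

text \<open>The Riemann sums \<open>Z n\<close> have the law of \<open>B\<close> at time
  \<open>w n\<close>, and both converge: the sums pathwise after Abel summation, the times to the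
  integral of \<open>u powr (\<rho> - 1)\<close>, because
  \<open>- \<gamma> * \<alpha> = \<rho> - 1\<close>.\<close>

lemma weighted_increment:
  assumes s: "0 < s" "s \<le> t" and \<rho>: "\<rho> = 1 - \<alpha> * \<gamma>" "\<rho> > 0"
  shows "indep_law M (F s) (weighted_increment \<gamma> s t) (law ((t powr \<rho> - s powr \<rho>) / \<rho>))"
    and "weighted_increment \<gamma> s t \<in> borel_measurable (F t)"
proof -
  define \<tau> where "\<tau> n i = s + real i * ((t - s) / real (Suc n))" for n i
  have \<tau>0: "\<tau> n 0 = s" for n by (simp add: \<tau>_def)
  have \<tau>_last: "\<tau> n (Suc n) = t" for n by (simp add: \<tau>_def)
  have \<tau>_Suc: "\<tau> n (Suc i) - \<tau> n i = (t - s) / real (Suc n)" for n i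
    by (simp add: \<tau>_def distrib_right add_divide_distrib[symmetric] del: times_divide_eq_right)
  have \<tau>_mono: "\<tau> n i \<le> \<tau> n (Suc i)" for n i
  proof -
    have "(t - s) / real (Suc n) \<ge> 0" using s by (intro divide_nonneg_nonneg) auto
    then show ?thesis using \<tau>_Suc[of n i] by linarith
  qed
  have \<tau>_ge: "s \<le> \<tau> n i" for n i using s by (simp add: \<tau>_def)
  \<comment> \<open>The weights sit at left endpoints: Abel summation then evaluates
    \<open>B\<close> at right endpoints, as right continuity requires.\<close>
  define Z where "Z n \<omega> = (\<Sum>i<Suc n. \<tau> n i powr (- \<gamma>) * (B (\<tau> n (Suc i)) \<omega> - B (\<tau> n i) \<omega>))" for n \<omega>
  define w where "w n = (\<Sum>i<Suc n. (\<tau> n i powr (- \<gamma>)) powr \<alpha> * (\<tau> n (Suc i) - \<tau> n i))" for n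
  have Z: "indep_law M (F s) (Z n) (law (w n))" "Z n \<in> borel_measurable (F t)" for n
  proof -
    have "0 \<le> \<tau> n 0" "\<tau> n i powr (- \<gamma>) > 0" for i using \<tau>_ge[of n i] s by (auto simp: \<tau>0)
    note sum = indep_law_weighted_sum[where \<tau> = "\<tau> n" and k = "Suc n" and a = "\<lambda>i. \<tau> n i powr (- \<gamma>)",
      OF this(1) \<tau>_mono this(2), unfolded \<tau>0 \<tau>_last]
    have "Z n = (\<lambda>\<omega>. \<Sum>i<Suc n. \<tau> n i powr (- \<gamma>) * (B (\<tau> n (Suc i)) \<omega> - B (\<tau> n i) \<omega>))"
      by (rule ext) (rule Z_def)
    then show "indep_law M (F s) (Z n) (law (w n))" "Z n \<in> borel_measurable (F t)"
      using sum by (simp_all only: w_def)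
  qed
  have lim: "(\<lambda>n. Z n \<omega>) \<longlonglongrightarrow> weighted_increment \<gamma> s t \<omega>" if \<omega>: "\<omega> \<in> space M" for \<omega>
  proof -
    define a where "a u = u powr (- \<gamma>)" for u :: real
    obtain C where C: "\<And>u. u \<in> {s..t} \<Longrightarrow> \<bar>B u \<omega>\<bar> \<le> C"
      using cadlag_on_imp_bounded[OF B_cadlag[OF \<omega>] _ s(2)] s by auto
    have "(\<lambda>n. \<Sum>i<Suc n. B (\<tau> n (Suc i)) \<omega> * (a (\<tau> n (Suc i)) - a (\<tau> n i))) \<longlonglongrightarrow>
        integral {s..t} (\<lambda>u. B u \<omega> * (- \<gamma> * u powr (- \<gamma> - 1)))"
      unfolding \<tau>_def
    proof (rule right_Riemann_sums[OF s(2) _ C])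
      show "((\<lambda>u. B u \<omega>) \<longlongrightarrow> B u \<omega>) (at_right u)" if "u \<in> {s..t}" for u
        using that s \<omega> by (intro B_right) auto
      show "(a has_real_derivative - \<gamma> * u powr (- \<gamma> - 1)) (at u)" if "u \<in> {s..t}" for u
        unfolding a_def using that s by (intro has_real_derivative_powr) auto
      show "continuous_on {s..t} (\<lambda>u. - \<gamma> * u powr (- \<gamma> - 1))"
        using s by (intro continuous_intros) auto
    qed
    then have "(\<lambda>n. a t * B t \<omega> - a s * B s \<omega> - (\<Sum>i<Suc n. B (\<tau> n (Suc i)) \<omega> * (a (\<tau> n (Suc i)) - a (\<tau> n i)))) \<longlonglongrightarrow>
        a t * B t \<omega> - a s * B s \<omega> - integral {s..t} (\<lambda>u. B u \<omega> * (- \<gamma> * u powr (- \<gamma> - 1)))"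
      by (intro tendsto_intros)
    moreover have "a t * B t \<omega> - a s * B s \<omega> - (\<Sum>i<Suc n. B (\<tau> n (Suc i)) \<omega> * (a (\<tau> n (Suc i)) - a (\<tau> n i))) = Z n \<omega>" for n
    proof -
      have "(\<Sum>i<Suc n. a (\<tau> n (Suc i)) * B (\<tau> n (Suc i)) \<omega> - a (\<tau> n i) * B (\<tau> n i) \<omega>) = a t * B t \<omega> - a s * B s \<omega>"
        by (subst sum_lessThan_telescope) (simp add: \<tau>0 \<tau>_last)
      moreover have "Z n \<omega> = (\<Sum>i<Suc n. a (\<tau> n (Suc i)) * B (\<tau> n (Suc i)) \<omega> - a (\<tau> n i) * B (\<tau> n i) \<omega>) -
          (\<Sum>i<Suc n. B (\<tau> n (Suc i)) \<omega> * (a (\<tau> n (Suc i)) - a (\<tau> n i)))"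
        unfolding sum_subtractf[symmetric] Z_def a_def[symmetric] by (intro sum.cong) (auto simp: algebra_simps)
      ultimately show ?thesis by simp
    qed
    moreover have "integral {s..t} (\<lambda>u. B u \<omega> * (- \<gamma> * u powr (- \<gamma> - 1))) = - \<gamma> * integral {s..t} (\<lambda>u. u powr (- \<gamma> - 1) * B u \<omega>)"
    proof -
      have "(\<lambda>u. B u \<omega> * (- \<gamma> * u powr (- \<gamma> - 1))) = (\<lambda>u. - \<gamma> * (u powr (- \<gamma> - 1) * B u \<omega>))"
        by (simp only: mult_ac)
      then show ?thesis by (simp only: integral_mult_right)
    qed
    ultimately show ?thesis by (simp add: weighted_increment_def a_def)
  qed
  show m: "weighted_increment \<gamma> s t \<in> borel_measurable (F t)"
    by (rule borel_measurable_LIMSEQ_real[OF lim Z(2)]) (simp add: space_F)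
  have w_lim: "w \<longlonglongrightarrow> (t powr \<rho> - s powr \<rho>) / \<rho>"
  proof -
    define f where "f u = u powr (\<rho> - 1)" for u :: real
    have "compact (f ` {s..t})"
      unfolding f_def using s by (intro compact_continuous_image continuous_intros) auto
    then have "bounded (f ` {s..t})" by (rule compact_imp_bounded)
    then obtain C where C: "\<forall>x\<in>f ` {s..t}. norm x \<le> C" unfolding bounded_iff ..
    have "(\<lambda>n. \<Sum>i<Suc n. f (\<tau> n (Suc i)) * (\<tau> n (Suc i) - \<tau> n i)) \<longlonglongrightarrow> integral {s..t} (\<lambda>u. f u * 1)"
      unfolding \<tau>_def
    proof (rule right_Riemann_sums[OF s(2), where A = "\<lambda>u. u" and C = C])
      show "\<bar>f u\<bar> \<le> C" if "u \<in> {s..t}" for u using C that by auto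
      show "(f \<longlongrightarrow> f u) (at_right u)" if "u \<in> {s..t}" for u
        unfolding f_def using that s by (intro tendsto_intros) auto
    qed auto
    moreover have "((\<lambda>u. f u * 1) has_integral (t powr \<rho> / \<rho> - s powr \<rho> / \<rho>)) {s..t}"
    proof (rule fundamental_theorem_of_calculus[OF s(2)])
      fix u assume "u \<in> {s..t}"
      then have "u > 0" using s by auto
      then have "((\<lambda>u. u powr \<rho> / \<rho>) has_real_derivative \<rho> * u powr (\<rho> - 1) / \<rho>) (at u)"
        by (intro DERIV_cdivide has_real_derivative_powr)
      then show "((\<lambda>u. u powr \<rho> / \<rho>) has_vector_derivative f u * 1) (at u within {s..t})"
        using \<rho> by (simp add: f_def has_real_derivative_iff_has_vector_derivative[symmetric] has_field_derivative_at_within)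
    qed
    ultimately have "(\<lambda>n. \<Sum>i<Suc n. f (\<tau> n (Suc i)) * (\<tau> n (Suc i) - \<tau> n i)) \<longlonglongrightarrow> t powr \<rho> / \<rho> - s powr \<rho> / \<rho>"
      by (simp only: integral_unique)
    \<comment> \<open>\<open>w n\<close> uses left endpoints; its difference from the right-endpoint
      sum telescopes to this vanishing term.\<close>
    moreover have "(\<lambda>n. (t - s) * inverse (real (Suc n)) * (f s - f t)) \<longlonglongrightarrow> 0"
      by (intro tendsto_mult_left_zero tendsto_mult_right_zero LIMSEQ_inverse_real_of_nat)
    ultimately have "(\<lambda>n. (\<Sum>i<Suc n. f (\<tau> n (Suc i)) * (\<tau> n (Suc i) - \<tau> n i)) + (t - s) * inverse (real (Suc n)) * (f s - f t))
        \<longlonglongrightarrow> t powr \<rho> / \<rho> - s powr \<rho> / \<rho> + 0"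
      by (intro tendsto_add)
    moreover have "(\<Sum>i<Suc n. f (\<tau> n (Suc i)) * (\<tau> n (Suc i) - \<tau> n i)) + (t - s) * inverse (real (Suc n)) * (f s - f t) = w n" for n
    proof -
      define H where "H = (t - s) * inverse (real (Suc n))"
      have step: "\<tau> n (Suc i) - \<tau> n i = H" for i unfolding \<tau>_Suc H_def by (rule divide_inverse)
      have "(\<Sum>i<Suc n. f (\<tau> n i) - f (\<tau> n (Suc i))) = f s - f t"
        by (subst sum_lessThan_telescope') (simp only: \<tau>0 \<tau>_last)
      then have "H * (f s - f t) = (\<Sum>i<Suc n. H * (f (\<tau> n i) - f (\<tau> n (Suc i))))"
        by (simp only: sum_distrib_left[symmetric])
      moreover have "- \<gamma> * \<alpha> = \<rho> - 1" using \<rho>(1) by simp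
      then have "(\<tau> n i powr (- \<gamma>)) powr \<alpha> = f (\<tau> n i)" for i
        by (simp only: powr_powr f_def)
      then have "w n = (\<Sum>i<Suc n. f (\<tau> n i) * H)" by (simp only: w_def step)
      moreover have "(\<Sum>i<Suc n. f (\<tau> n (Suc i)) * H) + (\<Sum>i<Suc n. H * (f (\<tau> n i) - f (\<tau> n (Suc i)))) = (\<Sum>i<Suc n. f (\<tau> n i) * H)"
        unfolding sum.distrib[symmetric] by (intro sum.cong refl) (simp add: algebra_simps)
      ultimately show ?thesis by (simp only: step H_def[symmetric])
    qed
    ultimately show ?thesis by (simp add: diff_divide_distrib)
  qed
  have w0: "w n \<ge> 0" for n unfolding w_def using \<tau>_mono[of n] by (intro sum_nonneg mult_nonneg_nonneg) auto
  have v0: "(t powr \<rho> - s powr \<rho>) / \<rho> \<ge> 0" using s \<rho> by (intro divide_nonneg_pos) (auto intro: powr_mono2)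
  show "indep_law M (F s) (weighted_increment \<gamma> s t) (law ((t powr \<rho> - s powr \<rho>) / \<rho>))"
    by (rule indep_law_limit[OF prob_space_axioms subalgebra Z(1) measurable_from_subalg[OF subalgebra m] _
          real_distribution_law[OF v0] char_law_tendsto[OF w_lim w0 v0]])
      (use lim in \<open>intro AE_I2\<close>)
qed


section \<open>The integral from time zero, its law and its paths\<close>

text \<open>A limit along a fixed sequence of lower endpoints instead of an integral over
  \<open>{0..t}\<close>: adaptedness is then inherited from \<open>weighted_increment\<close>. The
  minimum with \<open>t\<close> keeps the lower endpoint inside the interval.\<close>

definition stable_integral :: "real \<Rightarrow> real \<Rightarrow> 'a \<Rightarrow> real" where
  "stable_integral \<gamma> t \<omega> =
     (if t \<le> 0 then 0 else lim (\<lambda>n. weighted_increment \<gamma> (min t (inverse (real (Suc n)))) t \<omega>))"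

text \<open>The boundary term at the lower endpoint \<open>s\<close> is at most
  \<open>C * s powr (e - \<gamma>)\<close> and vanishes with \<open>s\<close>; the integral
  converges by continuity of its primitive at 0.\<close>

lemma weighted_increment_tendsto:
  assumes \<omega>: "\<omega> \<in> space M" and d: "d > 0" and growth: "\<forall>t. 0 < t \<and> t \<le> d \<longrightarrow> \<bar>B t \<omega>\<bar> \<le> C * t powr e"
    and e: "\<gamma> < e" and t: "t > 0"
  shows "(\<lambda>n. weighted_increment \<gamma> (min t (inverse (real (Suc n)))) t \<omega>) \<longlonglongrightarrow>
    t powr (- \<gamma>) * B t \<omega> + \<gamma> * integral {0..t} (\<lambda>u. u powr (- \<gamma> - 1) * B u \<omega>)"
proof -
  define g where "g u = u powr (- \<gamma> - 1) * B u \<omega>" for u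
  note int = singular_integral[OF B_cadlag[OF \<omega>] d growth e, folded g_def]
  define s where "s n = min t (inverse (real (Suc n)))" for n
  have s: "0 < s n" "s n \<le> t" for n using t by (auto simp: s_def)
  have "s \<longlonglongrightarrow> min t 0" unfolding s_def by (intro tendsto_min tendsto_const LIMSEQ_inverse_real_of_nat)
  then have s0: "s \<longlonglongrightarrow> 0" using t by simp
  have "((\<lambda>t. integral {0..t} g) \<longlongrightarrow> integral {0..0} g) (at 0 within {0..})"
    using int(2) unfolding continuous_on_def by (metis atLeast_iff order_refl)
  then have "continuous (at 0 within {0..}) (\<lambda>t. integral {0..t} g)" by (simp add: continuous_within)
  then have "(\<lambda>n. integral {0..s n} g) \<longlonglongrightarrow> integral {0..0} g"
    using s s0 by (simp add: continuous_within_sequentially o_def less_imp_le)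
  then have I0: "(\<lambda>n. integral {0..s n} g) \<longlonglongrightarrow> 0" by simp
  have "(\<lambda>n. C * s n powr (e - \<gamma>)) \<longlonglongrightarrow> C * 0 powr (e - \<gamma>)"
    using e s by (intro tendsto_intros s0) (auto simp: less_imp_le)
  then have C0: "(\<lambda>n. C * s n powr (e - \<gamma>)) \<longlonglongrightarrow> 0" by simp
  have B0: "(\<lambda>n. s n powr (- \<gamma>) * B (s n) \<omega>) \<longlonglongrightarrow> 0"
  proof (rule Lim_null_comparison[OF _ C0])
    have "eventually (\<lambda>n. s n < d) sequentially" using s0 d by (intro order_tendstoD) auto
    then show "eventually (\<lambda>n. norm (s n powr (- \<gamma>) * B (s n) \<omega>) \<le> C * s n powr (e - \<gamma>)) sequentially"
    proof eventually_elim
      case (elim n)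
      have "norm (s n powr (- \<gamma>) * B (s n) \<omega>) = s n powr (- \<gamma>) * \<bar>B (s n) \<omega>\<bar>" by (simp add: abs_mult)
      also have "\<dots> \<le> s n powr (- \<gamma>) * (C * s n powr e)"
        using elim s[of n] by (intro mult_left_mono growth[rule_format]) auto
      also have "\<dots> = C * s n powr (e - \<gamma>)" using s[of n] by (simp add: powr_diff powr_minus field_simps)
      finally show ?case .
    qed
  qed
  have eq: "weighted_increment \<gamma> (s n) t \<omega> = t powr (- \<gamma>) * B t \<omega> - s n powr (- \<gamma>) * B (s n) \<omega> +
      \<gamma> * (integral {0..t} g - integral {0..s n} g)" for n
  proof -
    have "integral {0..s n} g + integral {s n..t} g = integral {0..t} g"
      using s[of n] int(1)[of t] by (intro Henstock_Kurzweil_Integration.integral_combine) auto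
    moreover have "(\<lambda>u. u powr (- \<gamma> - 1) * B u \<omega>) = g" by (simp add: g_def fun_eq_iff)
    ultimately show ?thesis unfolding weighted_increment_def by (simp only:) (simp flip: \<open>_ = integral {0..t} g\<close>)
  qed
  have "(\<lambda>n. weighted_increment \<gamma> (s n) t \<omega>) \<longlonglongrightarrow> t powr (- \<gamma>) * B t \<omega> - 0 + \<gamma> * (integral {0..t} g - 0)"
    unfolding eq by (intro tendsto_intros I0 B0)
  then show ?thesis by (simp add: s_def g_def[abs_def])
qed

lemma stable_integral_eq:
  assumes "\<omega> \<in> space M" "d > 0" "\<forall>t. 0 < t \<and> t \<le> d \<longrightarrow> \<bar>B t \<omega>\<bar> \<le> C * t powr e" "\<gamma> < e" "t > 0"
  shows "stable_integral \<gamma> t \<omega> =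
    t powr (- \<gamma>) * B t \<omega> + \<gamma> * integral {0..t} (\<lambda>u. u powr (- \<gamma> - 1) * B u \<omega>)"
  using limI[OF weighted_increment_tendsto[OF assms]] \<open>t > 0\<close> by (simp add: stable_integral_def)

lemma stable_integral_increment:
  assumes \<omega>: "\<omega> \<in> space M" and d: "d > 0" and growth: "\<forall>t. 0 < t \<and> t \<le> d \<longrightarrow> \<bar>B t \<omega>\<bar> \<le> C * t powr e"
    and e: "\<gamma> < e" and s: "0 < s" "s \<le> t"
  shows "stable_integral \<gamma> t \<omega> - stable_integral \<gamma> s \<omega> = weighted_increment \<gamma> s t \<omega>"
proof -
  have split: "integral {0..s} (\<lambda>u. u powr (- \<gamma> - 1) * B u \<omega>) + integral {s..t} (\<lambda>u. u powr (- \<gamma> - 1) * B u \<omega>) =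
      integral {0..t} (\<lambda>u. u powr (- \<gamma> - 1) * B u \<omega>)"
    using s singular_integral(1)[OF B_cadlag[OF \<omega>] d growth e, of t]
    by (intro Henstock_Kurzweil_Integration.integral_combine) auto
  have "t > 0" using s by simp
  note eq_t = stable_integral_eq[OF \<omega> d growth e this] and eq_s = stable_integral_eq[OF \<omega> d growth e s(1)]
  have "\<gamma> * integral {0..t} (\<lambda>u. u powr (- \<gamma> - 1) * B u \<omega>) = \<gamma> * integral {0..s} (\<lambda>u. u powr (- \<gamma> - 1) * B u \<omega>) +
      \<gamma> * integral {s..t} (\<lambda>u. u powr (- \<gamma> - 1) * B u \<omega>)"
    by (simp only: split[symmetric] distrib_left)
  then show ?thesis using eq_t eq_s by (simp only: weighted_increment_def)
qed

lemma stable_integral_adapted: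
  assumes \<rho>: "1 - \<alpha> * \<gamma> > 0" and t: "t \<ge> 0"
  shows "stable_integral \<gamma> t \<in> borel_measurable (F t)"
proof (cases "t = 0")
  case False
  with t have "t > 0" by simp
  have "weighted_increment \<gamma> (min t (inverse (real (Suc n)))) t \<in> borel_measurable (F t)" for n
    using \<open>t > 0\<close> by (intro weighted_increment(2)[OF _ _ refl \<rho>]) auto
  then have "(\<lambda>\<omega>. lim (\<lambda>n. weighted_increment \<gamma> (min t (inverse (real (Suc n)))) t \<omega>)) \<in> borel_measurable (F t)"
    by (rule borel_measurable_lim_metric)
  then show ?thesis using \<open>t > 0\<close> by (simp add: stable_integral_def[abs_def])
qed (simp add: stable_integral_def[abs_def])

text \<open>Both processes have independent increments, and between \<open>s\<close> and
  \<open>t\<close> both increments have the law of \<open>B\<close> at time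
  \<open>(t powr \<rho> - s powr \<rho>) / \<rho>\<close>.\<close>

lemma stable_integral_law:
  assumes \<rho>: "\<rho> = 1 - \<alpha> * \<gamma>" "\<rho> > 0"
  shows "distr M (Pi\<^sub>M {0..} (\<lambda>_. borel)) (\<lambda>\<omega>. \<lambda>t\<in>{0..}. stable_integral \<gamma> t \<omega>) =
    distr M (Pi\<^sub>M {0..} (\<lambda>_. borel)) (\<lambda>\<omega>. \<lambda>t\<in>{0..}. B (t powr \<rho> / \<rho>) \<omega>)"
\<comment> \<open>The maximum with 0 makes the time-changed filtration monotone on the whole real
  line, as \<open>filtration\<close> demands.\<close>
proof (rule distr_eq_of_indep_increments[where F = F and F' = "\<lambda>t. F (max 0 t powr \<rho> / \<rho>)" and
    \<nu> = "\<lambda>s t. law ((t powr \<rho> - s powr \<rho>) / \<rho>)"])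
  \<comment> \<open>A growth exponent strictly between \<gamma> and 1 / \<alpha>, positive also when
    \<gamma> is negative.\<close>
  define e where "e = (max 0 \<gamma> + 1 / \<alpha>) / 2"
  have "\<gamma> < 1 / \<alpha>" using \<rho> \<alpha>_pos by (simp add: field_simps)
  moreover have "1 / \<alpha> > 0" using \<alpha>_pos by simp
  moreover have avg: "a < (a + b) / 2 \<and> (a + b) / 2 < b" if "a < b" for a b :: real
    using that by (simp add: field_simps)
  ultimately have e: "0 < e" "\<gamma> < e" "e < 1 / \<alpha>"
    using avg[of "max 0 \<gamma>" "1 / \<alpha>"] by (auto simp only: e_def max_less_iff_conj)
  note good = AE_growth_at_0[OF e(1,3)]
  have J_meas: "stable_integral \<gamma> t \<in> borel_measurable M" if "t \<ge> 0" for t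
    using measurable_from_subalg[OF subalgebra stable_integral_adapted] \<rho> that by simp
  have mono: "s powr \<rho> \<le> t powr \<rho>" if "0 \<le> s" "s \<le> t" for s t using that \<rho> by (intro powr_mono2) auto
  show "indep_law M (F s) (\<lambda>\<omega>. stable_integral \<gamma> t \<omega> - stable_integral \<gamma> s \<omega>) (law ((t powr \<rho> - s powr \<rho>) / \<rho>))"
    if st: "0 \<le> s" "s \<le> t" for s t
  proof -
    have v0: "(t powr \<rho> - s powr \<rho>) / \<rho> \<ge> 0" using mono[OF st] \<rho> by (intro divide_nonneg_pos) auto
    have Lm: "(\<lambda>\<omega>. stable_integral \<gamma> t \<omega> - stable_integral \<gamma> s \<omega>) \<in> borel_measurable M"
      using st by (intro borel_measurable_diff J_meas) auto
    consider "s > 0" | "s = 0" "t > 0" | "s = 0" "t = 0" using st by linarith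
    then show ?thesis
    proof cases
      case 1
      show ?thesis
      \<comment> \<open>The limit lemma with a constant sequence transfers the law along an almost
        sure equality.\<close>
      proof (rule indep_law_limit[OF prob_space_axioms subalgebra, where Z = "\<lambda>_. weighted_increment \<gamma> s t" and
            \<nu> = "\<lambda>_. law ((t powr \<rho> - s powr \<rho>) / \<rho>)"])
        show "AE \<omega> in M. (\<lambda>n. weighted_increment \<gamma> s t \<omega>) \<longlonglongrightarrow> stable_integral \<gamma> t \<omega> - stable_integral \<gamma> s \<omega>"
          using good AE_space
        proof eventually_elim
          case (elim \<omega>)
          then show ?case using stable_integral_increment[OF elim(2) _ _ e(2) 1 st(2)] by force
        qed
      qed (use weighted_increment(1)[OF 1 st(2) \<rho>] Lm real_distribution_law[OF v0] in auto)
    next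
      case 2
      \<comment> \<open>The increment from time 0 is the limit of those from \<open>u n\<close>,
        which are independent of \<open>F (u n)\<close> and so of the smaller
        \<open>F 0\<close>.\<close>
      define u where "u n = min t (inverse (real (Suc n)))" for n
      have u: "0 < u n" "u n \<le> t" for n using 2 by (auto simp: u_def)
      have "u \<longlonglongrightarrow> min t 0" unfolding u_def by (intro tendsto_min tendsto_const LIMSEQ_inverse_real_of_nat)
      then have u0: "u \<longlonglongrightarrow> 0" using 2 by simp
      have ind: "indep_law M (F s) (weighted_increment \<gamma> (u n) t) (law ((t powr \<rho> - u n powr \<rho>) / \<rho>))" for n
      proof -
        have "sets (F s) \<subseteq> sets (F (u n))" using u[of n] 2 by (intro sets_F_mono) auto
        then show ?thesis using weighted_increment(1)[OF u \<rho>, of n] unfolding indep_law_def by blast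
      qed
      show ?thesis
      proof (rule indep_law_limit[OF prob_space_axioms subalgebra ind Lm])
        show "AE \<omega> in M. (\<lambda>n. weighted_increment \<gamma> (u n) t \<omega>) \<longlonglongrightarrow> stable_integral \<gamma> t \<omega> - stable_integral \<gamma> s \<omega>"
          using good AE_space
        proof eventually_elim
          case (elim \<omega>)
          then obtain C d where d: "d > 0" "\<forall>t. 0 < t \<and> t \<le> d \<longrightarrow> \<bar>B t \<omega>\<bar> \<le> C * t powr e" by blast
          show ?case
            using weighted_increment_tendsto[OF elim(2) d e(2) 2(2)] stable_integral_eq[OF elim(2) d e(2) 2(2)] 2
            by (simp add: u_def stable_integral_def[of \<gamma> 0])
        qed
        have "(\<lambda>n. (t powr \<rho> - u n powr \<rho>) / \<rho>) \<longlonglongrightarrow> (t powr \<rho> - 0 powr \<rho>) / \<rho>"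
          using \<rho> u by (intro tendsto_intros u0) (auto simp: less_imp_le)
        then have "(\<lambda>n. (t powr \<rho> - u n powr \<rho>) / \<rho>) \<longlonglongrightarrow> (t powr \<rho> - s powr \<rho>) / \<rho>"
          by (simp only: 2(1))
        moreover have "0 \<le> (t powr \<rho> - u n powr \<rho>) / \<rho>" for n
          using mono[of "u n" t] u[of n] \<rho> by (intro divide_nonneg_pos) auto
        ultimately show "(\<lambda>n. char (law ((t powr \<rho> - u n powr \<rho>) / \<rho>)) \<theta>) \<longlonglongrightarrow> char (law ((t powr \<rho> - s powr \<rho>) / \<rho>)) \<theta>" for \<theta>
          by (rule char_law_tendsto[OF _ _ v0])
      qed (rule real_distribution_law[OF v0])
    next
      case 3
      then show ?thesis using B_indep_law[of 0 0] by (simp add: stable_integral_def)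
    qed
  qed
  show "filtration (space M) (\<lambda>t. F (max 0 t powr \<rho> / \<rho>))"
    unfolding filtration_def
  proof (intro conjI allI impI)
    fix s t :: real assume "s \<le> t"
    then have "max 0 s powr \<rho> / \<rho> \<le> max 0 t powr \<rho> / \<rho>"
      using \<rho> by (intro divide_right_mono mono) auto
    then show "sets (F (max 0 s powr \<rho> / \<rho>)) \<subseteq> sets (F (max 0 t powr \<rho> / \<rho>))" by (rule sets_F_mono)
  qed (simp add: space_F)
  show "B (t powr \<rho> / \<rho>) \<in> borel_measurable (F (max 0 t powr \<rho> / \<rho>))" if "t \<ge> 0" for t
    using that \<rho> by (auto intro!: B_adapted)
  show "indep_law M (F (max 0 s powr \<rho> / \<rho>)) (\<lambda>\<omega>. B (t powr \<rho> / \<rho>) \<omega> - B (s powr \<rho> / \<rho>) \<omega>) (law ((t powr \<rho> - s powr \<rho>) / \<rho>))"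
    if "0 \<le> s" "s \<le> t" for s t
    using B_indep_law[of "s powr \<rho> / \<rho>" "t powr \<rho> / \<rho>"] mono[OF that] that \<rho> by (simp add: divide_right_mono diff_divide_distrib)
  show "distr M borel (stable_integral \<gamma> 0) = distr M borel (B (0 powr \<rho> / \<rho>))"
    using \<rho> by (intro distr_cong) (auto simp: stable_integral_def B_0)
qed (use prob_space_axioms filtration subalgebra stable_integral_adapted \<rho> in auto)

text \<open>Here \<open>w t\<close> is \<open>\<gamma> * t powr \<gamma>\<close> times the integral
  of \<open>u powr (- \<gamma> - 1) * B u\<close> over \<open>{0..t}\<close>, so the product rule
  gives the Euler equation forced by \<open>B\<close>. As \<open>w\<close> is continuous,
  \<open>t powr \<gamma> * stable_integral \<gamma> t\<close> has exactly the jumps of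
  \<open>B\<close>, which makes the final remainder continuous.\<close>

lemma AE_stable_integral_path:
  assumes \<rho>: "1 - \<alpha> * \<gamma> > 0"
  shows "AE \<omega> in M. \<exists>w. (\<forall>t>0. t powr \<gamma> * stable_integral \<gamma> t \<omega> = B t \<omega> + w t) \<and> continuous_on {0<..} w \<and>
    (\<forall>t>0. (w has_real_derivative \<gamma> * (w t + B t \<omega>) / t) (at_right t)) \<and> (w \<longlongrightarrow> 0) (at_right 0)"
proof -
  define e where "e = (max 0 \<gamma> + 1 / \<alpha>) / 2"
  have "\<gamma> < 1 / \<alpha>" using \<rho> \<alpha>_pos by (simp add: field_simps)
  moreover have "1 / \<alpha> > 0" using \<alpha>_pos by simp
  moreover have avg: "a < (a + b) / 2 \<and> (a + b) / 2 < b" if "a < b" for a b :: real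
    using that by (simp add: field_simps)
  ultimately have e: "0 < e" "\<gamma> < e" "e < 1 / \<alpha>"
    using avg[of "max 0 \<gamma>" "1 / \<alpha>"] by (auto simp only: e_def max_less_iff_conj)
  show ?thesis using AE_growth_at_0[OF e(1,3)] AE_space
  proof eventually_elim
    case (elim \<omega>)
    then obtain C d where d: "d > 0" "\<forall>t. 0 < t \<and> t \<le> d \<longrightarrow> \<bar>B t \<omega>\<bar> \<le> C * t powr e" by blast
    define g where "g u = u powr (- \<gamma> - 1) * B u \<omega>" for u
    note int = singular_integral[OF B_cadlag[OF elim(2)] d e(2), folded g_def]
    define w where "w t = \<gamma> * (t powr \<gamma> * integral {0..t} g)" for t
    show ?case
    proof (intro exI[of _ w] conjI allI impI)
      fix t :: real assume t: "t > 0"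
      have "t powr \<gamma> * t powr (- \<gamma>) = 1" using t by (simp flip: powr_add)
      then show "t powr \<gamma> * stable_integral \<gamma> t \<omega> = B t \<omega> + w t"
        using stable_integral_eq[OF elim(2) d e(2) t] by (simp add: w_def g_def[abs_def] algebra_simps)
      have "(w has_real_derivative \<gamma> * (\<gamma> * t powr (\<gamma> - 1) * integral {0..t} g + t powr (- \<gamma> - 1) * B t \<omega> * t powr \<gamma>)) (at_right t)"
      proof -
        have "((\<lambda>t. integral {0..t} g) has_real_derivative t powr (- \<gamma> - 1) * B t \<omega>) (at_right t)"
          using int(3)[OF t] unfolding g_def[of t] .
        from DERIV_cmult[OF DERIV_mult[OF has_field_derivative_at_within[OF has_real_derivative_powr[OF t]] this], of \<gamma>]
        show ?thesis by (simp only: w_def[abs_def])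
      qed
      also have "\<gamma> * (\<gamma> * t powr (\<gamma> - 1) * integral {0..t} g + t powr (- \<gamma> - 1) * B t \<omega> * t powr \<gamma>) = \<gamma> * (w t + B t \<omega>) / t"
      proof -
        have "t powr (- \<gamma> - 1) * t powr \<gamma> = 1 / t" "t powr (\<gamma> - 1) = t powr \<gamma> / t"
          using t by (simp_all add: powr_diff powr_minus)
        then have "t powr (- \<gamma> - 1) * B t \<omega> * t powr \<gamma> = B t \<omega> / t" by (simp add: mult_ac)
        then show ?thesis using \<open>t powr (\<gamma> - 1) = t powr \<gamma> / t\<close> by (simp add: w_def add_divide_distrib algebra_simps)
      qed
      finally show "(w has_real_derivative \<gamma> * (w t + B t \<omega>) / t) (at_right t)" .
    next
      have "continuous_on {0<..} (\<lambda>t. integral {0..t} g)" by (rule continuous_on_subset[OF int(2)]) auto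
      then show "continuous_on {0<..} w" unfolding w_def by (intro continuous_intros) auto
    next
      show "(w \<longlongrightarrow> 0) (at_right 0)"
      proof (rule Lim_null_comparison)
        have "eventually (\<lambda>t. 0 < t \<and> t < d) (at_right 0)" using d(1) by (auto simp: eventually_at_right_field)
        then show "eventually (\<lambda>t. norm (w t) \<le> \<bar>\<gamma>\<bar> * C / (e - \<gamma>) * t powr e) (at_right 0)"
        proof eventually_elim
          case (elim t)
          have "norm (w t) = \<bar>\<gamma>\<bar> * (t powr \<gamma> * \<bar>integral {0..t} g\<bar>)" by (simp add: w_def abs_mult)
          also have "\<dots> \<le> \<bar>\<gamma>\<bar> * (t powr \<gamma> * (C * t powr (e - \<gamma>) / (e - \<gamma>)))"
            using elim by (intro mult_left_mono int(4)) auto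
          also have "t powr \<gamma> * (C * t powr (e - \<gamma>) / (e - \<gamma>)) = C / (e - \<gamma>) * (t powr \<gamma> * t powr (e - \<gamma>))" by simp
          also have "t powr \<gamma> * t powr (e - \<gamma>) = t powr e" by (simp flip: powr_add)
          finally show ?case by simp
        qed
        have "((\<lambda>t. \<bar>\<gamma>\<bar> * C / (e - \<gamma>) * t powr e) \<longlongrightarrow> \<bar>\<gamma>\<bar> * C / (e - \<gamma>) * 0 powr e) (at_right 0)"
          using e eventually_at_right_less[of "0::real"] by (intro tendsto_intros) (auto elim!: eventually_mono)
        then show "((\<lambda>t. \<bar>\<gamma>\<bar> * C / (e - \<gamma>) * t powr e) \<longlongrightarrow> 0) (at_right 0)" by simp
      qed
    qed
  qed
qed

end

section \<open>Convergence in distribution from continuous perturbations\<close>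

text \<open>Bernstein form on \<open>{0..Suc N}\<close> with rational coefficients. The indices
  range over countable types, so conditions imposed for all of these functions stay
  measurable.\<close>

definition rational_polynomial :: "nat \<Rightarrow> rat list \<Rightarrow> real \<Rightarrow> real" where
  "rational_polynomial N qs t =
     (\<Sum>k\<le>length qs - 1. of_rat (qs ! k) * Bernstein (length qs - 1) k (t / real (Suc N)))"

lemma continuous_on_rational_polynomial: "continuous_on A (rational_polynomial N qs)"
  unfolding rational_polynomial_def[abs_def] Bernstein_def by (intro continuous_intros) auto

text \<open>Bernstein approximation followed by rounding of the coefficients: the Bernstein weights
  are non-negative and sum to 1, so the polynomial changes by no more than the coefficients
  do.\<close>

lemma rational_polynomial_approximation:
  fixes z :: "real \<Rightarrow> real"
  assumes z: "continuous_on {l..u} z" and lu: "0 \<le> l" "l \<le> u" "u \<le> real (Suc N)" and e: "\<epsilon> > 0"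
  obtains qs where "\<And>t. t \<in> {l..u} \<Longrightarrow> \<bar>z t - rational_polynomial N qs t\<bar> < \<epsilon>"
proof -
  define c where "c = real (Suc N)"
  have c: "c > 0" "u \<le> c" using lu by (auto simp: c_def)
  \<comment> \<open>\<open>z\<close> is extended by constants outside \<open>{l..u}\<close> and
    rescaled to the unit interval.\<close>
  define f where "f x = z (max l (min u (c * x)))" for x
  have "continuous_on {0..1} f" unfolding f_def
    by (rule continuous_on_compose2[OF z]) (use lu in \<open>auto intro!: continuous_intros\<close>)
  from Bernstein_Weierstrass[OF this, of "\<epsilon> / 2"] e
  obtain n where n: "\<And>x. x \<in> {0..1} \<Longrightarrow> \<bar>f x - (\<Sum>k\<le>n. f (real k / real n) * Bernstein n k x)\<bar> < \<epsilon> / 2"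
    by (metis half_gt_zero order_refl)
  have "\<exists>q :: rat. \<bar>f (real k / real n) - of_rat q\<bar> < \<epsilon> / 2" for k
  proof -
    obtain q where "f (real k / real n) - \<epsilon> / 2 < of_rat q" "of_rat q < f (real k / real n) + \<epsilon> / 2"
      using of_rat_dense[of "f (real k / real n) - \<epsilon> / 2" "f (real k / real n) + \<epsilon> / 2"] e by auto
    then show ?thesis by (intro exI[of _ q]) (simp only: abs_less_iff, linarith)
  qed
  then obtain q :: "nat \<Rightarrow> rat" where q: "\<And>k. \<bar>f (real k / real n) - of_rat (q k)\<bar> < \<epsilon> / 2" by metis
  define qs where "qs = map q [0..<Suc n]"
  have qs: "length qs - 1 = n" "\<And>k. k \<le> n \<Longrightarrow> qs ! k = q k"
    by (auto simp: qs_def simp del: upt_Suc)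
  have "\<bar>z t - rational_polynomial N qs t\<bar> < \<epsilon>" if t: "t \<in> {l..u}" for t
  proof -
    define x where "x = t / c"
    have x: "x \<in> {0..1}" using t lu c by (auto simp: x_def)
    have fx: "f x = z t" using t c by (simp add: f_def x_def)
    have p: "rational_polynomial N qs t = (\<Sum>k\<le>n. of_rat (q k) * Bernstein n k x)"
      unfolding rational_polynomial_def qs(1) x_def c_def by (intro sum.cong) (auto simp: qs(2))
    have "\<bar>(\<Sum>k\<le>n. f (real k / real n) * Bernstein n k x) - (\<Sum>k\<le>n. of_rat (q k) * Bernstein n k x)\<bar>
        = \<bar>\<Sum>k\<le>n. (f (real k / real n) - of_rat (q k)) * Bernstein n k x\<bar>"
      by (simp add: sum_subtractf left_diff_distrib)
    also have "\<dots> \<le> (\<Sum>k\<le>n. \<epsilon> / 2 * Bernstein n k x)"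
    proof (rule sum_norm_le[where 'a = real, unfolded real_norm_def])
      fix k
      have "0 \<le> Bernstein n k x" using x by (intro Bernstein_nonneg) auto
      then show "\<bar>(f (real k / real n) - of_rat (q k)) * Bernstein n k x\<bar> \<le> \<epsilon> / 2 * Bernstein n k x"
        using q[of k] by (simp only: abs_mult abs_of_nonneg) (intro mult_right_mono, auto)
    qed
    also have "\<dots> = \<epsilon> / 2 * (\<Sum>k\<le>n. Bernstein n k x)" by (rule sum_distrib_left[symmetric])
    also have "\<dots> = \<epsilon> / 2" by simp
    finally show ?thesis using n[OF x] unfolding fx p by linarith
  qed
  then show thesis by (rule that)
qed

section \<open>The space of cadlag paths\<close>

lemma cadlag_on_cong:
  assumes "\<And>t. t \<in> I \<Longrightarrow> x t = y t"
  shows "cadlag_on I x \<longleftrightarrow> cadlag_on I y"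
proof -
  have eq: "(x \<longlongrightarrow> l) (at t within I \<inter> A) \<longleftrightarrow> (y \<longlongrightarrow> l) (at t within I \<inter> A)" for t l A
    by (rule Lim_cong_within) (auto simp: assms)
  show ?thesis unfolding cadlag_on_def using eq assms by (intro ball_cong refl) simp
qed

lemma cadlag_on_add:
  fixes x y :: "real \<Rightarrow> real"
  assumes "cadlag_on I x" "cadlag_on I y"
  shows "cadlag_on I (\<lambda>t. x t + y t)"
  using assms unfolding cadlag_on_def by (metis tendsto_add)

lemma cadlag_on_mult:
  fixes x y :: "real \<Rightarrow> real"
  assumes "cadlag_on I x" "cadlag_on I y"
  shows "cadlag_on I (\<lambda>t. x t * y t)"
  using assms unfolding cadlag_on_def by (metis tendsto_mult)

lemma cadlag_on_continuous:
  assumes "continuous_on I x"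
  shows "cadlag_on I x"
proof -
  have "(x \<longlongrightarrow> x t) (at t within I \<inter> A)" if "t \<in> I" for t A
  proof (rule tendsto_within_subset)
    show "(x \<longlongrightarrow> x t) (at t within I)" using assms that by (auto simp: continuous_on_def)
  qed simp
  then show ?thesis unfolding cadlag_on_def by blast
qed

lemma restrict_in_cadlag_paths: "cadlag_on I x \<Longrightarrow> (\<lambda>t\<in>I. x t) \<in> cadlag_paths I"
  unfolding cadlag_paths_def using cadlag_on_cong[of I "\<lambda>t\<in>I. x t" x] by auto

lemma space_cadlag_space: "space (cadlag_space I) = cadlag_paths I"
  by (auto simp: cadlag_space_def space_restrict_space space_PiM cadlag_paths_def PiE_def)

lemma measurable_cadlag_spaceI:
  assumes "\<And>\<omega>. \<omega> \<in> space M \<Longrightarrow> cadlag_on I (\<lambda>t. Y t \<omega>)" "\<And>t. t \<in> I \<Longrightarrow> Y t \<in> borel_measurable M"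
  shows "(\<lambda>\<omega>. \<lambda>t\<in>I. Y t \<omega>) \<in> M \<rightarrow>\<^sub>M cadlag_space I"
  unfolding cadlag_space_def using assms
  by (intro measurable_restrict_space2 measurable_restrict) (auto intro: restrict_in_cadlag_paths)

text \<open>Every measurable set of paths is the trace of a set measurable in the product, so
  agreement of the laws there is enough.\<close>

lemma distr_cadlag_space_eq:
  assumes Y: "Y \<in> M \<rightarrow>\<^sub>M cadlag_space I" and Z: "Z \<in> M \<rightarrow>\<^sub>M cadlag_space I"
    and eq: "distr M (Pi\<^sub>M I (\<lambda>_. borel)) Y = distr M (Pi\<^sub>M I (\<lambda>_. borel)) Z"
  shows "distr M (cadlag_space I) Y = distr M (cadlag_space I) Z"
proof (rule measure_eqI)
  fix A assume "A \<in> sets (distr M (cadlag_space I) Y)"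
  then have A: "A \<in> sets (cadlag_space I)" by simp
  then obtain A' where A': "A' \<in> sets (Pi\<^sub>M I (\<lambda>_. borel))" "A = cadlag_paths I \<inter> A'"
    unfolding cadlag_space_def sets_restrict_space by auto
  have *: "emeasure (distr M (cadlag_space I) Y) A = emeasure (distr M (Pi\<^sub>M I (\<lambda>_. borel)) Y) A'"
    if Y: "Y \<in> M \<rightarrow>\<^sub>M cadlag_space I" for Y
  proof -
    have Y': "Y \<in> M \<rightarrow>\<^sub>M Pi\<^sub>M I (\<lambda>_. borel)" using Y unfolding cadlag_space_def by (rule measurable_restrict_space2_iff[THEN iffD1, THEN conjunct1])
    have "Y -` A \<inter> space M = Y -` A' \<inter> space M"
      using measurable_space[OF Y] by (auto simp: A' space_cadlag_space)
    then show ?thesis using A A' Y Y' by (simp add: emeasure_distr)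
  qed
  show "emeasure (distr M (cadlag_space I) Y) A = emeasure (distr M (cadlag_space I) Z) A"
    using *[OF Y] *[OF Z] eq by simp
qed simp

text \<open>Basic neighbourhoods need not be open, so the estimate is read off from the openness of
  the preimage of a ball around \<open>\<Phi> x\<close>.\<close>

lemma continuous_map_loc_unif:
  assumes \<Phi>: "continuous_map (loc_unif_topology I) euclideanreal \<Phi>" and x: "x \<in> cadlag_paths I" and \<epsilon>: "\<epsilon> > 0"
  obtains K \<delta> where "compact K" "K \<subseteq> I" "\<delta> > 0"
    "\<And>y. y \<in> cadlag_paths I \<Longrightarrow> (\<And>t. t \<in> K \<Longrightarrow> \<bar>y t - x t\<bar> < \<delta>) \<Longrightarrow> \<bar>\<Phi> y - \<Phi> x\<bar> < \<epsilon>"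
proof -
  have "openin (loc_unif_topology I) {y \<in> topspace (loc_unif_topology I). \<Phi> y \<in> ball (\<Phi> x) \<epsilon>}"
    using \<Phi> by (auto simp: continuous_map)
  then have "loc_unif_open I {y \<in> cadlag_paths I. \<Phi> y \<in> ball (\<Phi> x) \<epsilon>}"
    by (simp only: openin_loc_unif_topology topspace_loc_unif_topology)
  moreover have "x \<in> {y \<in> cadlag_paths I. \<Phi> y \<in> ball (\<Phi> x) \<epsilon>}" using x \<epsilon> by simp
  ultimately obtain K \<delta> where K: "compact K" "K \<subseteq> I" "\<delta> > 0"
    "{y \<in> cadlag_paths I. \<forall>t\<in>K. \<bar>y t - x t\<bar> < \<delta>} \<subseteq> {y \<in> cadlag_paths I. \<Phi> y \<in> ball (\<Phi> x) \<epsilon>}"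
    unfolding loc_unif_open_def by meson
  show thesis
  proof (rule that[OF K(1-3)])
    fix y assume "y \<in> cadlag_paths I" "\<And>t. t \<in> K \<Longrightarrow> \<bar>y t - x t\<bar> < \<delta>"
    then have "\<Phi> y \<in> ball (\<Phi> x) \<epsilon>" using K(4) by blast
    then show "\<bar>\<Phi> y - \<Phi> x\<bar> < \<epsilon>" by (simp add: dist_real_def abs_minus_commute)
  qed
qed

section \<open>Continuous functionals under continuous perturbations\<close>

text \<open>Exhaustion by compact intervals, so that \<open>{0..}\<close> and \<open>{0<..}\<close>
  are treated at once. The bound by \<open>Suc m\<close> fits the intervals on which rational
  polynomials approximate.\<close>

locale time_exhaustion =
  fixes I :: "real set" and l u :: "nat \<Rightarrow> real"
  assumes lu: "\<And>m. 0 \<le> l m" "\<And>m. l m \<le> u m" "\<And>m. u m \<le> real (Suc m)" "decseq l" "incseq u"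
    and sub: "\<And>m. {l m..u m} \<subseteq> I" and exhaust: "\<And>K. compact K \<Longrightarrow> K \<subseteq> I \<Longrightarrow> \<exists>m. K \<subseteq> {l m..u m}"
begin

lemma mono: "m \<le> n \<Longrightarrow> {l m..u m} \<subseteq> {l n..u n}"
  using lu(4,5) by (auto simp: decseq_def incseq_def intro: order_trans)

text \<open>The topology is not separable, but continuous perturbations of a path form a separable class. Hence
  the set of paths at which \<open>\<Phi>\<close> has oscillation at most \<open>\<epsilon>\<close> under such perturbations of size
  \<open>1 / Suc m\<close> on \<open>{l m..u m}\<close> is given by countably many conditions and is measurable.\<close>

definition steady_paths :: "((real \<Rightarrow> real) \<Rightarrow> real) \<Rightarrow> real \<Rightarrow> nat \<Rightarrow> (real \<Rightarrow> real) set" where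
  "steady_paths \<Phi> \<epsilon> m = {x \<in> cadlag_paths I. \<forall>N qs. (\<forall>t\<in>{l m..u m}. \<bar>rational_polynomial N qs t\<bar> < 1 / real (Suc m)) \<longrightarrow>
     \<bar>\<Phi> (\<lambda>t\<in>I. x t + rational_polynomial N qs t) - \<Phi> x\<bar> \<le> \<epsilon>}"

lemma shift_measurable:
  assumes "continuous_on I d"
  shows "(\<lambda>x. \<lambda>t\<in>I. x t + d t) \<in> cadlag_space I \<rightarrow>\<^sub>M cadlag_space I"
proof (rule measurable_cadlag_spaceI)
  fix x assume "x \<in> space (cadlag_space I)"
  then show "cadlag_on I (\<lambda>t. x t + d t)"
    using cadlag_on_continuous[OF assms] by (intro cadlag_on_add) (auto simp: space_cadlag_space cadlag_paths_def)
next
  fix t assume "t \<in> I"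
  then have "(\<lambda>x. x t) \<in> borel_measurable (cadlag_space I)"
    unfolding cadlag_space_def by (intro measurable_restrict_space1 measurable_component_singleton)
  then show "(\<lambda>x. x t + d t) \<in> borel_measurable (cadlag_space I)" by measurable
qed

lemma steady_paths_measurable:
  assumes \<Phi>: "\<Phi> \<in> borel_measurable (cadlag_space I)"
  shows "steady_paths \<Phi> \<epsilon> m \<in> sets (cadlag_space I)"
proof -
  have "(\<lambda>x. \<Phi> (\<lambda>t\<in>I. x t + rational_polynomial N qs t)) \<in> borel_measurable (cadlag_space I)" for N qs
    by (rule measurable_compose[OF shift_measurable[OF continuous_on_rational_polynomial] \<Phi>])
  then have [measurable]: "(\<lambda>x. \<bar>\<Phi> (\<lambda>t\<in>I. x t + rational_polynomial N qs t) - \<Phi> x\<bar>) \<in> borel_measurable (cadlag_space I)" for N qs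
    using \<Phi> by (intro borel_measurable_abs borel_measurable_diff)
  have "{x \<in> space (cadlag_space I). \<forall>N qs. (\<forall>t\<in>{l m..u m}. \<bar>rational_polynomial N qs t\<bar> < 1 / real (Suc m)) \<longrightarrow>
     \<bar>\<Phi> (\<lambda>t\<in>I. x t + rational_polynomial N qs t) - \<Phi> x\<bar> \<le> \<epsilon>} \<in> sets (cadlag_space I)"
    by (intro sets.sets_Collect_countable_All sets.sets_Collect_imp sets.sets_Collect_const borel_measurable_le) auto
  then show ?thesis by (simp add: steady_paths_def space_cadlag_space)
qed

lemma steady_paths_mono: "m \<le> n \<Longrightarrow> steady_paths \<Phi> \<epsilon> m \<subseteq> steady_paths \<Phi> \<epsilon> n"
proof -
  assume mn: "m \<le> n"
  then have "1 / real (Suc n) \<le> 1 / real (Suc m)" by (intro divide_left_mono) auto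
  then have "\<forall>t\<in>{l m..u m}. \<bar>d t\<bar> < 1 / real (Suc m)" if "\<forall>t\<in>{l n..u n}. \<bar>d t\<bar> < 1 / real (Suc n)" for d :: "real \<Rightarrow> real"
    using that mono[OF mn] by (meson less_le_trans subsetD)
  then show ?thesis unfolding steady_paths_def by blast
qed

text \<open>Continuity at \<open>x\<close> involves one compact set and one radius, and both are
  reached for large \<open>m\<close>. Hence steady sets with large \<open>m\<close> carry nearly all
  mass of a given law.\<close>

lemma UN_steady_paths:
  assumes \<Phi>: "continuous_map (loc_unif_topology I) euclideanreal \<Phi>" and \<epsilon>: "\<epsilon> > 0"
  shows "(\<Union>m. steady_paths \<Phi> \<epsilon> m) = cadlag_paths I"
proof (intro equalityI subsetI)
  fix x assume x: "x \<in> cadlag_paths I"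
  obtain K \<delta> where K: "compact K" "K \<subseteq> I" "\<delta> > 0"
    "\<And>y. y \<in> cadlag_paths I \<Longrightarrow> (\<And>t. t \<in> K \<Longrightarrow> \<bar>y t - x t\<bar> < \<delta>) \<Longrightarrow> \<bar>\<Phi> y - \<Phi> x\<bar> < \<epsilon>"
    using continuous_map_loc_unif[OF \<Phi> x \<epsilon>] by metis
  obtain m1 where m1: "K \<subseteq> {l m1..u m1}" using exhaust[OF K(1,2)] by blast
  obtain m2 where m2: "1 / real (Suc m2) < \<delta>" using K(3) by (rule nat_approx_posE)
  define m where "m = max m1 m2"
  have "1 / real (Suc m) \<le> 1 / real (Suc m2)" by (intro divide_left_mono) (auto simp: m_def)
  then have m: "K \<subseteq> {l m..u m}" "1 / real (Suc m) < \<delta>" using m1 m2 mono[of m1 m] by (auto simp: m_def)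
  have "x \<in> steady_paths \<Phi> \<epsilon> m" unfolding steady_paths_def
  proof (intro CollectI conjI x allI impI)
    fix N qs assume d: "\<forall>t\<in>{l m..u m}. \<bar>rational_polynomial N qs t\<bar> < 1 / real (Suc m)"
    have "\<bar>\<Phi> (\<lambda>t\<in>I. x t + rational_polynomial N qs t) - \<Phi> x\<bar> < \<epsilon>"
    proof (rule K(4))
      show "(\<lambda>t\<in>I. x t + rational_polynomial N qs t) \<in> cadlag_paths I"
        using x cadlag_on_add[OF _ cadlag_on_continuous[OF continuous_on_rational_polynomial]]
        by (intro restrict_in_cadlag_paths) (simp add: cadlag_paths_def)
      fix t assume "t \<in> K"
      then have "t \<in> I" "\<bar>rational_polynomial N qs t\<bar> < 1 / real (Suc m)" using K(2) m d by auto
      then show "\<bar>(\<lambda>t\<in>I. x t + rational_polynomial N qs t) t - x t\<bar> < \<delta>" using m by simp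
    qed
    then show "\<bar>\<Phi> (\<lambda>t\<in>I. x t + rational_polynomial N qs t) - \<Phi> x\<bar> \<le> \<epsilon>" by simp
  qed
  then show "x \<in> (\<Union>m. steady_paths \<Phi> \<epsilon> m)" by blast
qed (auto simp: steady_paths_def)

text \<open>From countably many perturbations to all continuous ones: \<open>y - x\<close> is
  approximated by a rational polynomial on an interval large enough both for the constraint and for
  the continuity of \<open>\<Phi>\<close> at \<open>y\<close>.\<close>

lemma steady_paths_oscillation:
  assumes \<Phi>: "continuous_map (loc_unif_topology I) euclideanreal \<Phi>" and x: "x \<in> steady_paths \<Phi> \<epsilon> m"
    and y: "y \<in> cadlag_paths I" and yx: "continuous_on I (\<lambda>t. y t - x t)"
    and close: "\<And>t. t \<in> {l m..u m} \<Longrightarrow> \<bar>y t - x t\<bar> \<le> 1 / real (Suc (Suc m))"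
  shows "\<bar>\<Phi> y - \<Phi> x\<bar> \<le> \<epsilon>"
proof (rule field_le_epsilon)
  fix \<eta> :: real assume \<eta>: "\<eta> > 0"
  have xp: "x \<in> cadlag_paths I" using x by (simp add: steady_paths_def)
  obtain K \<delta> where K: "compact K" "K \<subseteq> I" "\<delta> > 0"
    "\<And>v. v \<in> cadlag_paths I \<Longrightarrow> (\<And>t. t \<in> K \<Longrightarrow> \<bar>v t - y t\<bar> < \<delta>) \<Longrightarrow> \<bar>\<Phi> v - \<Phi> y\<bar> < \<eta>"
    using continuous_map_loc_unif[OF \<Phi> y \<eta>] by metis
  obtain k where k: "K \<subseteq> {l k..u k}" using exhaust[OF K(1,2)] by blast
  define n where "n = max k m"
  have n: "K \<subseteq> {l n..u n}" "{l m..u m} \<subseteq> {l n..u n}" using k mono[of k n] mono[of m n] by (auto simp: n_def)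
  \<comment> \<open>The gap between \<open>1 / Suc m\<close> and \<open>1 / Suc (Suc m)\<close> is
    the room that keeps the approximating polynomial within the strict bound.\<close>
  define e where "e = min \<delta> (1 / real (Suc m) - 1 / real (Suc (Suc m)))"
  have e: "e > 0" using K(3) by (simp add: e_def divide_simps)
  obtain qs where qs: "\<And>t. t \<in> {l n..u n} \<Longrightarrow> \<bar>(y t - x t) - rational_polynomial n qs t\<bar> < e"
    using rational_polynomial_approximation[OF continuous_on_subset[OF yx sub] lu(1-3) e] by metis
  define v where "v = (\<lambda>t\<in>I. x t + rational_polynomial n qs t)"
  have vp: "v \<in> cadlag_paths I" unfolding v_def
    using xp cadlag_on_add[OF _ cadlag_on_continuous[OF continuous_on_rational_polynomial]]
    by (intro restrict_in_cadlag_paths) (simp add: cadlag_paths_def)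
  have "\<bar>rational_polynomial n qs t\<bar> < 1 / real (Suc m)" if "t \<in> {l m..u m}" for t
  proof -
    have "\<bar>(y t - x t) - rational_polynomial n qs t\<bar> < e" using qs n(2) that by blast
    moreover have "e \<le> 1 / real (Suc m) - 1 / real (Suc (Suc m))" by (simp add: e_def)
    ultimately show ?thesis using close[OF that] by linarith
  qed
  then have "\<bar>\<Phi> v - \<Phi> x\<bar> \<le> \<epsilon>" using x unfolding steady_paths_def v_def by blast
  moreover have "\<bar>\<Phi> v - \<Phi> y\<bar> < \<eta>"
  proof (rule K(4)[OF vp])
    fix t assume t: "t \<in> K"
    then have "\<bar>(y t - x t) - rational_polynomial n qs t\<bar> < \<delta>" using qs[of t] n by (auto simp: e_def)
    moreover have "v t = x t + rational_polynomial n qs t" using t K(2) by (auto simp: v_def)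
    ultimately show "\<bar>v t - y t\<bar> < \<delta>" by linarith
  qed
  ultimately show "\<bar>\<Phi> y - \<Phi> x\<bar> \<le> \<epsilon> + \<eta>" by linarith
qed

text \<open>\<open>U\<close> has exactly the law of \<open>Z\<close>. On paths of \<open>U\<close>
  in a steady set the continuous, vanishing difference eventually changes \<open>\<Phi>\<close> by
  at most \<open>\<epsilon>\<close>; the paths outside are rare, uniformly in \<open>c\<close>,
  since the law of \<open>U\<close> does not depend on \<open>c\<close>.\<close>

lemma converges_in_distribution_loc_unifI:
  fixes Y U :: "real \<Rightarrow> real \<Rightarrow> 'a \<Rightarrow> real" and Z :: "real \<Rightarrow> 'a \<Rightarrow> real"
  assumes M: "prob_space M"
    and Y: "\<And>c. c > 0 \<Longrightarrow> (\<lambda>\<omega>. \<lambda>t\<in>I. Y c t \<omega>) \<in> M \<rightarrow>\<^sub>M cadlag_space I"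
    and U: "\<And>c. c > 0 \<Longrightarrow> (\<lambda>\<omega>. \<lambda>t\<in>I. U c t \<omega>) \<in> M \<rightarrow>\<^sub>M cadlag_space I"
    and Z: "(\<lambda>\<omega>. \<lambda>t\<in>I. Z t \<omega>) \<in> M \<rightarrow>\<^sub>M cadlag_space I"
    and law: "\<And>c. c > 0 \<Longrightarrow> distr M (Pi\<^sub>M I (\<lambda>_. borel)) (\<lambda>\<omega>. \<lambda>t\<in>I. U c t \<omega>) =
      distr M (Pi\<^sub>M I (\<lambda>_. borel)) (\<lambda>\<omega>. \<lambda>t\<in>I. Z t \<omega>)"
    and cont: "AE \<omega> in M. \<forall>c>0. continuous_on I (\<lambda>t. Y c t \<omega> - U c t \<omega>)"
    and close: "AE \<omega> in M. \<forall>m. \<forall>\<epsilon>>0. eventually (\<lambda>c. \<forall>t\<in>{l m..u m}. \<bar>Y c t \<omega> - U c t \<omega>\<bar> \<le> \<epsilon>) at_top"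
  shows "converges_in_distribution_loc_unif I M Y Z at_top"
  unfolding converges_in_distribution_loc_unif_def
proof (intro conjI allI impI)
  interpret prob_space M by fact
  show "eventually (\<lambda>c. (\<lambda>\<omega>. \<lambda>t\<in>I. Y c t \<omega>) \<in> M \<rightarrow>\<^sub>M cadlag_space I) at_top"
    using eventually_gt_at_top[of 0] by eventually_elim (rule Y)
  show "(\<lambda>\<omega>. \<lambda>t\<in>I. Z t \<omega>) \<in> M \<rightarrow>\<^sub>M cadlag_space I" by (rule Z)
  fix \<Phi> :: "(real \<Rightarrow> real) \<Rightarrow> real"
  assume \<Phi>: "continuous_map (loc_unif_topology I) euclideanreal \<Phi>"
    and \<Phi>m: "\<Phi> \<in> borel_measurable (cadlag_space I)" and \<Phi>b: "bounded (\<Phi> ` cadlag_paths I)"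
  obtain C where C: "C > 0" "\<And>x. x \<in> cadlag_paths I \<Longrightarrow> \<bar>\<Phi> x\<bar> \<le> C"
    using \<Phi>b by (auto simp: bounded_pos)
  define y where "y c \<omega> = (\<lambda>t\<in>I. Y c t \<omega>)" for c \<omega>
  define v where "v c \<omega> = (\<lambda>t\<in>I. U c t \<omega>)" for c \<omega>
  define z where "z \<omega> = (\<lambda>t\<in>I. Z t \<omega>)" for \<omega>
  have ym: "y c \<in> M \<rightarrow>\<^sub>M cadlag_space I" and vm: "v c \<in> M \<rightarrow>\<^sub>M cadlag_space I" if "c > 0" for c
    using Y[OF that] U[OF that] by (simp_all add: y_def[abs_def] v_def[abs_def])
  have zm: "z \<in> M \<rightarrow>\<^sub>M cadlag_space I" using Z by (simp add: z_def[abs_def])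
  have yp: "y c \<omega> \<in> cadlag_paths I" "v c \<omega> \<in> cadlag_paths I" if "c > 0" "\<omega> \<in> space M" for c \<omega>
    using measurable_space[OF ym that(2)] measurable_space[OF vm that(2)] that(1) by (auto simp: space_cadlag_space)
  have zp: "z \<omega> \<in> cadlag_paths I" if "\<omega> \<in> space M" for \<omega>
    using measurable_space[OF zm that] by (simp add: space_cadlag_space)
  have law': "distr M (cadlag_space I) (v c) = distr M (cadlag_space I) z" if "c > 0" for c
    using distr_cadlag_space_eq[OF vm[OF that] zm] law[OF that] by (simp add: v_def[abs_def] z_def[abs_def])
  have \<Phi>y: "(\<lambda>\<omega>. \<Phi> (y c \<omega>)) \<in> borel_measurable M" and \<Phi>v: "(\<lambda>\<omega>. \<Phi> (v c \<omega>)) \<in> borel_measurable M" if "c > 0" for c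
    by (rule measurable_compose[OF ym[OF that] \<Phi>m] measurable_compose[OF vm[OF that] \<Phi>m])+
  have inty: "integrable M (\<lambda>\<omega>. \<Phi> (y c \<omega>))" and intv: "integrable M (\<lambda>\<omega>. \<Phi> (v c \<omega>))" if "c > 0" for c
    using C(2) yp[OF that] \<Phi>y[OF that] \<Phi>v[OF that] by (auto intro!: integrable_const_bound[where B = C])
  have intz: "(\<integral>\<omega>. \<Phi> (v c \<omega>) \<partial>M) = (\<integral>\<omega>. \<Phi> (z \<omega>) \<partial>M)" if "c > 0" for c
    using integral_distr[OF vm[OF that] \<Phi>m] integral_distr[OF zm \<Phi>m] law'[OF that] by simp
  have "((\<lambda>c. \<integral>\<omega>. \<Phi> (y c \<omega>) \<partial>M) \<longlongrightarrow> (\<integral>\<omega>. \<Phi> (z \<omega>) \<partial>M)) at_top"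
  proof (rule tendsto_at_topI_sequentially)
    fix c0 :: "nat \<Rightarrow> real" assume c0: "filterlim c0 at_top sequentially"
    \<comment> \<open>Truncation at 1 gives positive parameters for all indices and leaves the tail
      of the sequence unchanged.\<close>
    define c where "c n = max 1 (c0 n)" for n
    have c: "c n > 0" for n by (simp add: c_def)
    have c_lim: "filterlim c at_top sequentially"
      by (rule filterlim_at_top_mono[OF c0]) (simp add: c_def)
    have "(\<lambda>n. \<integral>\<omega>. \<Phi> (y (c n) \<omega>) \<partial>M) \<longlonglongrightarrow> (\<integral>\<omega>. \<Phi> (z \<omega>) \<partial>M)"
    proof (rule tendstoI)
      fix \<eta> :: real assume \<eta>: "\<eta> > 0"
      define \<epsilon> where "\<epsilon> = \<eta> / 4"
      have \<epsilon>: "\<epsilon> > 0" using \<eta> by (simp add: \<epsilon>_def)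
      define A where "A = steady_paths \<Phi> \<epsilon>"
      have A: "A m \<in> sets (cadlag_space I)" for m unfolding A_def by (rule steady_paths_measurable[OF \<Phi>m])
      define P where "P m = {\<omega> \<in> space M. z \<omega> \<notin> A m}" for m
      have P: "P m \<in> events" for m
      proof -
        have "P m = space M - z -` A m \<inter> space M" by (auto simp: P_def)
        then show ?thesis using measurable_sets[OF zm A[of m]] by auto
      qed
      have "(\<lambda>m. prob (P m)) \<longlonglongrightarrow> prob (\<Inter>m. P m)"
      proof (rule finite_Lim_measure_decseq)
        have "A i \<subseteq> A j" if "i \<le> j" for i j using steady_paths_mono[OF that] by (simp add: A_def)
        then show "decseq P" by (auto simp: decseq_def P_def)
      qed (use P in auto)
      moreover have "(\<Inter>m. P m) = {}"
      proof (rule equals0I)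
        fix \<omega> assume "\<omega> \<in> (\<Inter>m. P m)"
        then have "\<omega> \<in> space M" "z \<omega> \<notin> (\<Union>m. A m)" by (auto simp: P_def)
        then show False using UN_steady_paths[OF \<Phi> \<epsilon>] zp by (simp add: A_def)
      qed
      ultimately have "(\<lambda>m. prob (P m)) \<longlonglongrightarrow> 0" by simp
      then have "eventually (\<lambda>m. prob (P m) < \<epsilon> / (2 * C)) sequentially"
        using \<epsilon> C by (intro order_tendstoD) auto
      \<comment> \<open>\<open>2 * C\<close> bounds any change of \<open>\<Phi>\<close>, so the
        exceptional paths contribute less than \<open>\<epsilon>\<close>.\<close>
      then obtain m where m: "prob (P m) < \<epsilon> / (2 * C)" by (auto simp: eventually_sequentially)
      \<comment> \<open>The maximum with \<open>\<epsilon>\<close> makes \<open>h n\<close>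
        eventually equal to \<open>\<epsilon>\<close> at almost every sample point, so dominated
        convergence applies to its integrals.\<close>
      define h where "h n \<omega> = max \<epsilon> (indicator (A m) (v (c n) \<omega>) * \<bar>\<Phi> (y (c n) \<omega>) - \<Phi> (v (c n) \<omega>)\<bar>)" for n \<omega>
      have Q: "{\<omega> \<in> space M. v (c n) \<omega> \<notin> A m} \<in> events" and PQ: "prob {\<omega> \<in> space M. v (c n) \<omega> \<notin> A m} = prob (P m)" for n
      proof -
        have pre: "{\<omega> \<in> space M. w \<omega> \<notin> A m} = w -` (space (cadlag_space I) - A m) \<inter> space M"
          if "w \<in> M \<rightarrow>\<^sub>M cadlag_space I" for w
          using measurable_space[OF that] by auto
        have cA: "space (cadlag_space I) - A m \<in> sets (cadlag_space I)" using A by auto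
        show "{\<omega> \<in> space M. v (c n) \<omega> \<notin> A m} \<in> events"
          unfolding pre[OF vm[OF c]] by (rule measurable_sets[OF vm[OF c] cA])
        show "prob {\<omega> \<in> space M. v (c n) \<omega> \<notin> A m} = prob (P m)"
          unfolding P_def pre[OF vm[OF c]] pre[OF zm] measure_distr[OF vm[OF c] cA, symmetric] measure_distr[OF zm cA, symmetric]
          by (simp only: law'[OF c])
      qed
      have ind: "(\<lambda>\<omega>. indicator (A m) (v (c n) \<omega>) :: real) \<in> borel_measurable M" for n
        by (rule measurable_compose[OF vm[OF c] borel_measurable_indicator[OF A]])
      have h_meas: "h n \<in> borel_measurable M" for n
        unfolding h_def[abs_def] using ind \<Phi>y[OF c] \<Phi>v[OF c] by measurable
      have diff_le: "\<bar>\<Phi> (y (c n) \<omega>) - \<Phi> (v (c n) \<omega>)\<bar> \<le> 2 * C" if "\<omega> \<in> space M" for n \<omega>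
        using C(2)[OF yp(1)[OF c that], of n] C(2)[OF yp(2)[OF c that], of n] by linarith
      have h_bound: "\<bar>h n \<omega>\<bar> \<le> max \<epsilon> (2 * C)" if "\<omega> \<in> space M" for n \<omega>
        using diff_le[OF that, of n] C \<epsilon> by (auto simp: h_def indicator_def)
      have "(\<lambda>n. \<integral>\<omega>. h n \<omega> \<partial>M) \<longlonglongrightarrow> (\<integral>\<omega>. \<epsilon> \<partial>M)"
      proof (rule integral_dominated_convergence[where w = "\<lambda>_. max \<epsilon> (2 * C)"])
        show "AE \<omega> in M. (\<lambda>n. h n \<omega>) \<longlonglongrightarrow> \<epsilon>"
          using cont close AE_space
        proof eventually_elim
          case (elim \<omega>)
          have "eventually (\<lambda>c. \<forall>t\<in>{l m..u m}. \<bar>Y c t \<omega> - U c t \<omega>\<bar> \<le> 1 / real (Suc (Suc m))) at_top"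
            by (rule elim(2)[rule_format]) simp
          then have "eventually (\<lambda>n. \<forall>t\<in>{l m..u m}. \<bar>Y (c n) t \<omega> - U (c n) t \<omega>\<bar> \<le> 1 / real (Suc (Suc m))) sequentially"
            by (rule eventually_compose_filterlim[OF _ c_lim])
          then have "eventually (\<lambda>n. h n \<omega> = \<epsilon>) sequentially"
          proof eventually_elim
            case (elim n)
            have "\<bar>\<Phi> (y (c n) \<omega>) - \<Phi> (v (c n) \<omega>)\<bar> \<le> \<epsilon>" if "v (c n) \<omega> \<in> A m"
            proof (rule steady_paths_oscillation[OF \<Phi> that[unfolded A_def]])
              show "y (c n) \<omega> \<in> cadlag_paths I" using yp c \<open>\<omega> \<in> space M\<close> by blast
              have "continuous_on I (\<lambda>t. Y (c n) t \<omega> - U (c n) t \<omega>)" using \<open>\<forall>c>0. _\<close> c by blast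
              then show "continuous_on I (\<lambda>t. y (c n) \<omega> t - v (c n) \<omega> t)"
                by (rule continuous_on_eq) (auto simp: y_def v_def)
              show "\<bar>y (c n) \<omega> t - v (c n) \<omega> t\<bar> \<le> 1 / real (Suc (Suc m))" if "t \<in> {l m..u m}" for t
                using elim that sub[of m] by (auto simp: y_def v_def)
            qed
            then show ?case using \<epsilon> by (auto simp: h_def indicator_def)
          qed
          then show ?case by (rule tendsto_eventually)
        qed
        show "AE \<omega> in M. norm (h n \<omega>) \<le> max \<epsilon> (2 * C)" for n
          using h_bound by (intro AE_I2) auto
      qed (use h_meas in auto)
      then have "(\<lambda>n. \<integral>\<omega>. h n \<omega> \<partial>M) \<longlonglongrightarrow> \<epsilon>" by (simp add: prob_space)
      then have "eventually (\<lambda>n. (\<integral>\<omega>. h n \<omega> \<partial>M) < 2 * \<epsilon>) sequentially"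
        using \<epsilon> by (intro order_tendstoD) auto
      then show "eventually (\<lambda>n. dist (\<integral>\<omega>. \<Phi> (y (c n) \<omega>) \<partial>M) (\<integral>\<omega>. \<Phi> (z \<omega>) \<partial>M) < \<eta>) sequentially"
      proof eventually_elim
        case (elim n)
        define Q where "Q = {\<omega> \<in> space M. v (c n) \<omega> \<notin> A m}"
        have inth: "integrable M (h n)"
          using h_bound h_meas by (intro integrable_const_bound[where B = "max \<epsilon> (2 * C)"]) auto
        have intQ: "integrable M (\<lambda>\<omega>. 2 * C * indicator Q \<omega>)"
          using Q[of n] by (intro integrable_mult_right integrable_real_indicator) (auto simp: Q_def emeasure_eq_measure)
        have "\<bar>(\<integral>\<omega>. \<Phi> (y (c n) \<omega>) \<partial>M) - (\<integral>\<omega>. \<Phi> (z \<omega>) \<partial>M)\<bar> = \<bar>\<integral>\<omega>. \<Phi> (y (c n) \<omega>) - \<Phi> (v (c n) \<omega>) \<partial>M\<bar>"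
          using inty[OF c] intv[OF c] by (simp add: intz[OF c])
        also have "\<dots> \<le> (\<integral>\<omega>. \<bar>\<Phi> (y (c n) \<omega>) - \<Phi> (v (c n) \<omega>)\<bar> \<partial>M)" by (rule integral_abs_bound)
        also have "\<dots> \<le> (\<integral>\<omega>. h n \<omega> + 2 * C * indicator Q \<omega> \<partial>M)"
        proof (rule integral_mono)
          show "\<bar>\<Phi> (y (c n) \<omega>) - \<Phi> (v (c n) \<omega>)\<bar> \<le> h n \<omega> + 2 * C * indicator Q \<omega>" if "\<omega> \<in> space M" for \<omega>
            using diff_le[OF that, of n] that \<epsilon> by (auto simp: h_def Q_def indicator_def)
        qed (use inty[OF c] intv[OF c] inth intQ in auto)
        also have "\<dots> = (\<integral>\<omega>. h n \<omega> \<partial>M) + 2 * C * prob (P m)"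
          using inth intQ Q[of n] PQ[of n] by (simp add: Q_def)
        also have "2 * C * prob (P m) < \<epsilon>" using m C by (simp add: field_simps)
        finally show ?case using elim by (simp add: \<epsilon>_def dist_real_def)
      qed
    qed
    moreover have "eventually (\<lambda>n. c n = c0 n) sequentially"
      using c0 by (auto simp: filterlim_at_top c_def elim!: eventually_mono dest: spec[of _ 1])
    ultimately show "(\<lambda>n. \<integral>\<omega>. \<Phi> (y (c0 n) \<omega>) \<partial>M) \<longlonglongrightarrow> (\<integral>\<omega>. \<Phi> (z \<omega>) \<partial>M)"
      by (rule Lim_transform_eventually[OF _ eventually_mono]) simp
  qed
  then show "((\<lambda>c. \<integral>\<omega>. \<Phi> (\<lambda>t\<in>I. Y c t \<omega>) \<partial>M) \<longlongrightarrow> (\<integral>\<omega>. \<Phi> (\<lambda>t\<in>I. Z t \<omega>) \<partial>M)) at_top"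
    by (simp add: y_def z_def)
qed

end

section \<open>Fluctuations of the solution\<close>

lemma cadlag_on_subset:
  assumes "cadlag_on J x" "I \<subseteq> J"
  shows "cadlag_on I x"
proof -
  have "(x \<longlongrightarrow> l) (at t within I \<inter> A)" if "(x \<longlongrightarrow> l) (at t within J \<inter> A)" for l t A
    by (rule tendsto_within_subset[OF that]) (use assms(2) in blast)
  then show ?thesis using assms unfolding cadlag_on_def by blast
qed

text \<open>Strict monotonicity sends one-sided approach to approach from the same side that avoids
  the limit point.\<close>

lemma cadlag_on_time_change:
  fixes g :: "real \<Rightarrow> real"
  assumes x: "cadlag_on {0..} x" and g: "continuous_on {0..} g" "strict_mono_on {0..} g" "\<And>t. t \<ge> 0 \<Longrightarrow> g t \<ge> 0"
  shows "cadlag_on {0..} (\<lambda>t. x (g t))"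
proof -
  have lim: "filterlim g (at (g t) within {0..} \<inter> B) (at t within {0..} \<inter> A)"
    if t: "t \<ge> 0" and AB: "\<And>s. s \<in> A \<Longrightarrow> s \<ge> 0 \<Longrightarrow> g s \<in> B \<and> g s \<noteq> g t" for t A B
  proof -
    have "(g \<longlongrightarrow> g t) (at t within {0..} \<inter> A)"
    proof (rule tendsto_within_subset)
      show "(g \<longlongrightarrow> g t) (at t within {0..})" using g(1) t by (auto simp: continuous_on_def)
    qed simp
    moreover have "eventually (\<lambda>s. s \<in> {0..} \<inter> A) (at t within {0..} \<inter> A)"
      by (simp add: eventually_at_filter)
    then have "eventually (\<lambda>s. g s \<in> {0..} \<inter> B \<and> g s \<noteq> g t) (at t within {0..} \<inter> A)"
      by eventually_elim (use AB g(3) in auto)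
    ultimately show ?thesis by (simp add: filterlim_at)
  qed
  show ?thesis unfolding cadlag_on_def
  proof (intro ballI conjI)
    fix t :: real assume t: "t \<in> {0..}"
    then have gt: "g t \<in> {0..}" using g(3) by simp
    then obtain l where r: "(x \<longlongrightarrow> x (g t)) (at (g t) within {0..} \<inter> {g t<..})"
      and l: "(x \<longlongrightarrow> l) (at (g t) within {0..} \<inter> {..<g t})"
      using x unfolding cadlag_on_def by blast
    have sm: "g s < g u" if "0 \<le> s" "s < u" for s u using g(2) that by (auto simp: strict_mono_on_def)
    show "((\<lambda>t. x (g t)) \<longlongrightarrow> x (g t)) (at t within {0..} \<inter> {t<..})"
    proof (rule filterlim_compose[OF r lim])
      show "g s \<in> {g t<..} \<and> g s \<noteq> g t" if "s \<in> {t<..}" "s \<ge> 0" for s using sm[of t s] that t by auto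
    qed (use t in auto)
    have "((\<lambda>t. x (g t)) \<longlongrightarrow> l) (at t within {0..} \<inter> {..<t})"
    proof (rule filterlim_compose[OF l lim])
      show "g s \<in> {..<g t} \<and> g s \<noteq> g t" if "s \<in> {..<t}" "s \<ge> 0" for s using sm[of s t] that by auto
    qed (use t in auto)
    then show "\<exists>l. ((\<lambda>t. x (g t)) \<longlongrightarrow> l) (at t within {0..} \<inter> {..<t})" by blast
  qed
qed

lemma continuous_on_powr_nonneg:
  fixes e :: real
  assumes "e > 0"
  shows "continuous_on {0..} (\<lambda>t. t powr e)"
  using assms by (intro continuous_on_powr' continuous_on_id continuous_on_const) auto

text \<open>Large arguments are governed by the little-o, with \<open>\<delta>\<close> tuned to
  contribute \<open>\<epsilon> / 2\<close>; arguments \<open>c * t \<le> T\<close> lie in a compact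
  interval where \<open>D\<close> is bounded, and division by a growing power makes them
  negligible.\<close>

lemma smallo_sup_scaling:
  fixes D :: "real \<Rightarrow> real"
  assumes D: "continuous_on {0..} D" "D \<in> o[at_top](\<lambda>t. t powr q)" and q: "q > 0" and \<rho>: "\<rho> > 0" and \<epsilon>: "\<epsilon> > 0" and N: "N > 0"
  shows "eventually (\<lambda>c. \<forall>t\<in>{0..N}. \<bar>D (c * t) / (c / \<rho>) powr q\<bar> \<le> \<epsilon>) at_top"
proof -
  define \<delta> where "\<delta> = \<epsilon> / (2 * (N * \<rho>) powr q)"
  have \<delta>: "\<delta> > 0" using \<epsilon> N \<rho> by (simp add: \<delta>_def)
  have "eventually (\<lambda>t. norm (D t) \<le> \<delta> * norm (t powr q)) at_top" using D(2) \<delta> by (rule landau_o.smallD)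
  then obtain T0 where T0: "\<And>t. t \<ge> T0 \<Longrightarrow> \<bar>D t\<bar> \<le> \<delta> * t powr q" by (auto simp: eventually_at_top_linorder)
  define T where "T = max 0 T0"
  have "compact (D ` {0..T})" by (intro compact_continuous_image continuous_on_subset[OF D(1)]) auto
  then have "bounded (D ` {0..T})" by (rule compact_imp_bounded)
  then obtain C where C: "\<forall>x\<in>D ` {0..T}. norm x \<le> C" unfolding bounded_iff ..
  have "((\<lambda>c. max C 0 * \<rho> powr q * c powr (- q)) \<longlongrightarrow> 0) at_top"
    by (intro tendsto_mult_right_zero tendsto_neg_powr filterlim_ident) (use q in auto)
  then have "eventually (\<lambda>c. max C 0 * \<rho> powr q * c powr (- q) < \<epsilon> / 2) at_top"
    using \<epsilon> by (intro order_tendstoD) auto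
  then show ?thesis using eventually_gt_at_top[of 0]
  proof eventually_elim
    case (elim c)
    show ?case
    proof
      fix t assume t: "t \<in> {0..N}"
      have "\<bar>D (c * t)\<bar> \<le> max C 0 + \<delta> * (c * N) powr q"
      proof (cases "c * t \<le> T")
        case True
        then have "norm (D (c * t)) \<le> C" using C t elim by (intro C[rule_format] imageI) auto
        then show ?thesis using \<delta> by (simp add: add_increasing2)
      next
        case False
        then have "\<bar>D (c * t)\<bar> \<le> \<delta> * (c * t) powr q" by (intro T0) (auto simp: T_def)
        also have "\<dots> \<le> \<delta> * (c * N) powr q"
          using \<delta> t elim q by (intro mult_left_mono powr_mono2) auto
        finally show ?thesis by simp
      qed
      then have "\<bar>D (c * t)\<bar> / (c / \<rho>) powr q \<le> (max C 0 + \<delta> * (c * N) powr q) / (c / \<rho>) powr q"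
        by (intro divide_right_mono) auto
      also have "\<dots> = max C 0 * \<rho> powr q * c powr (- q) + \<delta> * (N * \<rho>) powr q"
        using elim \<rho> N by (simp add: powr_divide powr_mult powr_minus field_simps)
      also have "\<delta> * (N * \<rho>) powr q = \<epsilon> / 2" using N \<rho> by (simp add: \<delta>_def)
      finally show "\<bar>D (c * t) / (c / \<rho>) powr q\<bar> \<le> \<epsilon>" using elim by simp
    qed
  qed
qed

text \<open>\<open>x - b\<close> is a primitive of the cadlag path \<open>f (x s)\<close>, so it has
  a right derivative at every time, though in general no two-sided one.\<close>

lemma solves_sde_right_derivative:
  assumes x: "cadlag_on {0..} x" and f: "continuous_on UNIV f"
    and eq: "\<And>t. t \<ge> 0 \<Longrightarrow> x t = x 0 + (LBINT s:{0..t}. f (x s)) + b t"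
  shows "continuous_on {0..} (\<lambda>t. x t - b t)"
    and "t \<ge> 0 \<Longrightarrow> ((\<lambda>t. x t - b t) has_real_derivative f (x t)) (at_right t)"
proof -
  have fx: "cadlag_on {0..} (\<lambda>s. f (x s))" by (rule cadlag_on_compose[OF x f])
  have int: "(\<lambda>s. f (x s)) integrable_on {0..t}" for t by (rule cadlag_on_integral(1)[OF fx]) simp
  have eq': "x t - b t = x 0 + integral {0..t} (\<lambda>s. f (x s))" if "t \<ge> 0" for t
    using eq[OF that] cadlag_on_integral(2)[OF fx, of 0 t] by simp
  have "continuous_on {0..} (\<lambda>t. x 0 + integral {0..t} (\<lambda>s. f (x s)))"
    by (intro continuous_intros continuous_on_atLeastI indefinite_integral_continuous_1 int)
  then show "continuous_on {0..} (\<lambda>t. x t - b t)" by (rule continuous_on_eq) (auto simp: eq')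
  assume t: "t \<ge> 0"
  have "((\<lambda>s. f (x s)) \<longlongrightarrow> f (x t)) (at_right t)" by (rule cadlag_on_right[OF fx]) (use t in auto)
  then have "((\<lambda>t. x 0 + integral {0..t} (\<lambda>s. f (x s))) has_real_derivative 0 + f (x t)) (at_right t)"
    by (intro derivative_intros integral_right_derivative int t)
  then have d: "((\<lambda>t. x 0 + integral {0..t} (\<lambda>s. f (x s))) has_real_derivative f (x t)) (at t within {t..})"
    by (simp add: at_within_Ici_at_right)
  have "((\<lambda>t. x t - b t) has_real_derivative f (x t)) (at t within {t..})"
    by (rule has_field_derivative_transform_within[OF d zero_less_one]) (use t in \<open>auto simp: eq'\<close>)
  then show "((\<lambda>t. x t - b t) has_real_derivative f (x t)) (at_right t)" by (simp add: at_within_Ici_at_right)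
qed

context stable_process
begin

text \<open>Countably many exponents \<open>1 / Suc k\<close> give one null set for all
  \<open>\<epsilon>\<close>.\<close>

lemma AE_growth_power:
  "AE \<omega> in M. \<forall>\<epsilon>>0. \<exists>C. \<forall>t\<ge>1. \<bar>B t \<omega>\<bar> \<le> C * t powr (1 / \<alpha> + \<epsilon>)"
proof -
  have "AE \<omega> in M. \<forall>k::nat. \<exists>C. \<forall>t\<ge>0. \<bar>B t \<omega>\<bar> \<le> C * (1 + t) powr (1 / \<alpha> + 1 / real (Suc k))"
    unfolding AE_all_countable by (intro allI AE_growth_at_top) simp
  then show ?thesis
  proof eventually_elim
    case (elim \<omega>)
    show ?case
    proof (intro allI impI)
      fix \<epsilon> :: real assume "\<epsilon> > 0"
      then obtain k :: nat where k: "1 / real (Suc k) < \<epsilon>" by (rule nat_approx_posE)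
      obtain C where C: "\<And>t. t \<ge> 0 \<Longrightarrow> \<bar>B t \<omega>\<bar> \<le> C * (1 + t) powr (1 / \<alpha> + 1 / real (Suc k))" using elim by blast
      define e where "e = 1 / \<alpha> + 1 / real (Suc k)"
      have e: "0 < e" "e \<le> 1 / \<alpha> + \<epsilon>" using \<alpha>_pos k by (auto simp: e_def intro: add_pos_pos)
      have "\<bar>B t \<omega>\<bar> \<le> (\<bar>C\<bar> * 2 powr e) * t powr (1 / \<alpha> + \<epsilon>)" if t: "t \<ge> 1" for t
      proof -
        have "\<bar>B t \<omega>\<bar> \<le> C * (1 + t) powr e" using C[of t] t by (simp add: e_def)
        also have "\<dots> \<le> \<bar>C\<bar> * (1 + t) powr e" by (intro mult_right_mono) auto
        also have "\<dots> \<le> \<bar>C\<bar> * (2 * t) powr e" using t e by (intro mult_left_mono powr_mono2) auto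
        also have "(2 * t) powr e = 2 powr e * t powr e" using t by (simp add: powr_mult)
        also have "\<bar>C\<bar> * (2 powr e * t powr e) \<le> \<bar>C\<bar> * (2 powr e * t powr (1 / \<alpha> + \<epsilon>))"
          using t e by (intro mult_left_mono powr_mono) auto
        finally show ?thesis by simp
      qed
      then show "\<exists>C. \<forall>t\<ge>1. \<bar>B t \<omega>\<bar> \<le> C * t powr (1 / \<alpha> + \<epsilon>)" by blast
    qed
  qed
qed

text \<open>On one almost sure event the restart property gives the rate of \<open>X\<close>; the
  growth of \<open>B\<close> and the Euler equation for \<open>w\<close> then bound the
  remainder.\<close>

lemma AE_sde_fluctuation:
  assumes a: "a > 0" and \<beta>: "1 - \<alpha> < \<beta>" "\<beta> < 1 / (1 + \<alpha>)"
    and c: "c = (a * (1 - \<beta>)) powr (1 / (1 - \<beta>))" and \<gamma>: "\<gamma> = \<beta> / (1 - \<beta>)" and r: "r = (\<alpha> + \<beta> - 1) / \<alpha>"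
    and f: "continuous_on UNIV f" "(\<lambda>x. f x - a * x powr \<beta>) \<in> o[at_top](\<lambda>x. x powr (\<beta> - r))"
    and X: "solves_sde M F f B X" "AE \<omega> in M. filterlim (\<lambda>t. X t \<omega>) at_top at_top"
  shows "AE \<omega> in M. \<exists>w D. continuous_on {0..} w \<and> (\<forall>t\<ge>0. t powr \<gamma> * stable_integral \<gamma> t \<omega> = B t \<omega> + w t) \<and>
    continuous_on {0..} D \<and> D \<in> o[at_top](\<lambda>t. t powr (1 / \<alpha>)) \<and>
    (\<forall>t\<ge>0. X t \<omega> - c * t powr (1 / (1 - \<beta>)) = t powr \<gamma> * stable_integral \<gamma> t \<omega> + D t)"
proof -
  define p where "p = 1 / (1 - \<beta>)"
  define q where "q = 1 / \<alpha>"
  have \<alpha>\<beta>: "\<alpha> * \<beta> < 1 - \<beta>" using \<beta>(2) \<alpha>_pos by (simp add: field_simps)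
  have "1 / (1 + \<alpha>) < 1" using \<alpha>_pos by simp
  then have \<beta>1: "\<beta> < 1" using \<beta>(2) by linarith
  have p0: "p > 0" using \<beta>1 by (simp add: p_def)
  have "\<alpha> * \<gamma> < 1" using \<alpha>\<beta> \<beta>1 by (simp add: \<gamma> divide_less_eq)
  then have q: "\<gamma> < q" "1 - \<alpha> * \<gamma> > 0" using \<alpha>_pos by (simp_all add: q_def field_simps)
  have qp: "q < p" using \<beta>(1) \<beta>1 \<alpha>_pos by (simp add: q_def p_def field_simps)
  have pr: "p * (\<beta> - r) = q - 1"
  proof -
    have "\<beta> - r = (1 - \<alpha>) * (1 - \<beta>) / \<alpha>" using \<alpha>_pos by (simp add: r field_simps)
    then have "p * (\<beta> - r) = (1 - \<alpha>) / \<alpha>" using \<beta>1 by (simp add: p_def)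
    then show ?thesis using \<alpha>_pos by (simp add: q_def diff_divide_distrib)
  qed
  have r0: "r > 0" using \<beta>(1) \<alpha>_pos by (simp add: r)
  have f_lim: "((\<lambda>x. f x / x powr \<beta>) \<longlongrightarrow> a) at_top"
  proof -
    have "(\<lambda>x::real. x powr (\<beta> - r)) \<in> o[at_top](\<lambda>x. x powr \<beta>)" using r0 by real_asymp
    from landau_o.small_trans[OF f(2) this] have "((\<lambda>x. (f x - a * x powr \<beta>) / x powr \<beta>) \<longlongrightarrow> 0) at_top"
      by (rule smalloD_tendsto)
    then have "((\<lambda>x. (f x - a * x powr \<beta>) / x powr \<beta> + a) \<longlongrightarrow> 0 + a) at_top" by (intro tendsto_intros)
    then have "((\<lambda>x. (f x - a * x powr \<beta>) / x powr \<beta> + a) \<longlongrightarrow> a) at_top" by simp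
    then show ?thesis
      by (rule Lim_transform_eventually)
        (use eventually_gt_at_top[of 0] in \<open>eventually_elim, simp add: diff_divide_distrib\<close>)
  qed
  have Xc: "\<And>\<omega>. \<omega> \<in> space M \<Longrightarrow> cadlag_on {0..} (\<lambda>t. X t \<omega>)" and Xm: "\<And>t. t \<ge> 0 \<Longrightarrow> X t \<in> borel_measurable M"
    using X(1) by (auto simp: solves_sde_def cadlag_adapted_def intro: measurable_from_subalg[OF subalgebra])
  have eq: "AE \<omega> in M. \<forall>t\<ge>0. X t \<omega> = X 0 \<omega> + (LBINT s:{0..t}. f (X s \<omega>)) + B t \<omega>"
    using X(1) by (simp add: solves_sde_def)
  have restart: "AE \<omega> in M. \<forall>\<delta>>0. \<forall>N. \<exists>T\<ge>0. \<exists>n\<ge>N. X T \<omega> \<ge> n powr p \<and>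
      (\<forall>s\<ge>0. \<bar>B (T + s) \<omega> - B T \<omega>\<bar> \<le> \<delta> * (n + s) powr p)"
    by (rule AE_restart[OF _ Xm X(2)]) (use qp in \<open>simp_all add: q_def\<close>)
  show ?thesis
    using eq restart AE_growth_power AE_stable_integral_path[OF q(2)] AE_space
  proof eventually_elim
    case (elim \<omega>)
    have V: "continuous_on {0..} (\<lambda>t. X t \<omega> - B t \<omega>)"
      "\<And>t. t \<ge> 0 \<Longrightarrow> ((\<lambda>t. X t \<omega> - B t \<omega>) has_real_derivative f (X t \<omega>)) (at_right t)"
      using solves_sde_right_derivative[OF Xc[OF elim(5)] f(1), of "\<lambda>t. B t \<omega>"] elim(1) by blast+
    have "((\<lambda>t. X t \<omega> / t powr p) \<longlongrightarrow> (a * (1 - \<beta>)) powr p) at_top"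
      by (rule power_flow_asymptotics[OF a \<beta>1 p_def f_lim V]) (use elim(2) in auto)
    then have X_asymp: "((\<lambda>t. X t \<omega> / t powr p) \<longlongrightarrow> c) at_top" by (simp add: c p_def)
    obtain w where w: "\<And>t. t > 0 \<Longrightarrow> t powr \<gamma> * stable_integral \<gamma> t \<omega> = B t \<omega> + w t" "continuous_on {0<..} w"
      "\<And>t. t > 0 \<Longrightarrow> (w has_real_derivative \<gamma> * (w t + B t \<omega>) / t) (at_right t)" "(w \<longlongrightarrow> 0) (at_right 0)"
      using elim(4) by blast
    have "(\<lambda>t. X t \<omega> - c * t powr p - B t \<omega> - w t) \<in> o[at_top](\<lambda>t. t powr q)"
    proof (rule flow_fluctuation_asymptotics[OF a \<beta>1 p_def _ \<gamma> q(1) qp pr f(2) X_asymp])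
      show "c = (a * (1 - \<beta>)) powr p" by (simp add: c p_def)
      show "continuous_on {0<..} (\<lambda>t. X t \<omega> - B t \<omega>)" by (rule continuous_on_subset[OF V(1)]) auto
      show "\<exists>C. \<forall>t\<ge>1. \<bar>B t \<omega>\<bar> \<le> C * t powr (q + \<epsilon>)" if "\<epsilon> > 0" for \<epsilon>
        using elim(3) that by (simp add: q_def)
    qed (use V w in auto)
    \<comment> \<open>At time 0 the weighted integral and \<open>B\<close> both vanish, and
      \<open>w\<close> tends to 0, so this value extends both the identity and the continuity to
      \<open>{0..}\<close>.\<close>
    define w0 where "w0 t = (if t = 0 then 0 else w t)" for t
    define D where "D t = X t \<omega> - c * t powr p - B t \<omega> - w0 t" for t
    have w0: "continuous_on {0..} w0"
      unfolding continuous_on_def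
    proof
      fix t :: real assume t: "t \<in> {0..}"
      show "(w0 \<longlongrightarrow> w0 t) (at t within {0..})"
      proof (cases "t = 0")
        case True
        have "eventually (\<lambda>t. w t = w0 t) (at_right 0)"
          using eventually_at_right_less[of "0::real"] by eventually_elim (simp add: w0_def)
        then have "(w0 \<longlongrightarrow> 0) (at_right 0)" by (rule Lim_transform_eventually[OF w(4)])
        then show ?thesis using True by (simp add: at_within_Ici_at_right w0_def)
      next
        case False
        then have "t > 0" using t by simp
        have at: "at t within {0..} = at t"
          by (rule at_within_open_subset[of t "{0<..}"]) (use \<open>t > 0\<close> in auto)
        have "(w \<longlongrightarrow> w t) (at t within {0<..})" using w(2) \<open>t > 0\<close> by (simp add: continuous_on_def)
        then have "(w \<longlongrightarrow> w t) (at t)" using at_within_open[of t "{0<..}"] \<open>t > 0\<close> by simp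
        moreover have "eventually (\<lambda>s. w s = w0 s) (at t)"
          by (rule eventually_mono[OF eventually_at_in_open'[of "{0<..}" t]]) (use \<open>t > 0\<close> in \<open>auto simp: w0_def\<close>)
        ultimately have "(w0 \<longlongrightarrow> w t) (at t)" by (rule Lim_transform_eventually)
        then show ?thesis using False by (simp add: at w0_def)
      qed
    qed
    have w0_eq: "t powr \<gamma> * stable_integral \<gamma> t \<omega> = B t \<omega> + w0 t" if "t \<ge> 0" for t
      using w(1)[of t] that B_0[OF elim(5)] by (cases "t = 0") (auto simp: w0_def)
    have "continuous_on {0..} (\<lambda>t. (X t \<omega> - B t \<omega>) - c * t powr p - w0 t)"
      by (rule continuous_on_diff[OF continuous_on_diff[OF V(1) continuous_on_mult[OF continuous_on_const
            continuous_on_powr_nonneg[OF p0]]] w0])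
    then have "continuous_on {0..} D" unfolding D_def by (simp add: algebra_simps)
    moreover have "D \<in> o[at_top](\<lambda>t. t powr q)"
    proof (rule landau_o.small.in_cong[THEN iffD1])
      show "(\<lambda>t. X t \<omega> - c * t powr p - B t \<omega> - w t) \<in> o[at_top](\<lambda>t. t powr q)" by fact
      show "eventually (\<lambda>t. X t \<omega> - c * t powr p - B t \<omega> - w t = D t) at_top"
        using eventually_gt_at_top[of 0] by eventually_elim (simp add: D_def w0_def)
    qed
    moreover have "X t \<omega> - c * t powr p = t powr \<gamma> * stable_integral \<gamma> t \<omega> + D t" if "t \<ge> 0" for t
      using w0_eq[OF that] by (simp add: D_def)
    ultimately show ?case using w0 w0_eq unfolding p_def q_def by blast
  qed
qed


section \<open>Exact scaling of the comparison process and convergence\<close>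

text \<open>The origin of the normalisation: \<open>c powr \<gamma>\<close> in front and
  \<open>(c powr \<rho> / \<rho>) powr (1 / \<alpha>)\<close> from self-similarity multiply to
  \<open>(c / \<rho>) powr (1 / \<alpha>)\<close>, as
  \<open>\<gamma> + \<rho> / \<alpha> = 1 / \<alpha>\<close>. The law is that of the limit for every
  \<open>c\<close>, not only asymptotically.\<close>

lemma scaled_stable_integral_law:
  fixes k :: "real \<Rightarrow> real"
  assumes \<rho>: "\<rho> = 1 - \<alpha> * \<gamma>" "\<rho> > 0" and c: "c > 0" and I: "I \<subseteq> {0..}"
  shows "distr M (Pi\<^sub>M I (\<lambda>_. borel)) (\<lambda>\<omega>. \<lambda>t\<in>I. k t * ((c * t) powr \<gamma> * stable_integral \<gamma> (c * t) \<omega> / (c / \<rho>) powr (1 / \<alpha>))) =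
    distr M (Pi\<^sub>M I (\<lambda>_. borel)) (\<lambda>\<omega>. \<lambda>t\<in>I. k t * (t powr \<gamma> * B (t powr \<rho>) \<omega>))"
proof -
  define K where "K t = k t * ((c * t) powr \<gamma> / (c / \<rho>) powr (1 / \<alpha>))" for t
  define l where "l = c powr \<rho> / \<rho>"
  have l: "l > 0" using c \<rho> by (simp add: l_def)
  have map: "(\<lambda>y. \<lambda>t\<in>I. K t * y (g t)) \<in> Pi\<^sub>M {0..} (\<lambda>_. borel) \<rightarrow>\<^sub>M Pi\<^sub>M I (\<lambda>_. borel)"
    if "\<And>t. t \<in> I \<Longrightarrow> g t \<ge> 0" for g :: "real \<Rightarrow> real"
    using that by (intro measurable_restrict borel_measurable_times borel_measurable_const measurable_component_singleton) auto
  have Jm: "stable_integral \<gamma> t \<in> borel_measurable M" if "t \<ge> 0" for t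
    using measurable_from_subalg[OF subalgebra stable_integral_adapted[OF _ that]] \<rho> by simp
  have pm: "(\<lambda>\<omega>. \<lambda>t\<in>{0..}. Y t \<omega>) \<in> M \<rightarrow>\<^sub>M Pi\<^sub>M {0..} (\<lambda>_. borel)" if "\<And>t. t \<ge> 0 \<Longrightarrow> Y t \<in> borel_measurable M" for Y :: "real \<Rightarrow> 'a \<Rightarrow> real"
    using that by (intro measurable_restrict) auto
  \<comment> \<open>Both sides are images of process laws on \<open>{0..}\<close> under the same
    measurable map, so equality survives weights and time changes.\<close>
  have transfer: "distr M (Pi\<^sub>M I (\<lambda>_. borel)) (\<lambda>\<omega>. \<lambda>t\<in>I. K t * Y (g t) \<omega>) = distr M (Pi\<^sub>M I (\<lambda>_. borel)) (\<lambda>\<omega>. \<lambda>t\<in>I. K t * Z (g t) \<omega>)"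
    if Y: "\<And>t. t \<ge> 0 \<Longrightarrow> Y t \<in> borel_measurable M" and Z: "\<And>t. t \<ge> 0 \<Longrightarrow> Z t \<in> borel_measurable M"
      and eq: "distr M (Pi\<^sub>M {0..} (\<lambda>_. borel)) (\<lambda>\<omega>. \<lambda>t\<in>{0..}. Y t \<omega>) = distr M (Pi\<^sub>M {0..} (\<lambda>_. borel)) (\<lambda>\<omega>. \<lambda>t\<in>{0..}. Z t \<omega>)"
      and g: "\<And>t. t \<in> I \<Longrightarrow> g t \<ge> 0" for Y Z :: "real \<Rightarrow> 'a \<Rightarrow> real" and g
  proof -
    have *: "distr M (Pi\<^sub>M I (\<lambda>_. borel)) (\<lambda>\<omega>. \<lambda>t\<in>I. K t * Y (g t) \<omega>) =
        distr (distr M (Pi\<^sub>M {0..} (\<lambda>_. borel)) (\<lambda>\<omega>. \<lambda>t\<in>{0..}. Y t \<omega>)) (Pi\<^sub>M I (\<lambda>_. borel)) (\<lambda>y. \<lambda>t\<in>I. K t * y (g t))"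
      if Y: "\<forall>t\<ge>0. Y t \<in> borel_measurable M" for Y :: "real \<Rightarrow> 'a \<Rightarrow> real"
    proof -
      have m: "(\<lambda>y. \<lambda>t\<in>I. K t * y (g t)) \<in> Pi\<^sub>M {0..} (\<lambda>_. borel) \<rightarrow>\<^sub>M Pi\<^sub>M I (\<lambda>_. borel)"
        by (rule map) (rule g)
      have m': "(\<lambda>\<omega>. \<lambda>t\<in>{0..}. Y t \<omega>) \<in> M \<rightarrow>\<^sub>M Pi\<^sub>M {0..} (\<lambda>_. borel)" by (rule pm) (use Y in auto)
      show ?thesis
        by (subst distr_distr[OF m m']) (auto simp: o_def g intro!: distr_cong restrict_ext)
    qed
    have "\<forall>t\<ge>0. Y t \<in> borel_measurable M" "\<forall>t\<ge>0. Z t \<in> borel_measurable M" using Y Z by auto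
    from *[OF this(1)] *[OF this(2)] show ?thesis by (simp only: eq)
  qed
  have "distr M (Pi\<^sub>M I (\<lambda>_. borel)) (\<lambda>\<omega>. \<lambda>t\<in>I. k t * ((c * t) powr \<gamma> * stable_integral \<gamma> (c * t) \<omega> / (c / \<rho>) powr (1 / \<alpha>))) =
      distr M (Pi\<^sub>M I (\<lambda>_. borel)) (\<lambda>\<omega>. \<lambda>t\<in>I. K t * stable_integral \<gamma> (c * t) \<omega>)"
    by (simp add: K_def mult.assoc)
  also have "\<dots> = distr M (Pi\<^sub>M I (\<lambda>_. borel)) (\<lambda>\<omega>. \<lambda>t\<in>I. K t * B ((c * t) powr \<rho> / \<rho>) \<omega>)"
    by (rule transfer[OF Jm _ stable_integral_law[OF \<rho>]]) (use \<rho> c I in auto)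
  also have "\<dots> = distr M (Pi\<^sub>M I (\<lambda>_. borel)) (\<lambda>\<omega>. \<lambda>t\<in>I. K t * B (l * t powr \<rho>) \<omega>)"
  proof -
    have "(c * t) powr \<rho> / \<rho> = l * t powr \<rho>" if "t \<in> I" for t
      using that c I by (auto simp: l_def powr_mult)
    then show ?thesis by (intro distr_cong refl restrict_ext) simp
  qed
  also have "\<dots> = distr M (Pi\<^sub>M I (\<lambda>_. borel)) (\<lambda>\<omega>. \<lambda>t\<in>I. K t * (l powr (1 / \<alpha>) * B (t powr \<rho>) \<omega>))"
    by (rule transfer[OF _ _ B_scaling[OF l]]) (use l in auto)
  also have "\<dots> = distr M (Pi\<^sub>M I (\<lambda>_. borel)) (\<lambda>\<omega>. \<lambda>t\<in>I. k t * (t powr \<gamma> * B (t powr \<rho>) \<omega>))"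
  proof -
    have "c powr \<gamma> * c powr (\<rho> / \<alpha>) = c powr (1 / \<alpha>)"
    proof -
      have "\<gamma> + \<rho> / \<alpha> = 1 / \<alpha>" using \<alpha>_pos by (simp add: \<rho>(1) diff_divide_distrib)
      then show ?thesis by (simp add: powr_add[symmetric])
    qed
    then have "c powr \<gamma> / (c / \<rho>) powr (1 / \<alpha>) * l powr (1 / \<alpha>) = 1"
      using c \<rho> by (simp add: l_def powr_divide powr_powr)
    moreover have "K t = k t * t powr \<gamma> * (c powr \<gamma> / (c / \<rho>) powr (1 / \<alpha>))" if "t \<in> I" for t
      using that c I by (auto simp: K_def powr_mult)
    ultimately have "K t * (l powr (1 / \<alpha>) * x) = k t * (t powr \<gamma> * x)" if "t \<in> I" for t x
      using that l by simp
    then show ?thesis by (intro distr_cong refl restrict_ext) simp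
  qed
  finally show ?thesis .
qed


text \<open>The three convergence statements differ in the time set and in the weight
  \<open>k\<close>, which is 1 or \<open>t powr (- \<gamma>)\<close>. The difference between
  \<open>Y\<close> and the comparison process is \<open>k t * D (c * t)\<close> over the
  normalisation, hence continuous and uniformly small on compact intervals.\<close>

lemma scaled_convergence:
  fixes k :: "real \<Rightarrow> real"
  assumes exh: "time_exhaustion I l u" and I: "I \<subseteq> {0..}" and k: "continuous_on {0..} k"
    and \<rho>: "\<rho> = 1 - \<alpha> * \<gamma>" "\<rho> > 0" and p: "p > 0"
    and Xc: "\<And>\<omega>. \<omega> \<in> space M \<Longrightarrow> cadlag_on {0..} (\<lambda>t. X t \<omega>)" and Xm: "\<And>t. t \<ge> 0 \<Longrightarrow> X t \<in> borel_measurable M"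
    and fluct: "AE \<omega> in M. \<exists>w D. continuous_on {0..} w \<and> (\<forall>t\<ge>0. t powr \<gamma> * stable_integral \<gamma> t \<omega> = B t \<omega> + w t) \<and>
      continuous_on {0..} D \<and> D \<in> o[at_top](\<lambda>t. t powr (1 / \<alpha>)) \<and>
      (\<forall>t\<ge>0. X t \<omega> - c\<^sub>1 * t powr p = t powr \<gamma> * stable_integral \<gamma> t \<omega> + D t)"
    and Y: "\<And>c t \<omega>. c > 0 \<Longrightarrow> t \<in> I \<Longrightarrow> Y c t \<omega> = k t * ((X (c * t) \<omega> - c\<^sub>1 * (c * t) powr p) / (c / \<rho>) powr (1 / \<alpha>))"
    and Z: "\<And>t \<omega>. t \<in> I \<Longrightarrow> \<omega> \<in> space M \<Longrightarrow> Z t \<omega> = k t * (t powr \<gamma> * B (t powr \<rho>) \<omega>)"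
    and Zc: "\<And>\<omega>. \<omega> \<in> space M \<Longrightarrow> cadlag_on I (\<lambda>t. Z t \<omega>)"
  shows "converges_in_distribution_loc_unif I M Y Z at_top"
proof -
  interpret time_exhaustion I l u by fact
  define good where "good \<omega> \<longleftrightarrow> (\<exists>w D. continuous_on {0..} w \<and> (\<forall>t\<ge>0. t powr \<gamma> * stable_integral \<gamma> t \<omega> = B t \<omega> + w t) \<and>
      continuous_on {0..} D \<and> D \<in> o[at_top](\<lambda>t. t powr (1 / \<alpha>)) \<and>
      (\<forall>t\<ge>0. X t \<omega> - c\<^sub>1 * t powr p = t powr \<gamma> * stable_integral \<gamma> t \<omega> + D t))" for \<omega>
  have "AE \<omega> in M. good \<omega>" using fluct by (simp add: good_def)
  \<comment> \<open>Measurability of the set of good paths is not known, so a measurable null set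
    containing the others is removed.\<close>
  then obtain N where N: "{\<omega> \<in> space M. \<not> good \<omega>} \<subseteq> N" "emeasure M N = 0" "N \<in> events" by (rule AE_E)
  define G where "G = space M - N"
  have G: "G \<in> events" "\<And>\<omega>. \<omega> \<in> G \<Longrightarrow> good \<omega>" "G \<subseteq> space M" using N by (auto simp: G_def)
  have "AE \<omega> in M. \<omega> \<notin> N" using N by (intro AE_not_in) (auto simp: null_sets_def)
  then have AE_G: "AE \<omega> in M. \<omega> \<in> G" using AE_space by eventually_elim (simp add: G_def)
  define S where "S c = (c / \<rho>) powr (1 / \<alpha>)" for c
  define W where "W c t \<omega> = k t * ((c * t) powr \<gamma> * stable_integral \<gamma> (c * t) \<omega> / S c)" for c t \<omega>
  \<comment> \<open>The value 0 off the good event makes every path cadlag, not just almost every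
    one, as membership in the path space requires.\<close>
  define U where "U c t \<omega> = (if \<omega> \<in> G then W c t \<omega> else 0)" for c t \<omega>
  have scale_cadlag: "cadlag_on {0..} (\<lambda>t. x (c * t))" if "cadlag_on {0..} x" "c > 0" for x c
    by (rule cadlag_on_time_change[OF that(1)])
      (use that(2) in \<open>auto intro!: continuous_intros simp: strict_mono_on_def\<close>)
  have cont_scale: "continuous_on {0..} (\<lambda>t. D (c * t))" if "continuous_on {0..} D" "c > 0" for D :: "real \<Rightarrow> real" and c
    by (rule continuous_on_compose2[OF that(1)]) (use that(2) in \<open>auto intro!: continuous_intros\<close>)
  have const: "cadlag_on {0..} (\<lambda>t. d)" for d by (intro cadlag_on_continuous continuous_intros)
  have Jm: "stable_integral \<gamma> t \<in> borel_measurable M" if "t \<ge> 0" for t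
    using measurable_from_subalg[OF subalgebra stable_integral_adapted[OF _ that]] \<rho> by simp
  have Wm: "W c t \<in> borel_measurable M" if "c > 0" "t \<in> I" for c t
  proof -
    have "c * t \<ge> 0" using that I by auto
    then show ?thesis unfolding W_def[abs_def]
      by (intro borel_measurable_times borel_measurable_divide borel_measurable_const Jm)
  qed
  have Wc: "cadlag_on {0..} (\<lambda>t. W c t \<omega>)" if c: "c > 0" and "\<omega> \<in> G" for c \<omega>
  proof -
    from G(2)[OF that(2)] obtain w where w: "continuous_on {0..} w"
      "\<And>t. t \<ge> 0 \<Longrightarrow> t powr \<gamma> * stable_integral \<gamma> t \<omega> = B t \<omega> + w t" unfolding good_def by blast
    have "cadlag_on {0..} (\<lambda>t. k t * ((B (c * t) \<omega> + w (c * t)) * (1 / S c)))"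
    proof -
      have "\<omega> \<in> space M" using that G(3) by auto
      from cadlag_on_add[OF scale_cadlag[OF B_cadlag[OF this] c] scale_cadlag[OF cadlag_on_continuous[OF w(1)] c]]
      show ?thesis by (rule cadlag_on_mult[OF cadlag_on_continuous[OF k] cadlag_on_mult[OF _ const]])
    qed
    then show ?thesis
      by (rule cadlag_on_cong[THEN iffD1, rotated]) (use w(2) c in \<open>auto simp: W_def\<close>)
  qed
  have UW: "AE \<omega> in M. (\<lambda>t\<in>I. U c t \<omega>) = (\<lambda>t\<in>I. W c t \<omega>)" for c
    using AE_G by eventually_elim (simp add: U_def)
  show ?thesis
  proof (rule converges_in_distribution_loc_unifI[where U = U])
    show "prob_space M" by (rule prob_space_axioms)
    show "(\<lambda>\<omega>. \<lambda>t\<in>I. Y c t \<omega>) \<in> M \<rightarrow>\<^sub>M cadlag_space I" if c: "c > 0" for c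
    proof (rule measurable_cadlag_spaceI)
      fix \<omega> assume \<omega>: "\<omega> \<in> space M"
      have "cadlag_on {0..} (\<lambda>t. c\<^sub>1 * (c * t) powr p)"
        using cont_scale[OF continuous_on_powr_nonneg[OF p] c] by (intro cadlag_on_continuous continuous_on_mult continuous_on_const)
      then have "cadlag_on {0..} (\<lambda>t. k t * ((X (c * t) \<omega> + (- 1) * (c\<^sub>1 * (c * t) powr p)) * (1 / S c)))"
        by (rule cadlag_on_mult[OF cadlag_on_continuous[OF k]
            cadlag_on_mult[OF cadlag_on_add[OF scale_cadlag[OF Xc[OF \<omega>] c] cadlag_on_mult[OF const]] const]])
      then have "cadlag_on I (\<lambda>t. k t * ((X (c * t) \<omega> + (- 1) * (c\<^sub>1 * (c * t) powr p)) * (1 / S c)))"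
        using I by (rule cadlag_on_subset)
      then show "cadlag_on I (\<lambda>t. Y c t \<omega>)"
        by (rule cadlag_on_cong[THEN iffD1, rotated]) (simp add: Y[OF c] S_def)
    next
      fix t assume t: "t \<in> I"
      then have "X (c * t) \<in> borel_measurable M" using c I by (intro Xm) auto
      then show "Y c t \<in> borel_measurable M" unfolding Y[OF c t, abs_def] by measurable
    qed
    show "(\<lambda>\<omega>. \<lambda>t\<in>I. U c t \<omega>) \<in> M \<rightarrow>\<^sub>M cadlag_space I" if c: "c > 0" for c
    proof (rule measurable_cadlag_spaceI)
      show "cadlag_on I (\<lambda>t. U c t \<omega>)" for \<omega>
        using Wc[OF c] const[of 0] cadlag_on_subset[OF _ I] by (cases "\<omega> \<in> G") (auto simp: U_def)
      show "U c t \<in> borel_measurable M" if "t \<in> I" for t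
        using Wm[OF c that] G(1) unfolding U_def[abs_def] by measurable
    qed
    show Zm: "(\<lambda>\<omega>. \<lambda>t\<in>I. Z t \<omega>) \<in> M \<rightarrow>\<^sub>M cadlag_space I"
    proof (rule measurable_cadlag_spaceI[OF Zc])
      fix t assume t: "t \<in> I"
      have "(\<lambda>\<omega>. k t * (t powr \<gamma> * B (t powr \<rho>) \<omega>)) \<in> borel_measurable M" by measurable auto
      then show "Z t \<in> borel_measurable M"
        by (rule measurable_cong[THEN iffD1, rotated]) (simp add: Z[OF t])
    qed
    show "distr M (Pi\<^sub>M I (\<lambda>_. borel)) (\<lambda>\<omega>. \<lambda>t\<in>I. U c t \<omega>) = distr M (Pi\<^sub>M I (\<lambda>_. borel)) (\<lambda>\<omega>. \<lambda>t\<in>I. Z t \<omega>)"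
      if c: "c > 0" for c
    proof -
      have "distr M (Pi\<^sub>M I (\<lambda>_. borel)) (\<lambda>\<omega>. \<lambda>t\<in>I. U c t \<omega>) = distr M (Pi\<^sub>M I (\<lambda>_. borel)) (\<lambda>\<omega>. \<lambda>t\<in>I. W c t \<omega>)"
      proof (rule distr_cong_AE[OF refl refl UW])
        have "U c t \<in> borel_measurable M" if "t \<in> I" for t
          using Wm[OF c that] G(1) unfolding U_def[abs_def] by measurable
        then show "(\<lambda>\<omega>. \<lambda>t\<in>I. U c t \<omega>) \<in> M \<rightarrow>\<^sub>M Pi\<^sub>M I (\<lambda>_. borel)" by (rule measurable_restrict)
        show "(\<lambda>\<omega>. \<lambda>t\<in>I. W c t \<omega>) \<in> M \<rightarrow>\<^sub>M Pi\<^sub>M I (\<lambda>_. borel)" using Wm[OF c] by (rule measurable_restrict)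
      qed
      also have "\<dots> = distr M (Pi\<^sub>M I (\<lambda>_. borel)) (\<lambda>\<omega>. \<lambda>t\<in>I. k t * (t powr \<gamma> * B (t powr \<rho>) \<omega>))"
        unfolding W_def S_def by (rule scaled_stable_integral_law[OF \<rho> c I])
      also have "\<dots> = distr M (Pi\<^sub>M I (\<lambda>_. borel)) (\<lambda>\<omega>. \<lambda>t\<in>I. Z t \<omega>)"
        by (intro distr_cong refl restrict_ext) (simp add: Z)
      finally show ?thesis .
    qed
    have diff: "\<exists>D. continuous_on {0..} D \<and> D \<in> o[at_top](\<lambda>t. t powr (1 / \<alpha>)) \<and>
        (\<forall>c>0. \<forall>t\<in>I. Y c t \<omega> - U c t \<omega> = k t * (D (c * t) / S c))" if \<omega>: "\<omega> \<in> G" for \<omega>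
    proof -
      from G(2)[OF \<omega>] obtain D where D: "continuous_on {0..} D" "D \<in> o[at_top](\<lambda>t. t powr (1 / \<alpha>))"
        "\<And>t. t \<ge> 0 \<Longrightarrow> X t \<omega> - c\<^sub>1 * t powr p = t powr \<gamma> * stable_integral \<gamma> t \<omega> + D t"
        unfolding good_def by blast
      have "Y c t \<omega> - U c t \<omega> = k t * (D (c * t) / S c)" if "c > 0" "t \<in> I" for c t
      proof -
        have "c * t \<ge> 0" using that I by auto
        from D(3)[OF this] have "Y c t \<omega> = k t * (((c * t) powr \<gamma> * stable_integral \<gamma> (c * t) \<omega> + D (c * t)) / S c)"
          by (simp only: Y[OF that] S_def)
        then show ?thesis using \<omega> by (simp add: U_def W_def add_divide_distrib distrib_left)
      qed
      then show ?thesis using D by blast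
    qed
    show "AE \<omega> in M. \<forall>c>0. continuous_on I (\<lambda>t. Y c t \<omega> - U c t \<omega>)"
      using AE_G
    proof eventually_elim
      case (elim \<omega>)
      obtain D where D: "continuous_on {0..} D" "\<forall>c>0. \<forall>t\<in>I. Y c t \<omega> - U c t \<omega> = k t * (D (c * t) / S c)"
        using diff[OF elim] by blast
      show ?case
      proof (intro allI impI)
        fix c :: real assume c: "c > 0"
        have "S c \<noteq> 0" using c \<rho> by (simp add: S_def)
        then have "continuous_on {0..} (\<lambda>t. k t * (D (c * t) / S c))"
          by (intro continuous_intros k cont_scale[OF D(1) c]) auto
        then have "continuous_on I (\<lambda>t. k t * (D (c * t) / S c))" using I by (rule continuous_on_subset)
        then show "continuous_on I (\<lambda>t. Y c t \<omega> - U c t \<omega>)"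
          by (rule continuous_on_eq) (use D(2) c in auto)
      qed
    qed
    show "AE \<omega> in M. \<forall>m. \<forall>\<epsilon>>0. eventually (\<lambda>c. \<forall>t\<in>{l m..u m}. \<bar>Y c t \<omega> - U c t \<omega>\<bar> \<le> \<epsilon>) at_top"
      using AE_G
    proof eventually_elim
      case (elim \<omega>)
      obtain D where D: "continuous_on {0..} D" "D \<in> o[at_top](\<lambda>t. t powr (1 / \<alpha>))"
        "\<forall>c>0. \<forall>t\<in>I. Y c t \<omega> - U c t \<omega> = k t * (D (c * t) / S c)"
        using diff[OF elim] by blast
      show ?case
      proof (intro allI impI)
        fix m and \<epsilon> :: real assume \<epsilon>: "\<epsilon> > 0"
        have "compact (k ` {0..real (Suc m)})" by (intro compact_continuous_image continuous_on_subset[OF k]) auto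
        then have "bounded (k ` {0..real (Suc m)})" by (rule compact_imp_bounded)
        then obtain K where K: "K > 0" "\<forall>x\<in>k ` {0..real (Suc m)}. norm x \<le> K" unfolding bounded_pos by blast
        have "eventually (\<lambda>c. \<forall>t\<in>{0..real (Suc m)}. \<bar>D (c * t) / (c / \<rho>) powr (1 / \<alpha>)\<bar> \<le> \<epsilon> / K) at_top"
          by (rule smallo_sup_scaling[OF D(1,2)]) (use \<alpha>_pos \<rho> \<epsilon> K in auto)
        then show "eventually (\<lambda>c. \<forall>t\<in>{l m..u m}. \<bar>Y c t \<omega> - U c t \<omega>\<bar> \<le> \<epsilon>) at_top"
          using eventually_gt_at_top[of 0]
        proof eventually_elim
          case (elim c)
          show ?case
          proof
            fix t assume t: "t \<in> {l m..u m}"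
            then have tI: "t \<in> I" and tm: "t \<in> {0..real (Suc m)}" using sub[of m] lu(1,3)[of m] by auto
            have "\<bar>Y c t \<omega> - U c t \<omega>\<bar> = \<bar>k t\<bar> * \<bar>D (c * t) / S c\<bar>" using D(3) elim(2) tI by (simp add: abs_mult)
            also have "\<dots> \<le> K * (\<epsilon> / K)"
              using K elim(1) tm by (intro mult_mono) (auto simp: S_def)
            finally show "\<bar>Y c t \<omega> - U c t \<omega>\<bar> \<le> \<epsilon>" using K by simp
          qed
        qed
      qed
    qed
  qed
qed

end

section \<open>Convergence on the open and on the closed half-line\<close>

lemma time_exhaustion_atLeast: "time_exhaustion {0..} (\<lambda>m. 0) (\<lambda>m. real (Suc m))"
proof
  fix K :: "real set" assume K: "compact K" "K \<subseteq> {0..}"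
  obtain b where b: "\<forall>x\<in>K. norm x \<le> b" using compact_imp_bounded[OF K(1)] unfolding bounded_iff ..
  obtain m :: nat where "b \<le> real m" using real_arch_simple by blast
  then have "K \<subseteq> {0..real (Suc m)}" using b K(2) by fastforce
  then show "\<exists>m. K \<subseteq> {0..real (Suc m)}" by blast
qed (auto simp: decseq_def incseq_def)

lemma time_exhaustion_greaterThan: "time_exhaustion {0<..} (\<lambda>m. 1 / real (Suc m)) (\<lambda>m. real (Suc m))"
proof
  fix K :: "real set" assume K: "compact K" "K \<subseteq> {0<..}"
  show "\<exists>m. K \<subseteq> {1 / real (Suc m)..real (Suc m)}"
  proof (cases "K = {}")
    case False
    obtain s where s: "s \<in> K" "\<And>x. x \<in> K \<Longrightarrow> s \<le> x" using compact_attains_inf[OF K(1) False] by blast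
    obtain b where b: "\<forall>x\<in>K. norm x \<le> b" using compact_imp_bounded[OF K(1)] unfolding bounded_iff ..
    have "s > 0" using s K(2) by auto
    obtain m where m: "max b (1 / s) \<le> real m" using real_arch_simple by blast
    then have "1 / real (Suc m) \<le> s" using \<open>s > 0\<close> by (auto simp: field_simps)
    moreover have "x \<le> real (Suc m)" if "x \<in> K" for x using b that m by fastforce
    ultimately have "K \<subseteq> {1 / real (Suc m)..real (Suc m)}" using s(2) by fastforce
    then show ?thesis by blast
  qed auto
next
  show "1 / real (Suc m) \<le> real (Suc m)" for m
    by (rule order_trans[of _ 1]) (auto simp: divide_le_eq_1)
  show "{1 / real (Suc m)..real (Suc m)} \<subseteq> {0<..}" for m
    by (auto intro: less_le_trans[of 0 "1 / real (Suc m)"])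
qed (auto simp: decseq_def incseq_def frac_le)

theorem theorem1p1:
  fixes M :: "'a measure" and F :: "real \<Rightarrow> 'a measure"
    and B X :: "real \<Rightarrow> 'a \<Rightarrow> real" and f :: "real \<Rightarrow> real"
    and \<alpha> \<beta> a c\<^sub>1 \<gamma> \<rho> r cp cm :: real
    and Xs :: "real \<Rightarrow> real \<Rightarrow> 'a \<Rightarrow> real"
  assumes \<alpha>: "\<alpha> \<in> {0<..<2} - {1}"
    and a: "a > 0"
    and \<beta>: "\<beta> \<in> {1 - \<alpha><..<1 / (1 + \<alpha>)}"
    and c\<^sub>1: "c\<^sub>1 = (a * (1 - \<beta>)) powr (1 / (1 - \<beta>))"
    and \<gamma>: "\<gamma> = \<beta> / (1 - \<beta>)"
    and \<rho>: "\<rho> = 1 - \<alpha> * \<beta> / (1 - \<beta>)"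
    and r: "r = (\<alpha> + \<beta> - 1) / \<alpha>"
    and c_pm: "cp \<ge> 0" "cm \<ge> 0" "cp + cm > 0"
    and B: "strictly_stable_process M F \<alpha> B"
    and levy_measure: "has_levy_measure M B (stable_levy_measure \<alpha> cp cm)"
    and f_C1: "f C1_differentiable_on UNIV"
    and f_log_deriv: "(\<lambda>x. deriv (\<lambda>y. ln (f y)) x) \<in> O[at_top](\<lambda>x. 1 / x)"
    and f_asymp: "(\<lambda>x. f x - a * x powr \<beta>) \<in> o[at_top](\<lambda>x. x powr (\<beta> - r))"
    and X: "solves_sde M F f B X"
    and X_lim: "AE \<omega> in M. filterlim (\<lambda>t. X t \<omega>) at_top at_top"
    and Xs: "\<And>l t \<omega>. l > 0 \<Longrightarrow> t \<ge> 0 \<Longrightarrow>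
      Xs l t \<omega> = (X (l * t) \<omega> - c\<^sub>1 * (l * t) powr (1 / (1 - \<beta>))) / (l / \<rho>) powr (1 / \<alpha>)"
  shows "converges_in_distribution_loc_unif {0<..} M Xs (\<lambda>t \<omega>. t powr \<gamma> * B (t powr \<rho>) \<omega>) at_top \<and>
    (\<beta> \<ge> 0 \<longrightarrow>
      converges_in_distribution_loc_unif {0..} M Xs (\<lambda>t \<omega>. t powr \<gamma> * B (t powr \<rho>) \<omega>) at_top) \<and>
    (\<beta> < 0 \<longrightarrow>
      converges_in_distribution_loc_unif {0..} M (\<lambda>l t \<omega>. t powr (- \<gamma>) * Xs l t \<omega>)
        (\<lambda>t \<omega>. B (t powr \<rho>) \<omega>) at_top)"
proof -
  interpret stable_process M F \<alpha> B using B \<alpha> by unfold_locales auto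
  have \<beta>': "1 - \<alpha> < \<beta>" "\<beta> < 1 / (1 + \<alpha>)" using \<beta> by auto
  have "1 / (1 + \<alpha>) < 1" using \<alpha>_pos by simp
  then have \<beta>1: "\<beta> < 1" using \<beta>'(2) by linarith
  have p: "1 / (1 - \<beta>) > 0" using \<beta>1 by simp
  have "\<alpha> * \<beta> < 1 - \<beta>" using \<beta>'(2) \<alpha>_pos by (simp add: field_simps)
  then have \<rho>': "\<rho> = 1 - \<alpha> * \<gamma>" "\<rho> > 0" using \<beta>1 by (simp_all add: \<rho> \<gamma> divide_less_eq)
  have f: "continuous_on UNIV f" by (rule C1_differentiable_imp_continuous_on[OF f_C1])
  have Xc: "\<And>\<omega>. \<omega> \<in> space M \<Longrightarrow> cadlag_on {0..} (\<lambda>t. X t \<omega>)" and Xm: "\<And>t. t \<ge> 0 \<Longrightarrow> X t \<in> borel_measurable M"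
    using X by (auto simp: solves_sde_def cadlag_adapted_def intro: measurable_from_subalg[OF subalgebra])
  note fluct = AE_sde_fluctuation[OF a \<beta>' c\<^sub>1 \<gamma> r f f_asymp X X_lim]
  have B_c: "cadlag_on {0..} (\<lambda>t. B (t powr \<rho>) \<omega>)" if "\<omega> \<in> space M" for \<omega>
  proof (rule cadlag_on_time_change[OF B_cadlag[OF that]])
    show "continuous_on {0..} (\<lambda>t. t powr \<rho>)" using \<rho>'(2) by (rule continuous_on_powr_nonneg)
    show "strict_mono_on {0..} (\<lambda>t. t powr \<rho>)"
      using \<rho>'(2) by (intro strict_mono_onI powr_less_mono2) auto
  qed simp
  note conv = scaled_convergence[OF _ _ _ \<rho>' p Xc Xm fluct]
  have "converges_in_distribution_loc_unif {0<..} M Xs (\<lambda>t \<omega>. t powr \<gamma> * B (t powr \<rho>) \<omega>) at_top"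
  proof (rule conv[OF time_exhaustion_greaterThan, where k = "\<lambda>_. 1"])
    fix \<omega> assume \<omega>: "\<omega> \<in> space M"
    have "cadlag_on {0<..} (\<lambda>t. t powr \<gamma>)" by (intro cadlag_on_continuous continuous_intros) auto
    moreover have "cadlag_on {0<..} (\<lambda>t. B (t powr \<rho>) \<omega>)" by (rule cadlag_on_subset[OF B_c[OF \<omega>]]) auto
    ultimately show "cadlag_on {0<..} (\<lambda>t. t powr \<gamma> * B (t powr \<rho>) \<omega>)" by (rule cadlag_on_mult)
  qed (auto simp: Xs)
  moreover have "converges_in_distribution_loc_unif {0..} M Xs (\<lambda>t \<omega>. t powr \<gamma> * B (t powr \<rho>) \<omega>) at_top" if "\<beta> \<ge> 0"
  proof (rule conv[OF time_exhaustion_atLeast, where k = "\<lambda>_. 1"])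
    fix \<omega> assume \<omega>: "\<omega> \<in> space M"
    show "cadlag_on {0..} (\<lambda>t. t powr \<gamma> * B (t powr \<rho>) \<omega>)"
    \<comment> \<open>Since \<open>0 powr 0 = 0\<close>, the factor \<open>t powr \<gamma>\<close>
      is not continuous at 0 when \<open>\<gamma> = 0\<close>; but \<open>B\<close> vanishes there,
      so the product agrees with \<open>B (t powr \<rho>)\<close>.\<close>
    proof (cases "\<gamma> = 0")
      case True
      show ?thesis
        by (rule cadlag_on_cong[THEN iffD1, OF _ B_c[OF \<omega>]]) (use True B_0[OF \<omega>] in auto)
    next
      case False
      then have "\<gamma> > 0" using that \<beta>1 by (auto simp: \<gamma>)
      then have "cadlag_on {0..} (\<lambda>t. t powr \<gamma>)" by (intro cadlag_on_continuous continuous_on_powr_nonneg)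
      then show ?thesis using B_c[OF \<omega>] by (rule cadlag_on_mult)
    qed
  qed (auto simp: Xs)
  moreover have "converges_in_distribution_loc_unif {0..} M (\<lambda>l t \<omega>. t powr (- \<gamma>) * Xs l t \<omega>) (\<lambda>t \<omega>. B (t powr \<rho>) \<omega>) at_top"
    if "\<beta> < 0"
  \<comment> \<open>For negative \<beta> the exponent \<gamma> is negative: the weight is continuous
    at 0 and cancels the singular factor \<open>t powr \<gamma>\<close> of the limit.\<close>
  proof (rule conv[OF time_exhaustion_atLeast, where k = "\<lambda>t. t powr (- \<gamma>)"])
    have "\<gamma> < 0" using that \<beta>1 by (simp add: \<gamma> divide_less_0_iff)
    then show "continuous_on {0..} (\<lambda>t. t powr (- \<gamma>))" by (intro continuous_on_powr_nonneg) simp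
    \<comment> \<open>At \<open>t = 0\<close> the powers do not cancel but vanish, and
      \<open>B 0\<close> vanishes with them.\<close>
    show "B (t powr \<rho>) \<omega> = t powr (- \<gamma>) * (t powr \<gamma> * B (t powr \<rho>) \<omega>)" if "t \<in> {0..}" "\<omega> \<in> space M" for t \<omega>
      using that B_0 by (cases "t = 0") (auto simp: mult.assoc[symmetric] simp flip: powr_add)
  qed (auto simp: Xs B_c)
  ultimately show ?thesis by blast
qed

end
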